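(* Let $H$ be a real Hilbert space, $F:H\to H$, and $z_0\in H$. Assume: (a) the equation $F(z)=0$ has a unique solution $y\in H$; (b) $F$ is compact and twice Fréchet differentiable, and there are positive constants $N_1,N_2$ with $\|F'(x)\|\le N_1$, $\|F''(x)\|\le N_2$ for all $x\in H$; (c) there exist $\xi\in H$ and $\varepsilon_0>0$ such that $$C:=\sup_{\varepsilon\in(0,\varepsilon_0]}\big\|P_\varepsilon(\xi)T_\varepsilon^{-1}(\xi)\{T(y)-T(\xi)\}\big\|<\tfrac12;$$ (d) $\varepsilon:[0,\infty)\to\mathbb R$ satisfies $0<\varepsilon(t)\le\varepsilon_0$ for all $t\ge 0$. Put $\gamma:=\frac12-C$, $\alpha(t):=\|(P_{\varepsilon(t)}(\xi)-I)(y-z_0)\|$, and $$\Phi(h,t):=(P_{\varepsilon(t)}(\xi)-I)(h-z_0)-P_{\varepsilon(t)}(\xi)T^{-1}_{\varepsilon(t)}(h)F'^{*}(h)F(h).$$ Suppose moreover that: 1. $P(y-z_0)=0$, where $P$ is the orthogonal projector onto the null-space of $T(\xi)$; 2. $\varepsilon(t)$ is continuously differentiable, tends monotonically to $0$ as $t\to+\infty$, and $$C_0:=\min_{t\in[0,+\infty)}\left\{\gamma-\frac{|\dot\varepsilon(t)|}{\varepsilon(t)}\right\}>0;$$ 3. $C_\alpha:=\varepsilon(0)\max_{t\in[0,+\infty)}\left\{\frac{\alpha(t)}{\varepsilon(t)}\right\}<\infty$; 4. $$\frac{4N_1N_2+N_2\sqrt{\varepsilon(0)}}{2C_0}<\varepsilon(0)\min\left\{\frac{C_0}{2C_\alpha},\frac1{\|y-z_0\|}\right\}.$$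 Then the Cauchy problem $\dot z(t)=\Phi(z(t),t)$, $z(0)=z_0$, has a unique solution $z(t)$ for $t\in[0,\infty)$, and $$\|z(t)-y\|\le\frac{2C_0}{4N_1N_2+N_2\sqrt{\varepsilon(0)}}\,\varepsilon(t),\qquad t\ge0.$$
   Context: For $h\in H$, $F'(h)$ is the Fréchet derivative, $F'^{*}(h)$ its adjoint, $T(h):=F'^{*}(h)F'(h)$, and $T_\varepsilon(h):=T(h)+\varepsilon I$ for $\varepsilon>0$, where $I$ is the identity operator. For $\xi\in H$ and $\varepsilon>0$, $P_\varepsilon(\xi):=\int_\varepsilon^{N_1^2}dE(s)$, where $E(s)=E(s,\xi)$ is the resolution of the identity of the self-adjoint operator $T(\xi)$ (whose norm is at most $N_1^2$); that is, $P_\varepsilon(\xi)$ is the spectral projector of $T(\xi)$ for the interval $[\varepsilon,N_1^2]$. A dot denotes the derivative with respect to $t$.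
   Formalization: Since P_{ε(t)}(ξ) may jump, a solution that is differentiable everywhere need not exist; here "solution" means z continuous, with right derivative equal to Φ(z(t),t) for all t≥0 and ordinary derivative equal to it outside a locally finite set of times. *)

theory Defs
  imports "HOL-Analysis.Analysis"
begin

text \<open>
  A real Hilbert space is a type of sort \<open>{real_inner, complete_space}\<close>.  Linear operators
  are plain functions; the Frechet derivative is a map \<open>F' :: 'a \<Rightarrow> ('a \<Rightarrow>\<^sub>L 'a)\<close>, coerced to functions
  by \<open>blinfun_apply\<close>.
\<close>

definition compact_map :: "('a::metric_space \<Rightarrow> 'b::metric_space) \<Rightarrow> bool" where
  "compact_map F \<longleftrightarrow> continuous_on UNIV F \<and> (\<forall>B. bounded B \<longrightarrow> compact (closure (F ` B)))"

definition orthogonal_projector :: "('a::real_inner \<Rightarrow> 'a) \<Rightarrow> bool" where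
  "orthogonal_projector P \<longleftrightarrow>
     bounded_linear P \<and> P \<circ> P = P \<and> (\<forall>x y. P x \<bullet> y = x \<bullet> P y)"

definition orthogonal_projection :: "'a::real_inner set \<Rightarrow> 'a \<Rightarrow> 'a" where
  "orthogonal_projection S x = (THE p. p \<in> S \<and> (\<forall>s\<in>S. (x - p) \<bullet> s = 0))"

text \<open>
  \<open>E\<close> is a resolution of the identity (right-continuous spectral family) of the bounded self-adjoint
  operator \<open>A\<close>.  The representation $A = \int s\,dE(s)$ is taken in the weak sense, with respect to
  the Lebesgue--Stieltjes measures of \<open>s \<mapsto> (E s x, x)\<close>; since \<open>A\<close> is self-adjoint, its quadratic form
  determines it by polarization.
\<close>
definition resolution_of_identity_of :: "('a::real_inner \<Rightarrow> 'a) \<Rightarrow> (real \<Rightarrow> 'a \<Rightarrow> 'a) \<Rightarrow> bool" where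
  "resolution_of_identity_of A E \<longleftrightarrow>
     bounded_linear A \<and> (\<forall>x y. A x \<bullet> y = x \<bullet> A y) \<and>
     (\<forall>s. orthogonal_projector (E s)) \<and>
     (\<forall>s u. s \<le> u \<longrightarrow> E s \<circ> E u = E s \<and> E u \<circ> E s = E s) \<and>
     (\<forall>s x. ((\<lambda>u. E u x) \<longlongrightarrow> E s x) (at_right s)) \<and>
     (\<forall>x. ((\<lambda>s. E s x) \<longlongrightarrow> 0) at_bot) \<and>
     (\<forall>x. ((\<lambda>s. E s x) \<longlongrightarrow> x) at_top) \<and>
     (\<forall>x. has_bochner_integral (interval_measure (\<lambda>s. E s x \<bullet> x)) (\<lambda>s. s) (A x \<bullet> x))"

text \<open>By the spectral theorem such a family exists and is unique, so the choice is harmless.\<close>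
definition resolution_of_identity :: "('a::real_inner \<Rightarrow> 'a) \<Rightarrow> real \<Rightarrow> 'a \<Rightarrow> 'a" where
  "resolution_of_identity A = (SOME E. resolution_of_identity_of A E)"

text \<open>
  $\int_a^b dE(s)$ over the closed interval $[a,b]$, i.e. \<open>E(b) - E(a - 0)\<close>: the left limit keeps the
  spectral mass at the end point \<open>a\<close>.
\<close>
definition spectral_projector :: "('a::real_inner \<Rightarrow> 'a) \<Rightarrow> real \<Rightarrow> real \<Rightarrow> 'a \<Rightarrow> 'a" where
  "spectral_projector A a b x =
     resolution_of_identity A b x - Lim (at_left a) (\<lambda>s. resolution_of_identity A s x)"

definition T_op :: "('a::real_inner \<Rightarrow> ('a \<Rightarrow>\<^sub>L 'a)) \<Rightarrow> 'a \<Rightarrow> 'a \<Rightarrow> 'a" where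
  "T_op F' h = adjoint (blinfun_apply (F' h)) \<circ> blinfun_apply (F' h)"

definition T_reg :: "('a::real_inner \<Rightarrow> ('a \<Rightarrow>\<^sub>L 'a)) \<Rightarrow> real \<Rightarrow> 'a \<Rightarrow> 'a \<Rightarrow> 'a" where
  "T_reg F' e h = (\<lambda>x. T_op F' h x + e *\<^sub>R x)"

definition P_proj :: "('a::real_inner \<Rightarrow> ('a \<Rightarrow>\<^sub>L 'a)) \<Rightarrow> real \<Rightarrow> 'a \<Rightarrow> real \<Rightarrow> 'a \<Rightarrow> 'a" where
  "P_proj F' N1 \<xi> e = spectral_projector (T_op F' \<xi>) e (N1\<^sup>2)"

definition Phi ::
  "('a::real_inner \<Rightarrow> 'a) \<Rightarrow> ('a \<Rightarrow> ('a \<Rightarrow>\<^sub>L 'a)) \<Rightarrow> real \<Rightarrow> 'a \<Rightarrow> 'a \<Rightarrow> (real \<Rightarrow> real) \<Rightarrow> 'a \<Rightarrow> real \<Rightarrow> 'a"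
where
  "Phi F F' N1 \<xi> z\<^sub>0 \<epsilon> h t =
     (P_proj F' N1 \<xi> (\<epsilon> t) (h - z\<^sub>0) - (h - z\<^sub>0)) -
     P_proj F' N1 \<xi> (\<epsilon> t) (inv (T_reg F' (\<epsilon> t) h) (adjoint (blinfun_apply (F' h)) (F h)))"

text \<open>
  Solution on $[0,\infty)$ of \<open>z' = f z t\<close>, \<open>z 0 = z\<^sub>0\<close> for a right-hand side with isolated jumps in \<open>t\<close>.
  The projector $P_{\varepsilon(t)}(\xi)$ jumps whenever $\varepsilon(t)$ crosses an eigenvalue of $T(\xi)$,
  and there a two-sided derivative of \<open>z\<close> need not exist (already for \<open>F z = z\<close> on the real line).
  Hence \<open>z\<close> is continuous, the equation holds with the right derivative at every \<open>t \<ge> 0\<close>, and with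
  the ordinary derivative outside a set having finitely many points in each bounded interval.
\<close>
definition cauchy_solution ::
  "('a::real_normed_vector \<Rightarrow> real \<Rightarrow> 'a) \<Rightarrow> 'a \<Rightarrow> (real \<Rightarrow> 'a) \<Rightarrow> bool" where
  "cauchy_solution f z\<^sub>0 z \<longleftrightarrow>
     z 0 = z\<^sub>0 \<and> continuous_on {0..} z \<and>
     (\<forall>t\<ge>0. (z has_vector_derivative f (z t) t) (at_right t)) \<and>
     (\<exists>D. (\<forall>b. finite (D \<inter> {0..b})) \<and>
          (\<forall>t\<in>{0..} - D. (z has_vector_derivative f (z t) t) (at t within {0..})))"

end

theory Submission
  imports Defs "HOL-Probability.Distribution_Functions"
begin

text \<open>
  Since \<open>F\<close> is compact, so is \<open>T(\<xi>)\<close>; hence its spectral projectors for \<open>[\<epsilon>, N\<^sub>1\<^sup>2]\<close> take finitely many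
  values for \<open>\<epsilon>\<close> bounded away from \<open>0\<close>, and \<open>\<Phi>\<close> is continuous in time up to finitely many jumps in each
  bounded interval and locally Lipschitz in space.

  For \<open>w = z - y\<close>, Taylor's formula at \<open>z\<close> turns \<open>T\<^sub>\<epsilon>\<^sup>-\<^sup>1 F'\<^sup>* F\<close> into \<open>w - \<epsilon> T\<^sub>\<epsilon>\<^sup>-\<^sup>1 w\<close> plus a quadratic remainder,
  and comparing \<open>T\<^sub>\<epsilon>\<^sup>-\<^sup>1\<close> at \<open>z\<close>, \<open>y\<close> and \<open>\<xi>\<close> shows that \<open>norm w\<close> satisfies
  \<open>u' \<le> - \<gamma> u + (4 N\<^sub>1 N\<^sub>2 + N\<^sub>2 \<surd>\<epsilon>) u\<^sup>2 / (4 \<epsilon>) + \<alpha>\<close>.  By hypothesis 4, \<open>u\<close> cannot cross the barrier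
  \<open>2 C\<^sub>0 \<epsilon>(t) / (4 N\<^sub>1 N\<^sub>2 + N\<^sub>2 \<surd>\<epsilon>(0))\<close>.  Solving with the right-hand side truncated outside a ball of
  the initial radius of the barrier thus yields a global solution.
\<close>

section \<open>Hilbert space preliminaries\<close>

text \<open>\<open>resolution_of_identity\<close> is a choice, so a family must first be built, here
  from the eigenvectors of the compact operator. Afterwards the chosen family is studied through its
  defining properties: the integral representation gives form bounds and commutation with the
  operator. The jumps shape the analysis. Solutions are compared through right derivatives, which
  exist at all times. Since the spectral interval is closed at its lower end, the projector is
  left-continuous in the level, hence right-continuous in time because \<open>\<epsilon>\<close>
  decreases. The constant in the bound: put M = 4 N1 N2 + N2 sqrt(\<open>\<epsilon> 0\<close>) and
  let c be the supremum of \<open>\<alpha> t / \<epsilon> t\<close>. A barrier r *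
  \<open>\<epsilon> t\<close> cannot be crossed when M r^2 / 4 - \<open>C\<^sub>0\<close> r + c < 0.
  The value r = 2 \<open>C\<^sub>0\<close> / M is the vertex of this parabola, where it equals c -
  \<open>C\<^sup>2\<^sub>0\<close> / M. The two entries of the minimum in hypothesis 4 make the
  vertex value negative and put the initial point below the barrier.\<close>

lemma hilbert_projection_exists:
  fixes W :: "'a::{real_inner,complete_space} set"
  assumes W: "subspace W" "closed W"
  shows "\<exists>p\<in>W. \<forall>s\<in>W. (x - p) \<bullet> s = 0"
proof -
  define d where "d = (INF w\<in>W. (norm (x - w))\<^sup>2)"
  have ne: "W \<noteq> {}" using W(1) subspace_0 by auto
  have bdd: "bdd_below ((\<lambda>w. (norm (x - w))\<^sup>2) ` W)" by (rule bdd_belowI[of _ 0]) auto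
  have dle: "d \<le> (norm (x - w))\<^sup>2" if "w \<in> W" for w
    unfolding d_def by (rule cINF_lower[OF bdd that])
  have "\<exists>w\<in>W. (norm (x - w))\<^sup>2 < d + 1 / Suc n" for n
    using cINF_less_iff[OF ne bdd, of "d + 1 / Suc n"] by (auto simp: d_def)
  then obtain w where w: "\<And>n. w n \<in> W" "\<And>n. (norm (x - w n))\<^sup>2 < d + 1 / Suc n"
    by metis
  \<comment> \<open>Parallelogram law: the midpoint of two nearly optimal points is again a
    competitor, which forces the points together.\<close>
  have par: "(norm (w m - w n))\<^sup>2 \<le> 2 / Suc m + 2 / Suc n" for m n
  proof -
    have mid: "(1/2) *\<^sub>R (w m + w n) \<in> W" using W(1) w(1) by (simp add: subspace_add subspace_scale)
    have "(norm (w m - w n))\<^sup>2 = 2 * (norm (x - w m))\<^sup>2 + 2 * (norm (x - w n))\<^sup>2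
            - 4 * (norm (x - (1/2) *\<^sub>R (w m + w n)))\<^sup>2"
      by (simp add: power2_norm_eq_inner inner_diff inner_add inner_commute algebra_simps)
    then show ?thesis using dle[OF mid] w(2)[of m] w(2)[of n] by simp
  qed
  have "Cauchy w"
  proof (rule metric_CauchyI)
    fix e :: real assume e: "e > 0"
    obtain N where N: "4 / e\<^sup>2 < real N" using reals_Archimedean2 by blast
    have "dist (w m) (w n) < e" if "m \<ge> N" "n \<ge> N" for m n
    proof -
      have N': "N > 0" using N e by (cases N) (auto simp: field_simps)
      have "2 / Suc m \<le> 2 / Suc N" "2 / Suc n \<le> 2 / Suc N" using that by (auto simp: field_simps)
      then have "(norm (w m - w n))\<^sup>2 \<le> 4 / Suc N" using par[of m n] by linarith
      also have "\<dots> < e\<^sup>2" using N e N' by (simp add: field_simps) (smt (verit) zero_less_power)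
      finally show ?thesis using e by (simp add: dist_norm power_less_imp_less_base)
    qed
    then show "\<exists>M. \<forall>m\<ge>M. \<forall>n\<ge>M. dist (w m) (w n) < e" by blast
  qed
  then obtain p where p: "w \<longlonglongrightarrow> p" using Cauchy_convergent_iff convergent_def by blast
  have pW: "p \<in> W" using closed_sequentially[OF W(2)] w(1) p by blast
  have pd: "(norm (x - p))\<^sup>2 \<le> d"
  proof (rule LIMSEQ_le)
    show "(\<lambda>n. (norm (x - w n))\<^sup>2) \<longlonglongrightarrow> (norm (x - p))\<^sup>2" by (intro tendsto_intros p)
    show "(\<lambda>n. d + 1 / Suc n) \<longlonglongrightarrow> d"
      using tendsto_add[OF tendsto_const LIMSEQ_inverse_real_of_nat, of d] by (simp add: inverse_eq_divide)
    show "\<exists>N. \<forall>n\<ge>N. (norm (x - w n))\<^sup>2 \<le> d + 1 / Suc n" using w(2) less_imp_le by blast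
  qed
  have "(x - p) \<bullet> s = 0" if s: "s \<in> W" for s
  proof (cases "s = 0")
    case False
    \<comment> \<open>The \<open>t\<close> minimising the distance from \<open>x\<close> to
      \<open>p + t *\<^sub>R s\<close>; unless the inner product vanishes, it beats the
      minimum.\<close>
    define t where "t = ((x - p) \<bullet> s) / (s \<bullet> s)"
    have ss: "s \<bullet> s > 0" using False by simp
    have "p + t *\<^sub>R s \<in> W" using W(1) pW s by (simp add: subspace_add subspace_scale)
    then have "(norm (x - p))\<^sup>2 \<le> (norm (x - (p + t *\<^sub>R s)))\<^sup>2" using dle[of "p + t *\<^sub>R s"] pd by linarith
    also have "\<dots> = (norm (x - p))\<^sup>2 - 2 * t * ((x - p) \<bullet> s) + t\<^sup>2 * (s \<bullet> s)"
      unfolding power2_norm_eq_inner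
      by (simp add: inner_diff_left inner_diff_right inner_add_left inner_add_right inner_commute algebra_simps power2_eq_square)
    also have "\<dots> = (norm (x - p))\<^sup>2 - ((x - p) \<bullet> s)\<^sup>2 / (s \<bullet> s)"
      using ss by (simp add: t_def power2_eq_square field_simps)
    finally have "((x - p) \<bullet> s)\<^sup>2 / (s \<bullet> s) \<le> 0" by simp
    then show ?thesis using ss by (simp add: field_simps)
  qed simp
  with pW show ?thesis by blast
qed

lemma orthogonal_projection_unique:
  fixes W :: "'a::real_inner set"
  assumes W: "subspace W" and p: "p \<in> W" "\<And>s. s \<in> W \<Longrightarrow> (x - p) \<bullet> s = 0"
  shows "orthogonal_projection W x = p"
  unfolding orthogonal_projection_def
proof (rule the_equality)
  fix q assume q: "q \<in> W \<and> (\<forall>s\<in>W. (x - q) \<bullet> s = 0)"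
  then have "q - p \<in> W" using W p by (simp add: subspace_diff)
  then have "(x - p) \<bullet> (q - p) - (x - q) \<bullet> (q - p) = 0" using q p by simp
  then have "(q - p) \<bullet> (q - p) = 0" by (simp add: inner_diff algebra_simps)
  then show "q = p" by simp
qed (use p in auto)

context
  fixes W :: "'a::{real_inner,complete_space} set"
  assumes W: "subspace W" "closed W"
begin

lemma orthogonal_projection_mem: "orthogonal_projection W x \<in> W"
  and orthogonal_projection_orth: "s \<in> W \<Longrightarrow> (x - orthogonal_projection W x) \<bullet> s = 0"
  using hilbert_projection_exists[OF W, of x] orthogonal_projection_unique[OF W(1)] by metis+

lemma orthogonal_projection_eq_self: "x \<in> W \<Longrightarrow> orthogonal_projection W x = x"
  by (rule orthogonal_projection_unique[OF W(1)]) auto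

lemma orthogonal_projection_eq_0: "(\<And>s. s \<in> W \<Longrightarrow> x \<bullet> s = 0) \<Longrightarrow> orthogonal_projection W x = 0"
  using W by (intro orthogonal_projection_unique) (auto simp: subspace_0)

lemma orthogonal_projector_orthogonal_projection: "orthogonal_projector (orthogonal_projection W)"
proof -
  let ?P = "orthogonal_projection W"
  have add: "?P (x + y) = ?P x + ?P y" for x y
    using W(1) orthogonal_projection_mem orthogonal_projection_orth[of _ x] orthogonal_projection_orth[of _ y]
    by (intro orthogonal_projection_unique)
       (auto simp: subspace_add inner_diff_left inner_add_left algebra_simps)
  have scale: "?P (c *\<^sub>R x) = c *\<^sub>R ?P x" for c x
    using W(1) orthogonal_projection_mem orthogonal_projection_orth[of _ x]
    by (intro orthogonal_projection_unique)
       (auto simp: subspace_scale inner_diff_left algebra_simps)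
  have "norm (?P x) \<le> norm x" for x
  proof -
    have "(norm x)\<^sup>2 = (norm (?P x))\<^sup>2 + (norm (x - ?P x))\<^sup>2"
      using orthogonal_projection_orth[OF orthogonal_projection_mem, of x x]
      by (simp add: power2_norm_eq_inner inner_diff inner_commute)
    then have "(norm (?P x))\<^sup>2 \<le> (norm x)\<^sup>2" by simp
    then show ?thesis by (simp add: power2_le_iff_abs_le)
  qed
  then have "bounded_linear ?P" by (intro bounded_linear_intro[of _ 1]) (auto simp: add scale)
  moreover have "?P \<circ> ?P = ?P"
    by (auto simp: orthogonal_projection_eq_self orthogonal_projection_mem)
  moreover have "?P x \<bullet> y = x \<bullet> ?P y" for x y
    using orthogonal_projection_orth[OF orthogonal_projection_mem, of y x]
      orthogonal_projection_orth[OF orthogonal_projection_mem, of x y]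
    by (metis inner_commute inner_diff_left right_minus_eq)
  ultimately show ?thesis unfolding orthogonal_projector_def by blast
qed

end

lemma orthogonal_projectorD:
  assumes "orthogonal_projector P"
  shows "bounded_linear P" "P (P x) = P x" "P x \<bullet> y = x \<bullet> P y" "P x \<bullet> x = (norm (P x))\<^sup>2"
    "norm (P x) \<le> norm x" "P (x + y) = P x + P y" "P (x - y) = P x - P y" "P (c *\<^sub>R x) = c *\<^sub>R P x"
    "P 0 = 0" "P (- x) = - P x"
proof -
  show bl: "bounded_linear P" and id: "P (P x) = P x" and sym: "P x \<bullet> y = x \<bullet> P y" for x y
    using assms unfolding orthogonal_projector_def by (auto simp: o_def fun_eq_iff)
  interpret bounded_linear P by fact
  show "P (x + y) = P x + P y" "P (x - y) = P x - P y" "P (c *\<^sub>R x) = c *\<^sub>R P x"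
    "P 0 = 0" "P (- x) = - P x"
    by (fact add diff scaleR zero neg)+
  show sq: "P x \<bullet> x = (norm (P x))\<^sup>2"
    using sym[of x "P x"] sym[of x x] id by (simp add: power2_norm_eq_inner)
  show "norm (P x) \<le> norm x"
  proof (cases "P x = 0")
    case False
    have "norm (P x) * norm (P x) \<le> norm (P x) * norm x"
      using sq norm_cauchy_schwarz[of "P x" x] by (simp add: power2_eq_square)
    then show ?thesis using False by simp
  qed simp
qed

lemma orthogonal_projector_complement:
  assumes P: "orthogonal_projector P"
  shows "orthogonal_projector (\<lambda>x. x - P x)"
  unfolding orthogonal_projector_def
proof (intro conjI allI)
  show "bounded_linear (\<lambda>x. x - P x)"
    using orthogonal_projectorD(1)[OF P] by (intro bounded_linear_sub bounded_linear_ident)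
  show "(\<lambda>x. x - P x) \<circ> (\<lambda>x. x - P x) = (\<lambda>x. x - P x)"
    by (auto simp: o_def orthogonal_projectorD[OF P])
  show "(x - P x) \<bullet> y = x \<bullet> (y - P y)" for x y
    using orthogonal_projectorD(3)[OF P] by (simp add: inner_diff)
qed

section \<open>Riesz representation, adjoints and coercive operators\<close>

lemma riesz_representation:
  fixes f :: "'a::{real_inner,complete_space} \<Rightarrow> real"
  assumes f: "bounded_linear f"
  shows "\<exists>v. \<forall>x. f x = x \<bullet> v"
proof (cases "\<forall>x. f x = 0")
  case True then show ?thesis by (intro exI[of _ 0]) auto
next
  case False
  interpret bounded_linear f by fact
  define W where "W = {x. f x = 0}"
  have W: "subspace W" by (auto simp: W_def subspace_def zero add scaleR)
  have cW: "closed W"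
    unfolding W_def by (intro closed_Collect_eq continuous_on continuous_on_const continuous_on_id)
  obtain a where a: "f a \<noteq> 0" using False by blast
  \<comment> \<open>\<open>q\<close> is orthogonal to the kernel of \<open>f\<close>, which has
    codimension one, so a multiple of \<open>q\<close> represents \<open>f\<close>.\<close>
  define q where "q = a - orthogonal_projection W a"
  have q: "q \<bullet> s = 0" if "s \<in> W" for s
    unfolding q_def by (rule orthogonal_projection_orth[OF W cW that])
  have fq: "f q = f a" using orthogonal_projection_mem[OF W cW, of a] by (simp add: q_def diff W_def)
  then have q0: "q \<bullet> q \<noteq> 0" using a zero by auto
  have "f x = x \<bullet> ((f q / (q \<bullet> q)) *\<^sub>R q)" for x
  proof -
    have "x - (f x / f q) *\<^sub>R q \<in> W" using fq a by (simp add: W_def diff scaleR)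
    then have "q \<bullet> x = (f x / f q) * (q \<bullet> q)" using q by (fastforce simp: inner_diff_right)
    then show ?thesis using q0 fq a by (simp add: inner_commute field_simps)
  qed
  then show ?thesis by blast
qed

text \<open>\<open>adjoint\<close> is a choice among the maps with this property; Riesz
  representation shows that there is one to choose.\<close>

lemma adjoint_inner:
  fixes f :: "'a::{real_inner,complete_space} \<Rightarrow> 'b::real_inner"
  assumes f: "bounded_linear f"
  shows "f x \<bullet> y = x \<bullet> adjoint f y"
proof -
  have "\<exists>v. \<forall>x. f x \<bullet> y = x \<bullet> v" for y
    by (rule riesz_representation) (intro bounded_linear_compose[OF bounded_linear_inner_left f])
  then obtain g where "\<forall>x y. f x \<bullet> y = x \<bullet> g y" by metis
  then show ?thesis using adjoint_unique[of f g] by simp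
qed

lemma inner_eqI: "(\<And>x. x \<bullet> u = x \<bullet> v) \<Longrightarrow> u = (v::'a::real_inner)"
  by (metis inner_diff_right inner_eq_zero_iff right_minus_eq)

lemma norm_adjoint_le:
  fixes f :: "'a::{real_inner,complete_space} \<Rightarrow> 'b::real_inner"
  assumes f: "bounded_linear f" and B0: "B \<ge> 0" and B: "\<And>x. norm (f x) \<le> B * norm x"
  shows "norm (adjoint f y) \<le> B * norm y"
proof (cases "adjoint f y = 0")
  case True
  with B0 show ?thesis by simp
next
  case False
  have "(norm (adjoint f y))\<^sup>2 = f (adjoint f y) \<bullet> y"
    by (simp add: adjoint_inner[OF f] power2_norm_eq_inner)
  also have "\<dots> \<le> B * norm (adjoint f y) * norm y"
    using norm_cauchy_schwarz[of "f (adjoint f y)" y] B[of "adjoint f y"]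
    by (meson mult_right_mono norm_ge_zero order_trans)
  finally show ?thesis using False by (simp add: power2_eq_square mult.assoc mult.left_commute)
qed

lemma bounded_linear_adjoint:
  fixes f :: "'a::{real_inner,complete_space} \<Rightarrow> 'b::real_inner"
  assumes f: "bounded_linear f"
  shows "bounded_linear (adjoint f)"
proof -
  obtain B where B: "B \<ge> 0" "\<And>x. norm (f x) \<le> norm x * B"
    using bounded_linear.nonneg_bounded[OF f] by auto
  show ?thesis
  proof (rule bounded_linear_intro[of _ B])
    show "adjoint f (x + y) = adjoint f x + adjoint f y" for x y
      by (rule inner_eqI) (simp add: adjoint_inner[OF f, symmetric] inner_add_right)
    show "adjoint f (r *\<^sub>R x) = r *\<^sub>R adjoint f x" for r x
      by (rule inner_eqI) (simp add: adjoint_inner[OF f, symmetric])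
    show "norm (adjoint f x) \<le> norm x * B" for x
      using norm_adjoint_le[OF f B(1), of x] B by (simp add: mult.commute)
  qed
qed

text \<open>Lax--Milgram, by the contraction \<open>x \<mapsto> x - \<tau> (A x - y)\<close> for small \<open>\<tau>\<close>.\<close>

lemma coercive_bij:
  fixes A :: "'a::{real_inner,complete_space} \<Rightarrow> 'a"
  assumes A: "bounded_linear A" and e: "e > 0" and coer: "\<And>x. A x \<bullet> x \<ge> e * (norm x)\<^sup>2"
  shows "bij A"
proof (rule bijI)
  interpret bounded_linear A by fact
  show "inj A"
  proof (rule injI)
    fix x y assume "A x = A y"
    then have "e * (norm (x - y))\<^sup>2 \<le> 0" using coer[of "x - y"] by (simp add: diff)
    then show "x = y" using e by (simp add: mult_le_0_iff)
  qed
  obtain L0 where L0: "L0 \<ge> 0" "\<And>x. norm (A x) \<le> norm x * L0" using nonneg_bounded by auto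
  \<comment> \<open>Raising the norm bound to at least \<open>e\<close> keeps the number under the
    root in \<open>c\<close> nonnegative, also in the trivial space.\<close>
  define L where "L = max L0 e"
  have L: "L > 0" "L \<ge> e" using e by (auto simp: L_def)
  have AL: "norm (A x) \<le> L * norm x" for x
  proof -
    have "norm x * L0 \<le> norm x * L" by (rule mult_left_mono) (auto simp: L_def)
    then show ?thesis using L0(2)[of x] by (simp add: mult.commute)
  qed
  \<comment> \<open>This value minimises
    \<open>1 - 2 * \<tau> * e + \<tau>\<^sup>2 * L\<^sup>2\<close>, the bound for the squared
    contraction factor; the minimum is \<open>c\<^sup>2\<close>.\<close>
  define \<tau> where "\<tau> = e / L\<^sup>2"
  have \<tau>: "\<tau> > 0" using e L by (simp add: \<tau>_def)
  define c where "c = sqrt (1 - e\<^sup>2 / L\<^sup>2)"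
  have "e\<^sup>2 \<le> L\<^sup>2" using e L by (intro power_mono) auto
  then have eL: "e\<^sup>2 / L\<^sup>2 \<le> 1" "e\<^sup>2 / L\<^sup>2 > 0" using e L by auto
  then have c: "0 \<le> c" "c < 1" by (auto simp: c_def)
  have contr: "norm (x - \<tau> *\<^sub>R A x) \<le> c * norm x" for x
  proof -
    have "(norm (x - \<tau> *\<^sub>R A x))\<^sup>2 = (norm x)\<^sup>2 - 2 * \<tau> * (A x \<bullet> x) + \<tau>\<^sup>2 * (norm (A x))\<^sup>2"
      unfolding power2_norm_eq_inner
      by (simp add: inner_diff_left inner_diff_right inner_commute algebra_simps power2_eq_square)
    also have "\<dots> \<le> (norm x)\<^sup>2 - 2 * \<tau> * (e * (norm x)\<^sup>2) + \<tau>\<^sup>2 * (L * norm x)\<^sup>2"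
      using coer[of x] \<tau> power_mono[OF AL[of x], of 2] by (intro add_mono diff_mono mult_left_mono) auto
    also have "\<dots> = (c * norm x)\<^sup>2"
    proof -
      have "c\<^sup>2 = 1 - e\<^sup>2 / L\<^sup>2" using eL by (simp add: c_def)
      moreover have "\<tau> * e = e\<^sup>2 / L\<^sup>2" "\<tau>\<^sup>2 * L\<^sup>2 = e\<^sup>2 / L\<^sup>2"
        using L by (simp_all add: \<tau>_def power2_eq_square)
      moreover have "(norm x)\<^sup>2 - 2 * \<tau> * (e * (norm x)\<^sup>2) + \<tau>\<^sup>2 * (L * norm x)\<^sup>2
          = (1 - 2 * (\<tau> * e) + \<tau>\<^sup>2 * L\<^sup>2) * (norm x)\<^sup>2"
        by (simp add: power_mult_distrib algebra_simps)
      ultimately show ?thesis by (simp add: power_mult_distrib)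
    qed
    finally show ?thesis by (rule power2_le_imp_le) (simp add: c)
  qed
  show "surj A"
    unfolding surj_def
  proof
    fix y
    have "\<exists>!x. x - \<tau> *\<^sub>R (A x - y) = x"
    proof (rule banach_fix_type[OF c], intro allI)
      fix u v
      have "dist (u - \<tau> *\<^sub>R (A u - y)) (v - \<tau> *\<^sub>R (A v - y)) = norm ((u - v) - \<tau> *\<^sub>R A (u - v))"
        by (simp add: dist_norm diff algebra_simps)
      also have "\<dots> \<le> c * dist u v" using contr by (simp add: dist_norm)
      finally show "dist (u - \<tau> *\<^sub>R (A u - y)) (v - \<tau> *\<^sub>R (A v - y)) \<le> c * dist u v" .
    qed
    then obtain x where "x - \<tau> *\<^sub>R (A x - y) = x" by blast
    then have "A x = y" using \<tau> by simp
    then show "\<exists>x. y = A x" by blast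
  qed
qed

text \<open>Integration is carried out in the dual space \<open>'a \<Rightarrow>\<^sub>L real\<close>, which is of class \<open>banach\<close>, whereas
  a type of sort \<open>{real_inner, complete_space}\<close> is not.\<close>

lemma antiderivative_exists:
  fixes g :: "real \<Rightarrow> 'a::{real_inner,complete_space}"
  assumes g: "continuous_on {a..b} g"
  shows "\<exists>G. \<forall>t\<in>{a..b}. (G has_vector_derivative g t) (at t within {a..b})"
proof -
  have "\<exists>v. \<forall>x. blinfun_apply \<phi> x = x \<bullet> v" for \<phi> :: "'a \<Rightarrow>\<^sub>L real"
    by (rule riesz_representation) (rule blinfun.bounded_linear_right)
  \<comment> \<open>\<open>R\<close> inverts \<open>blinfun_inner_left\<close>, so it carries
    integrals taken in the dual back to the space.\<close>
  then obtain R :: "('a \<Rightarrow>\<^sub>L real) \<Rightarrow> 'a" where R: "\<And>\<phi> x. blinfun_apply \<phi> x = x \<bullet> R \<phi>" by metis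
  have "bounded_linear R"
  proof (rule bounded_linear_intro[of _ 1])
    show "R (\<phi> + \<psi>) = R \<phi> + R \<psi>" for \<phi> \<psi>
      by (rule inner_eqI) (simp add: R[symmetric] inner_add_right blinfun.add_left)
    show "R (r *\<^sub>R \<phi>) = r *\<^sub>R R \<phi>" for r \<phi>
      by (rule inner_eqI) (simp add: R[symmetric] blinfun.scaleR_left)
    show "norm (R \<phi>) \<le> norm \<phi> * 1" for \<phi>
    proof (cases "R \<phi> = 0")
      case False
      have "norm (R \<phi>) * norm (R \<phi>) \<le> norm \<phi> * norm (R \<phi>)"
        using norm_blinfun[of \<phi> "R \<phi>"] by (simp add: R power2_norm_eq_inner[symmetric] power2_eq_square)
      then show ?thesis using False by simp
    qed simp
  qed
  moreover have "R (blinfun_inner_left v) = v" for v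
    by (rule inner_eqI) (simp add: R[symmetric])
  moreover have "continuous_on {a..b} (\<lambda>s. blinfun_inner_left (g s))"
    by (rule bounded_linear.continuous_on[OF bounded_linear_blinfun_inner_left g])
  ultimately show ?thesis
    using bounded_linear.has_vector_derivative[OF \<open>bounded_linear R\<close> integral_has_vector_derivative]
    by (intro exI[of _ "\<lambda>u. R (integral {a..u} (\<lambda>s. blinfun_inner_left (g s)))"]) fastforce
qed

section \<open>Initial value problems with isolated jumps in time\<close>

lemma continuous_on_compose_lipschitz:
  fixes f :: "'a::real_normed_vector \<Rightarrow> real \<Rightarrow> 'b::real_normed_vector"
  assumes lip: "\<And>t h k. t \<in> S \<Longrightarrow> norm (f h t - f k t) \<le> L * norm (h - k)"
    and cont: "\<And>h. continuous_on S (f h)" and z: "continuous_on S z"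
  shows "continuous_on S (\<lambda>t. f (z t) t)"
  unfolding continuous_on_def
proof
  fix t assume t: "t \<in> S"
  have "((\<lambda>s. f (z s) s - f (z t) s) \<longlongrightarrow> 0) (at t within S)"
  proof (rule Lim_null_comparison)
    show "\<forall>\<^sub>F s in at t within S. norm (f (z s) s - f (z t) s) \<le> L * norm (z s - z t)"
      using lip by (auto simp: eventually_at_filter)
    have "(z \<longlongrightarrow> z t) (at t within S)" using z t by (auto simp: continuous_on_def)
    then have "((\<lambda>s. L * norm (z s - z t)) \<longlongrightarrow> L * norm (z t - z t)) (at t within S)"
      by (intro tendsto_intros)
    then show "((\<lambda>s. L * norm (z s - z t)) \<longlongrightarrow> 0) (at t within S)" by simp
  qed
  moreover have "((\<lambda>s. f (z t) s) \<longlongrightarrow> f (z t) t) (at t within S)"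
    using cont t by (auto simp: continuous_on_def)
  ultimately show "((\<lambda>s. f (z s) s) \<longlongrightarrow> f (z t) t) (at t within S)"
    using tendsto_add by fastforce
qed

text \<open>With \<open>(b - a) * L\<close> at most 1/2, the integral operator of the equation
  halves the supremum distance, so Banach's fixed point theorem applies directly.\<close>

lemma picard_short_interval:
  fixes f :: "'a::{real_inner,complete_space} \<Rightarrow> real \<Rightarrow> 'a"
  assumes ab: "a \<le> b" and L: "L \<ge> 0" "(b - a) * L \<le> 1/2"
    and lip: "\<And>t h k. t \<in> {a..b} \<Longrightarrow> norm (f h t - f k t) \<le> L * norm (h - k)"
    and cont: "\<And>h. continuous_on {a..b} (f h)"
  shows "\<exists>z. z a = x \<and> (\<forall>t\<in>{a..b}. (z has_vector_derivative f (z t) t) (at t within {a..b}))"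
proof -
  have "\<exists>G. G a = x \<and> (\<forall>t\<in>{a..b}. (G has_vector_derivative f (apply_bcontfun u t) t) (at t within {a..b}))"
    for u :: "real \<Rightarrow>\<^sub>C 'a"
  proof -
    have "continuous_on {a..b} (\<lambda>t. f (apply_bcontfun u t) t)"
      by (rule continuous_on_compose_lipschitz[OF lip cont]) (auto intro!: continuous_intros)
    from antiderivative_exists[OF this] obtain G where
      G: "\<forall>t\<in>{a..b}. (G has_vector_derivative f (apply_bcontfun u t) t) (at t within {a..b})" by blast
    then have "\<forall>t\<in>{a..b}. ((\<lambda>t. G t + (x - G a)) has_vector_derivative f (apply_bcontfun u t) t) (at t within {a..b})"
      by (auto intro!: derivative_eq_intros)
    then show ?thesis by (intro exI[of _ "\<lambda>t. G t + (x - G a)"]) auto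
  qed
  then obtain G where Ga: "\<And>u. G u a = x" and
    G: "\<And>u t. t \<in> {a..b} \<Longrightarrow> (G u has_vector_derivative f (apply_bcontfun u t) t) (at t within {a..b})"
    by metis
  \<comment> \<open>Clamping time to \<open>[a, b]\<close> turns the iterates into bounded
    continuous functions on the whole line, the complete space in which the fixed point is
    sought.\<close>
  define c where "c t = max a (min b t)" for t
  have c: "c t \<in> {a..b}" "t \<in> {a..b} \<Longrightarrow> c t = t" for t using ab by (auto simp: c_def)
  have contG: "continuous_on {a..b} (G u)" for u
    using G has_vector_derivative_continuous continuous_on_eq_continuous_within by blast
  have bc: "(\<lambda>t. G u (c t)) \<in> bcontfun" for u
  proof -
    have "continuous_on UNIV (\<lambda>t. G u (c t))"
      by (rule continuous_on_compose2[OF contG]) (use c in \<open>auto simp: c_def[abs_def] intro!: continuous_intros\<close>)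
    moreover have "bounded (range (\<lambda>t. G u (c t)))"
      by (rule bounded_subset[OF compact_imp_bounded[OF compact_continuous_image[OF contG compact_Icc]]])
        (use c(1) in auto)
    ultimately show ?thesis by (simp add: bcontfun_def)
  qed
  define \<Gamma> where "\<Gamma> u = Bcontfun (\<lambda>t. G u (c t))" for u
  have \<Gamma>: "apply_bcontfun (\<Gamma> u) t = G u (c t)" for u t
    by (simp add: \<Gamma>_def Bcontfun_inverse[OF bc])
  have "\<exists>!u. \<Gamma> u = u"
  proof (rule banach_fix_type[of "1/2"], simp, simp, intro allI)
    fix u v
    show "dist (\<Gamma> u) (\<Gamma> v) \<le> 1/2 * dist u v"
    proof (rule dist_bound)
      fix t
      \<comment> \<open>Both primitives start from \<open>x\<close>, so the mean value inequality
        bounds their distance by the length times the bound for the difference of their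
        derivatives.\<close>
      define D where "D s = G u s - G v s" for s
      have d: "(D has_derivative (\<lambda>h. h *\<^sub>R (f (apply_bcontfun u s) s - f (apply_bcontfun v s) s))) (at s within {a..b})"
        if "s \<in> {a..b}" for s
        using has_vector_derivative_diff[OF G[OF that] G[OF that], of u v]
        by (simp add: D_def[abs_def] has_vector_derivative_def)
      have "norm (D (c t) - D a) \<le> (L * dist u v) * norm (c t - a)"
      proof (rule differentiable_bound[OF _ d])
        fix s assume s: "s \<in> {a..b}"
        have "norm (f (apply_bcontfun u s) s - f (apply_bcontfun v s) s) \<le> L * dist u v"
          using lip[OF s] mult_left_mono[OF dist_bounded L(1)] by (metis dist_norm order_trans)
        then show "onorm (\<lambda>h. h *\<^sub>R (f (apply_bcontfun u s) s - f (apply_bcontfun v s) s)) \<le> L * dist u v"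
          by (simp add: onorm_scaleR_left bounded_linear_ident onorm_id)
      qed (use c ab in auto)
      also have "\<dots> \<le> (L * dist u v) * (b - a)"
        using c[of t] L by (intro mult_left_mono) auto
      also have "\<dots> \<le> 1/2 * dist u v"
        using mult_right_mono[OF L(2), of "dist u v"] by (simp add: algebra_simps)
      finally show "dist (apply_bcontfun (\<Gamma> u) t) (apply_bcontfun (\<Gamma> v) t) \<le> 1/2 * dist u v"
        by (simp add: \<Gamma> dist_norm D_def Ga)
    qed
  qed
  then obtain u where u: "\<Gamma> u = u" by blast
  then have eq: "apply_bcontfun u t = G u t" if "t \<in> {a..b}" for t
    using \<Gamma>[of u t] c(2)[OF that] by simp
  show ?thesis
  proof (intro exI[of _ "G u"] conjI ballI)
    fix t assume t: "t \<in> {a..b}"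
    show "(G u has_vector_derivative f (G u t) t) (at t within {a..b})"
      using G[OF t, of u] eq[OF t] by simp
  qed (rule Ga)
qed

text \<open>Each one-sided derivative depends on one side of \<open>t\<close> only, so solutions on
  adjacent intervals glue as soon as their values agree, and only the left derivative may fail at a
  jump.\<close>

definition piecewise_solution ::
  "('a::real_normed_vector \<Rightarrow> real \<Rightarrow> 'a) \<Rightarrow> real set \<Rightarrow> real \<Rightarrow> real \<Rightarrow> (real \<Rightarrow> 'a) \<Rightarrow> bool" where
  "piecewise_solution f D a b z \<longleftrightarrow> continuous_on {a..b} z \<and>
     (\<forall>t\<in>{a..<b}. (z has_vector_derivative f (z t) t) (at_right t)) \<and>
     (\<forall>t\<in>{a<..b} - D. (z has_vector_derivative f (z t) t) (at_left t))"

lemma at_right_subset_interval: "(a::real) \<le> t \<Longrightarrow> t < b \<Longrightarrow> at t within {a..b} \<ge> at_right t"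
  by (metis at_le at_within_Icc_at_right atLeastatMost_subset_iff greaterThanAtMost_subseteq_atLeastAtMost_iff order_refl at_within_Icc_at_right)

lemma at_left_subset_interval: "(a::real) < t \<Longrightarrow> t \<le> b \<Longrightarrow> at t within {a..b} \<ge> at_left t"
  by (metis at_le at_within_Icc_at_left atLeastatMost_subset_iff order_refl)

lemma has_vector_derivative_mono_filter:
  "(z has_vector_derivative d) (at t within S) \<Longrightarrow> at t within T \<le> at t within S \<Longrightarrow>
    (z has_vector_derivative d) (at t within T)"
  unfolding has_vector_derivative_def has_derivative_within by (auto intro: tendsto_mono)

lemma has_vector_derivative_eventually_cong:
  assumes "(z has_vector_derivative d) (at t within S)" "\<forall>\<^sub>F s in at t within S. w s = z s" "w t = z t"
  shows "(w has_vector_derivative d) (at t within S)"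
proof -
  have "\<forall>\<^sub>F s in at t within S. (1 / norm (s - t)) *\<^sub>R (w s - (w t + (s - t) *\<^sub>R d)) =
      (1 / norm (s - t)) *\<^sub>R (z s - (z t + (s - t) *\<^sub>R d))"
    using assms(2) by (rule eventually_mono) (simp add: assms(3))
  from tendsto_cong[OF this] show ?thesis
    using assms(1) unfolding has_vector_derivative_def has_derivative_within by simp
qed

lemma piecewise_solution_concat:
  assumes ab: "a \<le> b" "b \<le> c" and z1: "piecewise_solution f D a b z1" and z2: "piecewise_solution f D b c z2"
    and eq: "z1 b = z2 b"
  shows "piecewise_solution f D a c (\<lambda>t. if t \<le> b then z1 t else z2 t)"
    (is "piecewise_solution f D a c ?z")
  unfolding piecewise_solution_def
proof (intro conjI ballI)
  have un: "{a..c} = {a..b} \<union> {b..c}" using ab by auto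
  show "continuous_on {a..c} ?z"
    unfolding un using z1 z2 eq
    by (intro continuous_on_cases) (auto simp: piecewise_solution_def)
next
  fix t assume t: "t \<in> {a..<c}"
  show "(?z has_vector_derivative f (?z t) t) (at_right t)"
  proof (cases "t < b")
    case True
    have "(z1 has_vector_derivative f (?z t) t) (at_right t)"
      using z1 t True by (auto simp: piecewise_solution_def)
    then show ?thesis
      by (rule has_vector_derivative_eventually_cong)
         (use True in \<open>auto simp: eventually_at_right_field intro!: exI[of _ b]\<close>)
  next
    case False
    then have zt: "?z t = z2 t" using eq by auto
    have "(z2 has_vector_derivative f (?z t) t) (at_right t)"
      using z2 t False unfolding zt by (auto simp: piecewise_solution_def)
    then show ?thesis
      by (rule has_vector_derivative_eventually_cong)
         (use False zt in \<open>auto simp: eventually_at_right_field intro!: exI[of _ "t+1"]\<close>)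
  qed
next
  fix t assume t: "t \<in> {a<..c} - D"
  show "(?z has_vector_derivative f (?z t) t) (at_left t)"
  proof (cases "t \<le> b")
    case True
    have "(z1 has_vector_derivative f (?z t) t) (at_left t)"
      using z1 t True by (auto simp: piecewise_solution_def)
    then show ?thesis
      by (rule has_vector_derivative_eventually_cong)
         (use True in \<open>auto simp: eventually_at_left_field intro!: exI[of _ "t-1"]\<close>)
  next
    case False
    have "(z2 has_vector_derivative f (?z t) t) (at_left t)"
      using z2 t False by (auto simp: piecewise_solution_def)
    then show ?thesis
      by (rule has_vector_derivative_eventually_cong)
         (use False in \<open>auto simp: eventually_at_left_field intro!: exI[of _ b]\<close>)
  qed
qed

text \<open>On \<open>[a, b]\<close> the right-hand side is continuous up to a possible jump at \<open>b\<close>, which must then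
  belong to \<open>D\<close>.\<close>

definition continuous_piece :: "('a::real_normed_vector \<Rightarrow> real \<Rightarrow> 'a) \<Rightarrow> real set \<Rightarrow> real \<Rightarrow> real \<Rightarrow> real \<Rightarrow> bool" where
  "continuous_piece f D L a b \<longleftrightarrow> (\<exists>g. (\<forall>h. continuous_on {a..b} (g h)) \<and>
     (\<forall>t\<in>{a..b}. \<forall>h k. norm (g h t - g k t) \<le> L * norm (h - k)) \<and>
     (\<forall>t\<in>{a..<b}. \<forall>h. f h t = g h t) \<and> (b \<notin> D \<longrightarrow> (\<forall>h. f h b = g h b)))"

text \<open>Solve with the continuous extension of the right-hand side from \<open>[a, b)\<close>.
  The two differ at most at \<open>b\<close>, and then \<open>b\<close> lies in \<open>D\<close>,
  where no left derivative is claimed.\<close>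

lemma piecewise_solution_short_interval:
  fixes f :: "'a::{real_inner,complete_space} \<Rightarrow> real \<Rightarrow> 'a"
  assumes "a \<le> b" "L \<ge> 0" "(b - a) * L \<le> 1/2" and p: "continuous_piece f D L a b"
  shows "\<exists>z. z a = x \<and> piecewise_solution f D a b z"
proof -
  obtain g where g: "\<And>h. continuous_on {a..b} (g h)"
    "\<And>t h k. t \<in> {a..b} \<Longrightarrow> norm (g h t - g k t) \<le> L * norm (h - k)"
    "\<And>t h. t \<in> {a..<b} \<Longrightarrow> f h t = g h t" "\<And>h. b \<notin> D \<Longrightarrow> f h b = g h b"
    using p unfolding continuous_piece_def by blast
  obtain z where z: "z a = x" "\<And>t. t \<in> {a..b} \<Longrightarrow> (z has_vector_derivative g (z t) t) (at t within {a..b})"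
    using picard_short_interval[OF assms(1-3) g(2,1), of x] by blast
  have "piecewise_solution f D a b z"
    unfolding piecewise_solution_def
  proof (intro conjI ballI)
    show "continuous_on {a..b} z"
      using z(2) has_vector_derivative_continuous continuous_on_eq_continuous_within by blast
  next
    fix t assume "t \<in> {a..<b}"
    then show "(z has_vector_derivative f (z t) t) (at_right t)"
      using has_vector_derivative_mono_filter[OF z(2) at_right_subset_interval] g(3) by auto
  next
    fix t assume "t \<in> {a<..b} - D"
    then show "(z has_vector_derivative f (z t) t) (at_left t)"
      using has_vector_derivative_mono_filter[OF z(2) at_left_subset_interval] g(3,4)
      by (cases "t = b") auto
  qed
  with z(1) show ?thesis by blast
qed

text \<open>Bisection in the form of \<open>Bolzano\<close>. The predicate ranges over all initial
  values, which makes it transitive: the second piece starts wherever the first one ends.\<close>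

lemma piecewise_solution_exists:
  fixes f :: "'a::{real_inner,complete_space} \<Rightarrow> real \<Rightarrow> 'a"
  assumes ab: "a \<le> b" and L: "L \<ge> 0"
    and p: "\<And>s. a \<le> s \<Longrightarrow> s \<le> b \<Longrightarrow>
      \<exists>d>0. \<forall>u v. a \<le> u \<and> u \<le> s \<and> s \<le> v \<and> v \<le> b \<and> v - u < d \<longrightarrow> continuous_piece f D L u s \<and> continuous_piece f D L s v"
  shows "\<exists>z. z a = x \<and> piecewise_solution f D a b z"
proof -
  define P where "P u v \<longleftrightarrow> a \<le> u \<and> v \<le> b \<longrightarrow> (\<forall>x. \<exists>z. z u = x \<and> piecewise_solution f D u v z)" for u v
  have tr: "P u w" if P: "P u v" "P v w" and uv: "u \<le> v" "v \<le> w" for u v w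
    unfolding P_def
  proof (intro impI allI)
    fix x assume uw: "a \<le> u \<and> w \<le> b"
    obtain z1 where z1: "z1 u = x" "piecewise_solution f D u v z1" using P(1) uv uw by (auto simp: P_def)
    obtain z2 where z2: "z2 v = z1 v" "piecewise_solution f D v w z2" using P(2) uv uw by (force simp: P_def)
    show "\<exists>z. z u = x \<and> piecewise_solution f D u w z"
      using piecewise_solution_concat[OF uv z1(2) z2(2)] z1 z2 uv
      by (intro exI[of _ "\<lambda>t. if t \<le> v then z1 t else z2 t"]) auto
  qed
  have "P a b"
  proof (rule Bolzano[of a b P, OF ab tr])
    fix s assume s: "a \<le> s" "s \<le> b"
    obtain d where d: "d > 0" "\<And>u v. \<lbrakk>a \<le> u; u \<le> s; s \<le> v; v \<le> b; v - u < d\<rbrakk> \<Longrightarrow>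
      continuous_piece f D L u s \<and> continuous_piece f D L s v" using p[OF s] by blast
    \<comment> \<open>The second bound secures the contraction condition of Picard's theorem;
      \<open>L + 1\<close> stands in for \<open>L\<close>, which may be zero.\<close>
    define d' where "d' = min d (1 / (2 * (L + 1)))"
    have d': "d' > 0" "d' \<le> d" using d L by (auto simp: d'_def)
    have short: "r * L \<le> 1/2" if "r < d'" "r \<ge> 0" for r
    proof -
      have "r * L \<le> d' * (L + 1)" using that L by (intro mult_mono) auto
      also have "\<dots> \<le> 1 / (2 * (L + 1)) * (L + 1)" using L by (intro mult_right_mono) (auto simp: d'_def)
      also have "\<dots> = 1/2" using L by (simp add: field_simps)
      finally show ?thesis .
    qed
    have "P u v" if uv: "u \<le> s" "s \<le> v" "v - u < d'" for u v
    proof (rule tr[OF _ _ uv(1,2)])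
      show "P u s"
        unfolding P_def
      proof (intro impI allI)
        fix x assume "a \<le> u \<and> s \<le> b"
        then have "continuous_piece f D L u s" using d(2)[of u s] uv d' by auto
        then show "\<exists>z. z u = x \<and> piecewise_solution f D u s z"
          using uv short[of "s - u"] by (intro piecewise_solution_short_interval[OF _ L]) auto
      qed
      show "P s v"
        unfolding P_def
      proof (intro impI allI)
        fix x assume "a \<le> s \<and> v \<le> b"
        then have "continuous_piece f D L s v" using d(2)[of s v] uv d' by auto
        then show "\<exists>z. z s = x \<and> piecewise_solution f D s v z"
          using uv short[of "v - s"] by (intro piecewise_solution_short_interval[OF _ L]) auto
      qed
    qed
    then show "\<exists>d>0. \<forall>u v. u \<le> s \<and> s \<le> v \<and> v - u < d \<longrightarrow> P u v" using d'(1) by blast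
  qed
  then show ?thesis by (auto simp: P_def)
qed

text \<open>At the infimum \<open>i\<close> of the times with \<open>g > 0\<close>, continuity gives
  \<open>g i = 0\<close>, while positive values accumulate at \<open>i\<close> from the right; a
  negative right derivative excludes this. So only contact times have to be tested.\<close>

lemma right_derivative_barrier:
  fixes g :: "real \<Rightarrow> real"
  assumes cont: "continuous_on {a..b} g" and ga: "g a \<le> 0"
    and der: "\<And>t. a \<le> t \<Longrightarrow> t < b \<Longrightarrow> (\<And>s. a \<le> s \<Longrightarrow> s \<le> t \<Longrightarrow> g s \<le> 0) \<Longrightarrow> g t = 0 \<Longrightarrow>
      \<exists>d<0. (g has_vector_derivative d) (at_right t)"
    and t: "t \<in> {a..b}"
  shows "g t \<le> 0"
proof (rule ccontr)
  assume "\<not> g t \<le> 0"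
  then have gt: "g t > 0" by simp
  define S where "S = {s \<in> {a..t}. g s > 0}"
  define i where "i = Inf S"
  have ne: "S \<noteq> {}" and bdd: "bdd_below S" using t gt by (auto simp: S_def intro: bdd_belowI[of _ a])
  have i: "a \<le> i" "i \<le> t"
    using t gt cInf_lower[OF _ bdd, of t] by (auto simp: i_def S_def intro!: cInf_greatest)
  have neg: "g s \<le> 0" if "a \<le> s" "s < i" for s
    using cInf_lower[OF _ bdd, of s] that i unfolding i_def[symmetric] by (force simp: S_def)
  have conti: "continuous (at i within {a..b}) g"
    using cont i t by (auto simp: continuous_on_eq_continuous_within)
  have le: "g i \<le> 0"
  proof (rule ccontr)
    assume g: "\<not> g i \<le> 0"
    then have ai: "a < i" using i ga by (cases "a = i") auto
    have "(g \<longlongrightarrow> g i) (at i within {a..b})" using conti by (simp add: continuous_within)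
    then have "(g \<longlongrightarrow> g i) (at_left i)"
      by (rule tendsto_mono[OF at_left_subset_interval[OF ai], rotated]) (use i t in auto)
    moreover have "\<forall>\<^sub>F s in at_left i. g s \<le> 0"
      using neg ai by (auto simp: eventually_at_left_field intro!: exI[of _ a])
    ultimately have "g i \<le> 0" by (rule tendsto_upperbound) simp
    with g show False by simp
  qed
  then have it: "i < t" using gt i by (cases "i = t") auto
  \<comment> \<open>\<open>i\<close> itself is not in \<open>S\<close>, so points of
    \<open>S\<close> lie in every right neighbourhood of \<open>i\<close>.\<close>
  have freq: "\<exists>s. i < s \<and> s < i + r \<and> s \<le> t \<and> g s > 0" if r: "r > 0" for r
  proof -
    obtain s where s: "s \<in> S" "s < i + r" using cInf_lessD[OF ne, of "i + r"] r i_def by auto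
    have "s \<ge> i" using cInf_lower[OF s(1) bdd] by (simp add: i_def)
    moreover have "s \<noteq> i" using le s by (auto simp: S_def)
    ultimately show ?thesis using s by (intro exI[of _ s]) (auto simp: S_def)
  qed
  have "g i \<ge> 0"
  proof (rule ccontr)
    assume g: "\<not> g i \<ge> 0"
    have "(g \<longlongrightarrow> g i) (at_right i)"
      using conti unfolding continuous_within
      by (rule tendsto_mono[OF at_right_subset_interval, rotated 2]) (use i it t in auto)
    then have "\<forall>\<^sub>F s in at_right i. g s < 0" using g by (auto simp: order_tendsto_iff)
    then obtain c where "c > i" "\<And>s. i < s \<Longrightarrow> s < c \<Longrightarrow> g s < 0" by (auto simp: eventually_at_right_field)
    then show False using freq[of "c - i"] by force
  qed
  with le have gi: "g i = 0" by simp
  have "\<And>s. a \<le> s \<Longrightarrow> s \<le> i \<Longrightarrow> g s \<le> 0" using neg gi by (metis order.order_iff_strict order_refl)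
  then obtain d where d: "d < 0" "(g has_vector_derivative d) (at_right i)"
    using der[of i] i it t gi by auto
  have "((\<lambda>s. (g s - g i) / (s - i)) \<longlongrightarrow> d) (at_right i)"
    using d(2) unfolding has_real_derivative_iff_has_vector_derivative[symmetric] has_field_derivative_iff by simp
  then have "\<forall>\<^sub>F s in at_right i. (g s - g i) / (s - i) < 0" using d(1) by (auto simp: order_tendsto_iff)
  then obtain c where c: "c > i" "\<And>s. i < s \<Longrightarrow> s < c \<Longrightarrow> (g s - g i) / (s - i) < 0"
    by (auto simp: eventually_at_right_field)
  obtain s where s: "i < s" "s < i + (c - i)" "s \<le> t" "g s > 0" using freq[of "c - i"] c by auto
  then show False using c(2)[of s] gi by (auto simp: divide_less_0_iff)
qed

text \<open>Comparison arguments work with the square because the norm is not differentiable at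
  zero.\<close>

lemma has_vector_derivative_norm_squared:
  fixes z :: "real \<Rightarrow> 'a::real_inner"
  assumes "(z has_vector_derivative d) (at t within S)"
  shows "((\<lambda>s. (norm (z s))\<^sup>2) has_vector_derivative 2 * (z t \<bullet> d)) (at t within S)"
  unfolding power2_norm_eq_inner using assms unfolding has_vector_derivative_def
  by (auto intro!: derivative_eq_intros simp: inner_commute algebra_simps)

text \<open>Gronwall's inequality by way of the barrier: the squared distance stays below
  \<open>\<eta> * E\<close> for every \<open>\<eta> > 0\<close>. The summand 1 in the exponent makes
  the derivative strictly negative at contact.\<close>

lemma right_solutions_unique:
  fixes z w :: "real \<Rightarrow> 'a::real_inner"
  assumes cont: "continuous_on {a..b} z" "continuous_on {a..b} w"
    and z: "\<And>t. a \<le> t \<Longrightarrow> t < b \<Longrightarrow> (z has_vector_derivative f (z t) t) (at_right t)"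
    and w: "\<And>t. a \<le> t \<Longrightarrow> t < b \<Longrightarrow> (w has_vector_derivative f (w t) t) (at_right t)"
    and lip: "\<And>t. a \<le> t \<Longrightarrow> t < b \<Longrightarrow> norm (f (z t) t - f (w t) t) \<le> L * norm (z t - w t)"
    and init: "z a = w a" and t: "t \<in> {a..b}"
  shows "z t = w t"
proof -
  define E where "E s = exp ((2 * L + 1) * (s - a))" for s
  have "(norm (z t - w t))\<^sup>2 \<le> \<eta> * E t" if \<eta>: "\<eta> > 0" for \<eta>
  proof -
    define g where "g s = (norm (z s - w s))\<^sup>2 - \<eta> * E s" for s
    have "g t \<le> 0"
    proof (rule right_derivative_barrier[OF _ _ _ t])
      show "continuous_on {a..b} g" unfolding g_def E_def by (intro continuous_intros cont)
      show "g a \<le> 0" using init \<eta> by (simp add: g_def E_def)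
      fix s assume s: "a \<le> s" "s < b" and gs: "g s = 0"
      define d where "d = 2 * ((z s - w s) \<bullet> (f (z s) s - f (w s) s)) - \<eta> * ((2 * L + 1) * E s)"
      have "(E has_real_derivative (2 * L + 1) * E s) (at_right s)"
        unfolding E_def by (auto intro!: derivative_eq_intros)
      then have "(E has_vector_derivative (2 * L + 1) * E s) (at_right s)"
        by (simp add: has_real_derivative_iff_has_vector_derivative)
      then have "(g has_vector_derivative d) (at_right s)"
        unfolding g_def[abs_def] d_def
        by (intro has_vector_derivative_diff has_vector_derivative_norm_squared[OF has_vector_derivative_diff[OF z[OF s] w[OF s]]]
              has_vector_derivative_mult_right)
      moreover have "d < 0"
      proof -
        have "(z s - w s) \<bullet> (f (z s) s - f (w s) s) \<le> norm (z s - w s) * norm (f (z s) s - f (w s) s)"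
          by (rule norm_cauchy_schwarz)
        also have "\<dots> \<le> norm (z s - w s) * (L * norm (z s - w s))" by (intro mult_left_mono lip s) simp
        also have "\<dots> = L * (\<eta> * E s)" using gs by (simp add: g_def power2_eq_square)
        finally have "d \<le> - (\<eta> * E s)" by (simp add: d_def algebra_simps)
        moreover have "\<eta> * E s > 0" using \<eta> by (simp add: E_def)
        ultimately show ?thesis by simp
      qed
      ultimately show "\<exists>d<0. (g has_vector_derivative d) (at_right s)" by blast
    qed
    then show ?thesis by (simp add: g_def)
  qed
  from this[of "\<eta> / E t" for \<eta>] have "(norm (z t - w t))\<^sup>2 \<le> \<eta>" if "\<eta> > 0" for \<eta>
    using that by (simp add: E_def)
  then have "(norm (z t - w t))\<^sup>2 \<le> 0" by (rule field_le_epsilon[of _ 0, simplified])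
  then show ?thesis by simp
qed

section \<open>Spectral families\<close>

text \<open>Kept free of the operator, since two families are instances: the explicit one made of
  eigenvectors and the one chosen by \<open>resolution_of_identity\<close>.\<close>

locale spectral_family =
  fixes E :: "real \<Rightarrow> 'a::real_inner \<Rightarrow> 'a"
  assumes proj: "orthogonal_projector (E s)"
    and below: "s \<le> u \<Longrightarrow> E s (E u x) = E s x" "s \<le> u \<Longrightarrow> E u (E s x) = E s x"
    and right_limit: "((\<lambda>u. E u x) \<longlongrightarrow> E s x) (at_right s)"
    and limit_bot: "((\<lambda>s. E s x) \<longlongrightarrow> 0) at_bot"
    and limit_top: "((\<lambda>s. E s x) \<longlongrightarrow> x) at_top"
begin

lemma norm_E_mono: assumes "s \<le> u" shows "(norm (E s x))\<^sup>2 \<le> (norm (E u x))\<^sup>2"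
  using orthogonal_projectorD(5)[OF proj[of s], of "E u x"] below(1)[OF assms]
  by (auto intro: power_mono)

lemma norm_E_diff: assumes "s \<le> u" shows "(norm (E u x - E s x))\<^sup>2 = (norm (E u x))\<^sup>2 - (norm (E s x))\<^sup>2"
proof -
  have "E u x \<bullet> E s x = (norm (E s x))\<^sup>2"
    using orthogonal_projectorD(2,3,4)[OF proj[of s]] below(1)[OF assms, of x]
    by (metis inner_commute)
  then show ?thesis
    unfolding power2_norm_eq_inner by (simp add: inner_diff inner_commute)
qed

abbreviation mass :: "'a \<Rightarrow> real measure" where
  "mass x \<equiv> interval_measure (\<lambda>s. E s x \<bullet> x)"

lemma quadratic_E: "E s x \<bullet> x = (norm (E s x))\<^sup>2"
  by (rule orthogonal_projectorD(4)[OF proj])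

lemma distribution_mono: "s \<le> u \<Longrightarrow> E s x \<bullet> x \<le> E u x \<bullet> x"
  unfolding quadratic_E by (rule norm_E_mono)

lemma distribution_right_continuous: "continuous (at_right s) (\<lambda>s. E s x \<bullet> x)"
  unfolding continuous_within by (intro tendsto_intros right_limit)

lemma distribution_limit_bot: "((\<lambda>s. E s x \<bullet> x) \<longlongrightarrow> 0) at_bot"
  using tendsto_inner[OF limit_bot tendsto_const, of x x] by simp

lemma measure_mass_Ioc: "a \<le> b \<Longrightarrow> measure (mass x) {a<..b} = (norm (E b x))\<^sup>2 - (norm (E a x))\<^sup>2"
  using measure_interval_measure_Ioc[of a b "\<lambda>s. E s x \<bullet> x", OF _ distribution_mono distribution_right_continuous]
  by (simp add: quadratic_E)

lemma emeasure_mass_Iic: "emeasure (mass x) {..a} = ennreal ((norm (E a x))\<^sup>2)"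
  using emeasure_interval_measure_Iic[of "\<lambda>s. E s x \<bullet> x", OF distribution_mono distribution_right_continuous
      distribution_limit_bot] by (simp add: quadratic_E)

lemma emeasure_mass_UNIV: "emeasure (mass x) UNIV = ennreal ((norm x)\<^sup>2)"
proof (rule LIMSEQ_unique)
  have "(\<Union>n. {..real n}) = UNIV" using real_arch_simple by blast
  then show "(\<lambda>n. emeasure (mass x) {..real n}) \<longlonglongrightarrow> emeasure (mass x) UNIV"
    using Lim_emeasure_incseq[of "\<lambda>n. {..real n}" "mass x"] by (simp add: incseq_def image_subset_iff)
  have "((\<lambda>s. (norm (E s x))\<^sup>2) \<longlongrightarrow> (norm x)\<^sup>2) at_top" by (intro tendsto_intros limit_top)
  then have "(\<lambda>n. (norm (E (real n) x))\<^sup>2) \<longlonglongrightarrow> (norm x)\<^sup>2"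
    by (rule filterlim_compose[OF _ filterlim_real_sequentially])
  then show "(\<lambda>n. emeasure (mass x) {..real n}) \<longlonglongrightarrow> ennreal ((norm x)\<^sup>2)"
    unfolding emeasure_mass_Iic by (rule tendsto_ennrealI)
qed

lemma measure_mass_UNIV: "measure (mass x) UNIV = (norm x)\<^sup>2"
  using emeasure_mass_UNIV by (simp add: measure_def)

lemma finite_measure_mass: "finite_measure (mass x)"
  by (rule finite_measureI) (simp add: emeasure_mass_UNIV)

lemma AE_mass_greater:
  assumes "E a x = 0" shows "AE s in mass x. a < s"
proof (rule AE_I)
  show "{s \<in> space (mass x). \<not> a < s} \<subseteq> {..a}" by auto
  show "emeasure (mass x) {..a} = 0" by (simp add: emeasure_mass_Iic assms)
qed simp

lemma AE_mass_le:
  assumes "E b x = x" shows "AE s in mass x. s \<le> b"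
proof (rule AE_I)
  interpret finite_measure "mass x" by (rule finite_measure_mass)
  show "{s \<in> space (mass x). \<not> s \<le> b} \<subseteq> UNIV - {..b}" by auto
  have "emeasure (mass x) (UNIV - {..b}) = emeasure (mass x) UNIV - emeasure (mass x) {..b}"
    by (rule emeasure_Diff) (auto simp: emeasure_mass_Iic)
  then show "emeasure (mass x) (UNIV - {..b}) = 0" by (simp add: emeasure_mass_UNIV emeasure_mass_Iic assms)
qed simp

text \<open>The measure of \<open>x\<close> is carried by the half-line above \<open>a\<close>. This
  reads form bounds off an integral representation; \<open>has_bochner_integral_mass\<close> goes
  the other way.\<close>

lemma integral_mass_ge:
  assumes "E a x = 0" and int: "has_bochner_integral (mass x) (\<lambda>s. s) I"
  shows "a * (norm x)\<^sup>2 \<le> I"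
proof -
  interpret finite_measure "mass x" by (rule finite_measure_mass)
  have "(\<integral>s. a \<partial>mass x) \<le> (\<integral>s. s \<partial>mass x)"
    using AE_mass_greater[OF assms(1)] int
    by (intro integral_mono_AE) (auto simp: has_bochner_integral_iff elim: AE_mp)
  then show ?thesis using int by (simp add: has_bochner_integral_iff measure_mass_UNIV mult.commute)
qed

text \<open>The difference of the two sides, as a function of the truncation level \<open>s\<close>, varies by at most
  \<open>h\<close> times the mass on intervals shorter than \<open>h\<close>, hence is constant.\<close>

lemma has_bochner_integral_mass:
  fixes A :: "'a \<Rightarrow> 'a"
  assumes A: "bounded_linear A" "\<And>x y. A x \<bullet> y = x \<bullet> A y"
    and inv: "\<And>s x. A (E s x) \<bullet> (x - E s x) = 0"
    and lower: "\<And>s x. E s x = 0 \<Longrightarrow> s * (norm x)\<^sup>2 \<le> A x \<bullet> x"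
    and upper: "\<And>s x. E s x = x \<Longrightarrow> A x \<bullet> x \<le> s * (norm x)\<^sup>2"
    and m: "\<And>x. E m x = 0" and K: "\<And>x. E K x = x" and mK: "m \<le> K"
  shows "has_bochner_integral (mass x) (\<lambda>s. s) (A x \<bullet> x)"
proof -
  interpret A: bounded_linear A by fact
  interpret M: finite_measure "mass x" by (rule finite_measure_mass)
  have ae: "AE s in mass x. s \<le> K" "AE s in mass x. m < s"
    using AE_mass_le[OF K] AE_mass_greater[OF m] by auto
  have int: "integrable (mass x) (\<lambda>s. s)"
    by (rule M.integrable_const_bound[of _ "max \<bar>m\<bar> \<bar>K\<bar>"]) (use ae in \<open>auto elim!: AE_mp\<close>)
  have intJ: "integrable (mass x) (\<lambda>s. indicator B s * s)" if "B \<in> sets borel" for B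
    using integrable_mult_indicator[OF _ int, of B] that by simp
  have intc: "integrable (mass x) (\<lambda>s. indicator B s * c)" if "B \<in> sets borel" for B and c :: real
    using integrable_mult_indicator[OF _ M.integrable_const, of B c] that by simp
  define J where "J a = (\<integral>s. indicator {..a} s * s \<partial>mass x)" for a
  define d where "d a = A (E a x) \<bullet> x - J a" for a
  define g where "g a = (norm (E a x))\<^sup>2" for a
  have step: "\<bar>d b - d a\<bar> \<le> (b - a) * (g b - g a)" if ab: "a \<le> b" for a b
  proof -
    \<comment> \<open>The increment of the form, which is the form at \<open>v\<close>, and the
      integral over \<open>{a<..b}\<close> both lie between \<open>a\<close> and \<open>b\<close>
      times the squared norm of \<open>v\<close>.\<close>
    define v where "v = E b x - E a x"
    have nv: "(norm v)\<^sup>2 = g b - g a" unfolding v_def g_def by (rule norm_E_diff[OF ab])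
    have "E a v = 0" "E b v = v"
      by (simp_all add: v_def orthogonal_projectorD[OF proj] below ab)
    from lower[OF this(1)] upper[OF this(2)]
    have q: "a * (g b - g a) \<le> A v \<bullet> v" "A v \<bullet> v \<le> b * (g b - g a)" by (auto simp: nv)
    have Ea: "A (E s x) \<bullet> x = A (E s x) \<bullet> E s x" for s using inv[of s x] by (simp add: inner_diff)
    have "A (E a x) \<bullet> E b x = A (E a x) \<bullet> E a x"
      using inv[of a "E b x"] by (simp add: below ab inner_diff)
    then have "A v \<bullet> v = A (E b x) \<bullet> x - A (E a x) \<bullet> x"
      using A(2)[of "E b x" "E a x"] unfolding Ea by (simp add: v_def A.diff inner_diff inner_commute)
    moreover have "J b - J a = (\<integral>s. indicator {a<..b} s * s \<partial>mass x)"
      unfolding J_def using ab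
      by (subst Bochner_Integration.integral_diff[symmetric])
         (auto intro!: intJ Bochner_Integration.integral_cong split: split_indicator)
    moreover have "(\<integral>s. indicator {a<..b} s * s \<partial>mass x) \<le> (\<integral>s. indicator {a<..b} s * b \<partial>mass x)"
      by (intro integral_mono intJ intc) (auto split: split_indicator)
    moreover have "(\<integral>s. indicator {a<..b} s * a \<partial>mass x) \<le> (\<integral>s. indicator {a<..b} s * s \<partial>mass x)"
      by (intro integral_mono intJ intc) (auto split: split_indicator)
    moreover have "(\<integral>s. indicator {a<..b} s * a \<partial>mass x) = a * (g b - g a)"
      "(\<integral>s. indicator {a<..b} s * b \<partial>mass x) = b * (g b - g a)"
      using measure_mass_Ioc[OF ab, of x] by (simp_all add: g_def)
    moreover have "(b - a) * (g b - g a) = b * (g b - g a) - a * (g b - g a)" by (simp add: algebra_simps)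
    ultimately show ?thesis using q unfolding d_def by linarith
  qed
  \<comment> \<open>Chop \<open>[m, K]\<close> into pieces shorter than \<open>h\<close>: the error
    bounds telescope to \<open>h\<close> times the total mass, and \<open>h\<close> is
    arbitrary.\<close>
  have small: "\<bar>d K - d m\<bar> \<le> h * (g K - g m)" if h: "h > 0" for h
  proof -
    define P where "P a b \<longleftrightarrow> \<bar>d b - d a\<bar> \<le> h * (g b - g a)" for a b
    have "P m K"
    proof (rule Bolzano[OF mK])
      fix a b c assume "P a b" "P b c"
      then have "\<bar>d b - d a\<bar> \<le> h * (g b - g a)" "\<bar>d c - d b\<bar> \<le> h * (g c - g b)"
        by (auto simp: P_def)
      moreover have "h * (g b - g a) + h * (g c - g b) = h * (g c - g a)" by (simp add: algebra_simps)
      ultimately show "P a c" unfolding P_def by linarith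
    next
      fix s
      have "P a b" if "b - a < h" "a \<le> b" for a b
      proof -
        have "g a \<le> g b" using norm_E_mono[OF that(2)] by (simp add: g_def)
        then show ?thesis
          using step[OF that(2)] mult_right_mono[of "b - a" h "g b - g a"] that by (auto simp: P_def)
      qed
      then show "\<exists>r>0. \<forall>a b. a \<le> s \<and> s \<le> b \<and> b - a < r \<longrightarrow> P a b"
        using h by (meson order_trans)
    qed
    then show ?thesis by (simp add: P_def)
  qed
  have g: "g m = 0" "g K = (norm x)\<^sup>2" by (auto simp: g_def m K)
  have "\<bar>d K - d m\<bar> \<le> 0"
  proof (rule field_le_epsilon[of _ 0, simplified])
    fix e :: real assume e: "e > 0"
    have "\<bar>d K - d m\<bar> \<le> e / ((norm x)\<^sup>2 + 1) * (norm x)\<^sup>2"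
      using small[of "e / ((norm x)\<^sup>2 + 1)"] e g by (simp add: add_nonneg_pos)
    also have "\<dots> \<le> e"
    proof -
      have "(norm x)\<^sup>2 + 1 > 0" by (simp add: add_nonneg_pos)
      then show ?thesis using e by (simp add: pos_divide_le_eq)
    qed
    finally show "\<bar>d K - d m\<bar> \<le> e" .
  qed
  then have "d K = d m" by simp
  moreover have "J m = 0"
    unfolding J_def using ae by (intro integral_eq_zero_AE) (auto elim!: AE_mp)
  moreover have "J K = (\<integral>s. s \<partial>mass x)"
    unfolding J_def using ae by (intro integral_cong_AE) (auto elim!: AE_mp)
  ultimately have "A x \<bullet> x = (\<integral>s. s \<partial>mass x)" by (simp add: d_def m K A.zero)
  then show ?thesis using int by (simp add: has_bochner_integral_iff)
qed

end

lemma resolution_of_identity_of_spectral_family: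
  assumes "resolution_of_identity_of A E" shows "spectral_family E"
proof -
  have "E s (E u x) = E s x" "E u (E s x) = E s x" if "s \<le> u" for s u x
    using assms that unfolding resolution_of_identity_of_def by (auto simp: fun_eq_iff)
  then show ?thesis using assms unfolding resolution_of_identity_of_def
    by (unfold_locales) auto
qed

section \<open>Resolution of the identity of a compact positive operator\<close>

locale psd_operator =
  fixes A :: "'a::{real_inner,complete_space} \<Rightarrow> 'a"
  assumes linear: "bounded_linear A"
    and symmetric: "A x \<bullet> y = x \<bullet> A y"
    and psd: "0 \<le> A x \<bullet> x"
begin

sublocale A: bounded_linear A by (rule linear)

lemma psd_Cauchy_Schwarz: "(A x \<bullet> y)\<^sup>2 \<le> (A x \<bullet> x) * (A y \<bullet> y)"
proof -
  define q r where "q = A x \<bullet> y" and "r = A y \<bullet> y"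
  have quad: "0 \<le> A x \<bullet> x + 2 * t * q + t\<^sup>2 * r" for t
    using psd[of "x + t *\<^sub>R y"] symmetric[of x y]
    by (simp add: q_def r_def A.add A.scaleR inner_add inner_commute power2_eq_square algebra_simps)
  show ?thesis
  proof (cases "r = 0")
    case True
    \<comment> \<open>If the form vanishes at \<open>y\<close>, the expression is affine in
      \<open>t\<close> and would become negative unless its slope is zero.\<close>
    have "q = 0"
    proof (rule ccontr)
      assume "q \<noteq> 0"
      then have "2 * (- (A x \<bullet> x + 1) / (2 * q)) * q = - (A x \<bullet> x + 1)" by simp
      then show False using quad[of "- (A x \<bullet> x + 1) / (2 * q)"] True by simp
    qed
    then show ?thesis using True by (simp add: q_def r_def)
  next
    case False
    then have r: "r > 0" using psd[of y] by (simp add: r_def)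
    have "A x \<bullet> x + 2 * (- q / r) * q + (- q / r)\<^sup>2 * r = A x \<bullet> x - q\<^sup>2 / r"
      using r by (simp add: power2_eq_square field_simps)
    then have "q\<^sup>2 / r \<le> A x \<bullet> x" using quad[of "- q / r"] by simp
    then show ?thesis using r by (simp add: q_def[symmetric] r_def[symmetric] pos_divide_le_eq)
  qed
qed

text \<open>Cauchy-Schwarz for the form, applied to \<open>x\<close> and \<open>A x\<close>. The
  bound enters only at \<open>A x\<close>, so \<open>c\<close> may come from an invariant
  subspace.\<close>

lemma norm_image_le:
  assumes "A (A x) \<bullet> A x \<le> c * (norm (A x))\<^sup>2"
  shows "(norm (A x))\<^sup>2 \<le> c * (A x \<bullet> x)"
proof (cases "A x = 0")
  case False
  have "(norm (A x))\<^sup>2 * (norm (A x))\<^sup>2 = (A x \<bullet> A x)\<^sup>2"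
    unfolding power2_norm_eq_inner by (rule power2_eq_square[symmetric])
  also have "\<dots> \<le> (A x \<bullet> x) * (A (A x) \<bullet> A x)" by (rule psd_Cauchy_Schwarz)
  also have "\<dots> \<le> (A x \<bullet> x) * (c * (norm (A x))\<^sup>2)" by (rule mult_left_mono[OF assms psd])
  also have "\<dots> = (c * (A x \<bullet> x)) * (norm (A x))\<^sup>2" by (simp add: mult_ac)
  finally show ?thesis by (rule mult_right_le_imp_le) (simp add: False)
qed simp

lemma bound: obtains K where "K > 0" "\<And>x. norm (A x) \<le> K * norm x"
proof -
  obtain K where "K > 0" "\<And>x. norm (A x) \<le> norm x * K" using A.pos_bounded by blast
  then show thesis by (intro that[of K]) (simp_all add: mult.commute)
qed

lemma quadratic_le: "norm (A x) \<le> K * norm x \<Longrightarrow> A x \<bullet> x \<le> K * (norm x)\<^sup>2"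
  using norm_cauchy_schwarz[of "A x" x] mult_right_mono[of "norm (A x)" "K * norm x" "norm x"]
  by (simp add: power2_eq_square mult.assoc)

lemma quadratic_eq_0: assumes "A x \<bullet> x = 0" shows "A x = 0"
proof -
  obtain K where "\<And>x. norm (A x) \<le> K * norm x" using bound by blast
  from norm_image_le[OF quadratic_le[OF this], of x] assms show ?thesis by simp
qed

end

section \<open>Closed spans of eigenvectors and the spectral family they define\<close>

definition eigenvectors_above :: "('a::real_vector \<Rightarrow> 'a) \<Rightarrow> real \<Rightarrow> 'a set" where
  "eigenvectors_above A s = {v. \<exists>\<kappa>>s. A v = \<kappa> *\<^sub>R v}"

text \<open>The spectral subspace of the open half-line above \<open>s\<close>. The strict
  inequality between level and eigenvalue yields right-continuity; for negative \<open>s\<close> the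
  kernel is included.\<close>

definition eigenspan :: "('a::real_normed_vector \<Rightarrow> 'a) \<Rightarrow> real \<Rightarrow> 'a set" where
  "eigenspan A s = closure (span (eigenvectors_above A s))"

lemma subspace_closure:
  fixes S :: "'a::real_normed_vector set"
  assumes S: "subspace S" shows "subspace (closure S)"
proof (rule subspaceI)
  show "0 \<in> closure S" using subspace_0[OF S] closure_subset by blast
  show "x + y \<in> closure S" if xy: "x \<in> closure S" "y \<in> closure S" for x y
  proof -
    obtain u where u: "\<forall>n. u n \<in> S" "u \<longlonglongrightarrow> x" using xy(1) unfolding closure_sequential by blast
    obtain v where v: "\<forall>n. v n \<in> S" "v \<longlonglongrightarrow> y" using xy(2) unfolding closure_sequential by blast
    from u v show ?thesis unfolding closure_sequential
      by (intro exI[of _ "\<lambda>n. u n + v n"]) (auto intro!: tendsto_intros subspace_add[OF S])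
  qed
  show "c *\<^sub>R x \<in> closure S" if x: "x \<in> closure S" for x c
  proof -
    obtain u where "\<forall>n. u n \<in> S" "u \<longlonglongrightarrow> x" using x unfolding closure_sequential by blast
    then show ?thesis unfolding closure_sequential
      by (intro exI[of _ "\<lambda>n. c *\<^sub>R u n"]) (auto intro!: tendsto_intros subspace_scale[OF S])
  qed
qed

lemma subspace_eigenspan: "subspace (eigenspan A s)" and closed_eigenspan: "closed (eigenspan A s)"
  by (auto simp: eigenspan_def subspace_closure)

lemma eigenvectors_above_subset_eigenspan: "eigenvectors_above A s \<subseteq> eigenspan A s"
  unfolding eigenspan_def by (meson closure_subset order_trans span_superset)

lemma eigenvectors_above_antimono: "s \<le> u \<Longrightarrow> eigenvectors_above A u \<subseteq> eigenvectors_above A s"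
  unfolding eigenvectors_above_def by force

lemma eigenspan_antimono: "s \<le> u \<Longrightarrow> eigenspan A u \<subseteq> eigenspan A s"
  unfolding eigenspan_def by (intro closure_mono span_mono eigenvectors_above_antimono)

text \<open>Projecting away from the eigenvectors above \<open>s\<close>, rather than onto those
  below, defers the completeness of the eigenvectors to the limit at minus infinity.\<close>

definition eigenfamily :: "('a::real_inner \<Rightarrow> 'a) \<Rightarrow> real \<Rightarrow> 'a \<Rightarrow> 'a" where
  "eigenfamily A s x = x - orthogonal_projection (eigenspan A s) x"

context psd_operator
begin

abbreviation V where "V \<equiv> eigenvectors_above A"
abbreviation R where "R \<equiv> eigenspan A"
abbreviation E where "E \<equiv> eigenfamily A"

lemma projector_E: "orthogonal_projector (E s)"
  unfolding eigenfamily_def[abs_def]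
  by (intro orthogonal_projector_complement orthogonal_projector_orthogonal_projection
      subspace_eigenspan closed_eigenspan)

lemma E_orth: "v \<in> R s \<Longrightarrow> E s x \<bullet> v = 0"
  unfolding eigenfamily_def by (rule orthogonal_projection_orth[OF subspace_eigenspan closed_eigenspan])

lemma E_diff_mem: "x - E s x \<in> R s"
  unfolding eigenfamily_def by (simp add: orthogonal_projection_mem[OF subspace_eigenspan closed_eigenspan])

lemma E_eq_self: "(\<And>v. v \<in> R s \<Longrightarrow> x \<bullet> v = 0) \<Longrightarrow> E s x = x"
  unfolding eigenfamily_def by (simp add: orthogonal_projection_eq_0[OF subspace_eigenspan closed_eigenspan])

lemma E_eq_0: "x \<in> R s \<Longrightarrow> E s x = 0"
  unfolding eigenfamily_def by (simp add: orthogonal_projection_eq_self[OF subspace_eigenspan closed_eigenspan])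

lemma E_below:
  assumes "s \<le> u" shows "E s (E u x) = E s x" "E u (E s x) = E s x"
proof -
  have "x - E u x \<in> R s" using E_diff_mem eigenspan_antimono[OF assms] by blast
  then have "E s (x - E u x) = 0" by (rule E_eq_0)
  then show "E s (E u x) = E s x" by (simp add: orthogonal_projectorD[OF projector_E])
  show "E u (E s x) = E s x"
    using E_orth eigenspan_antimono[OF assms] by (intro E_eq_self) blast
qed

lemma A_span: assumes "v \<in> span (V s)" shows "A v \<in> span (V s)"
  using assms
proof (induction rule: span_induct_alt)
  case base show ?case by (simp add: A.zero span_zero)
next
  case (step c x y)
  from step(1) obtain \<kappa> where "A x = \<kappa> *\<^sub>R x" by (auto simp: eigenvectors_above_def)
  with step show ?case by (simp add: A.add A.scaleR span_add span_scale span_base)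
qed

lemma A_R: assumes "x \<in> R s" shows "A x \<in> R s"
proof -
  obtain u where u: "\<forall>n. u n \<in> span (V s)" "u \<longlonglongrightarrow> x"
    using assms unfolding eigenspan_def closure_sequential by blast
  then show ?thesis unfolding eigenspan_def closure_sequential
    by (intro exI[of _ "\<lambda>n. A (u n)"]) (auto intro: A_span A.tendsto)
qed

lemma A_E_orth: "A (E s x) \<bullet> (x - E s x) = 0"
  by (simp add: symmetric E_orth A_R E_diff_mem)

lemma eigenvectors_orthogonal:
  assumes "A v = \<kappa> *\<^sub>R v" "A w = \<mu> *\<^sub>R w" "\<kappa> \<noteq> \<mu>" shows "v \<bullet> w = 0"
  using symmetric[of v w] assms by simp

text \<open>Grouping by eigenvalue makes the summands pairwise orthogonal, so that the form becomes
  a diagonal sum.\<close>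

lemma span_decomposition:
  assumes "x \<in> span (V s)"
  shows "\<exists>L v. finite L \<and> (\<forall>\<kappa>\<in>L. s < \<kappa> \<and> A (v \<kappa>) = \<kappa> *\<^sub>R v \<kappa>) \<and> x = (\<Sum>\<kappa>\<in>L. v \<kappa>)"
  using assms
proof (induction rule: span_induct_alt)
  case base show ?case by (intro exI[of _ "{}"]) auto
next
  case (step c x y)
  obtain \<mu> where \<mu>: "\<mu> > s" "A x = \<mu> *\<^sub>R x" using step(1) by (auto simp: eigenvectors_above_def)
  obtain L v where L: "finite L" "\<And>\<kappa>. \<kappa> \<in> L \<Longrightarrow> s < \<kappa> \<and> A (v \<kappa>) = \<kappa> *\<^sub>R v \<kappa>" "y = (\<Sum>\<kappa>\<in>L. v \<kappa>)"
    using step(2) by blast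
  \<comment> \<open>The new vector joins the component already present for its eigenvalue; if
    \<open>\<mu>\<close> is outside \<open>L\<close>, the stray value \<open>v \<mu>\<close> is
    discarded.\<close>
  define v' where "v' = v (\<mu> := c *\<^sub>R x + (if \<mu> \<in> L then v \<mu> else 0))"
  have "A (v' \<kappa>) = \<kappa> *\<^sub>R v' \<kappa> \<and> s < \<kappa>" if "\<kappa> \<in> insert \<mu> L" for \<kappa>
    using that \<mu> L(2) by (auto simp: v'_def A.add A.scaleR A.zero scaleR_add_right)
  moreover have "c *\<^sub>R x + y = (\<Sum>\<kappa>\<in>insert \<mu> L. v' \<kappa>)"
  proof -
    have "(\<Sum>\<kappa>\<in>insert \<mu> L. v' \<kappa>) = v' \<mu> + (\<Sum>\<kappa>\<in>L - {\<mu>}. v' \<kappa>)"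
      using L(1) by (rule sum.insert_remove)
    also have "(\<Sum>\<kappa>\<in>L - {\<mu>}. v' \<kappa>) = (\<Sum>\<kappa>\<in>L - {\<mu>}. v \<kappa>)"
      by (intro sum.cong) (auto simp: v'_def)
    also have "v' \<mu> + \<dots> = c *\<^sub>R x + y"
      unfolding L(3) using L(1) by (auto simp: v'_def sum.remove[of L \<mu>])
    finally show ?thesis by simp
  qed
  ultimately show ?case using L(1) by (intro exI[of _ "insert \<mu> L"] exI[of _ v']) auto
qed

lemma quadratic_lower_span:
  assumes "x \<in> span (V s)" shows "s * (norm x)\<^sup>2 \<le> A x \<bullet> x"
proof -
  obtain L v where L: "finite L" "\<And>\<kappa>. \<kappa> \<in> L \<Longrightarrow> s < \<kappa> \<and> A (v \<kappa>) = \<kappa> *\<^sub>R v \<kappa>" "x = (\<Sum>\<kappa>\<in>L. v \<kappa>)"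
    using span_decomposition[OF assms] by blast
  have diag: "v \<kappa> \<bullet> x = v \<kappa> \<bullet> v \<kappa>" if "\<kappa> \<in> L" for \<kappa>
  proof -
    have "v \<kappa> \<bullet> x = (\<Sum>\<mu>\<in>L. if \<mu> = \<kappa> then v \<kappa> \<bullet> v \<kappa> else 0)"
      unfolding L(3) inner_sum_right
      using L(2) that eigenvectors_orthogonal[of "v \<kappa>" \<kappa>] by (intro sum.cong) auto
    then show ?thesis using L(1) that by simp
  qed
  have "A x = (\<Sum>\<kappa>\<in>L. \<kappa> *\<^sub>R v \<kappa>)" using L(2) by (simp add: L(3) A.sum)
  then have "A x \<bullet> x = (\<Sum>\<kappa>\<in>L. \<kappa> * (v \<kappa> \<bullet> v \<kappa>))" by (simp add: inner_sum_left diag)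
  moreover have "(norm x)\<^sup>2 = (\<Sum>\<kappa>\<in>L. v \<kappa> \<bullet> v \<kappa>)"
    unfolding power2_norm_eq_inner by (subst (1) L(3)) (simp add: inner_sum_left diag)
  moreover have "s * (\<Sum>\<kappa>\<in>L. v \<kappa> \<bullet> v \<kappa>) \<le> (\<Sum>\<kappa>\<in>L. \<kappa> * (v \<kappa> \<bullet> v \<kappa>))"
    unfolding sum_distrib_left using L(2) by (intro sum_mono mult_right_mono) (auto simp: less_imp_le)
  ultimately show ?thesis by simp
qed

lemma quadratic_lower: assumes "x \<in> R s" shows "s * (norm x)\<^sup>2 \<le> A x \<bullet> x"
proof -
  obtain u where u: "\<forall>n. u n \<in> span (V s)" "u \<longlonglongrightarrow> x"
    using assms unfolding eigenspan_def closure_sequential by blast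
  have "(\<lambda>n. A (u n)) \<longlonglongrightarrow> A x" by (rule A.tendsto[OF u(2)])
  then show ?thesis
    by (intro LIMSEQ_le[of "\<lambda>n. s * (norm (u n))\<^sup>2" _ "\<lambda>n. A (u n) \<bullet> u n"])
       (use u in \<open>auto intro!: tendsto_intros quadratic_lower_span\<close>)
qed

text \<open>A finite combination involves finitely many eigenvalues, all strictly above
  \<open>s\<close>, which leaves room to raise the level.\<close>

lemma span_eigenvectors_above_right:
  assumes "x \<in> span (V s)" shows "\<forall>\<^sub>F u in at_right s. x \<in> span (V u)"
  using assms
proof (induction rule: span_induct_alt)
  case base show ?case by (simp add: span_zero)
next
  case (step c x y)
  obtain \<mu> where \<mu>: "\<mu> > s" "A x = \<mu> *\<^sub>R x" using step(1) by (auto simp: eigenvectors_above_def)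
  have "\<forall>\<^sub>F u in at_right s. x \<in> V u"
    using \<mu> by (auto simp: eventually_at_right_field eigenvectors_above_def intro!: exI[of _ \<mu>])
  then show ?case using step(2)
    by eventually_elim (intro span_add span_scale, auto intro: span_base)
qed

text \<open>Approximate \<open>x - E s x\<close> by a finite combination \<open>v\<close> of
  eigenvectors. For \<open>u\<close> slightly above \<open>s\<close> the projector
  \<open>E u\<close> kills \<open>v\<close>, so \<open>E u x - E s x\<close> is the image of a small
  vector under a contraction.\<close>

lemma E_right_limit: "((\<lambda>u. E u x) \<longlongrightarrow> E s x) (at_right s)"
proof (rule tendstoI)
  fix e :: real assume e: "e > 0"
  obtain v where v: "v \<in> span (V s)" "dist v (x - E s x) < e"
    using E_diff_mem[of x s] e unfolding eigenspan_def closure_approachable by blast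
  have "\<forall>\<^sub>F u in at_right s. u > s" by (simp add: eventually_at_right_less)
  with span_eigenvectors_above_right[OF v(1)]
  show "\<forall>\<^sub>F u in at_right s. dist (E u x) (E s x) < e"
  proof eventually_elim
    fix u assume u: "v \<in> span (V u)" "s < u"
    then have "v \<in> R u" unfolding eigenspan_def using closure_subset by blast
    then have Ev: "E u v = 0" by (rule E_eq_0)
    have "E u (x - E s x - v) = E u x - E s x"
      using E_below(2)[of s u x] u(2) by (simp add: orthogonal_projectorD[OF projector_E] Ev)
    then have "dist (E u x) (E s x) \<le> norm (x - E s x - v)"
      using orthogonal_projectorD(5)[OF projector_E[of u], of "x - E s x - v"] by (simp add: dist_norm)
    also have "\<dots> < e" using v(2) by (simp add: dist_norm norm_minus_commute)
    finally show "dist (E u x) (E s x) < e" .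
  qed
qed

end

locale compact_psd_operator = psd_operator +
  assumes compact: "compact (closure (A ` cball 0 1))"
begin

text \<open>The supremum \<open>c\<close> of the form on the unit ball of \<open>W\<close> is an
  eigenvalue: along a maximising sequence \<open>norm_image_le\<close> forces
  \<open>A x - c *\<^sub>R x\<close> to zero, compactness makes \<open>A x\<close> converge along a
  subsequence, and \<open>c > b \<ge> 0\<close> permits division by \<open>c\<close>.\<close>

lemma eigenvector_exists:
  assumes W: "subspace W" "closed W" and inv: "\<And>x. x \<in> W \<Longrightarrow> A x \<in> W" and b: "b \<ge> 0"
    and x0: "x0 \<in> W" "A x0 \<bullet> x0 > b * (norm x0)\<^sup>2"
  shows "\<exists>x\<in>W. x \<noteq> 0 \<and> (\<exists>\<kappa>>b. A x = \<kappa> *\<^sub>R x)"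
proof -
  define B where "B = {x \<in> W. norm x \<le> 1}"
  define c where "c = (SUP x\<in>B. A x \<bullet> x)"
  obtain K where K: "K > 0" "\<And>x. norm (A x) \<le> K * norm x" using bound by blast
  have bdd: "bdd_above ((\<lambda>x. A x \<bullet> x) ` B)"
  proof (rule bdd_aboveI2)
    fix x assume "x \<in> B"
    then have "K * (norm x)\<^sup>2 \<le> K * 1" using K by (intro mult_left_mono) (auto simp: B_def power_le_one)
    then show "A x \<bullet> x \<le> K" using quadratic_le[OF K(2), of x] by simp
  qed
  have quad: "A x \<bullet> x \<le> c * (norm x)\<^sup>2" if x: "x \<in> W" for x
  proof (cases "x = 0")
    case False
    have "(1 / norm x) *\<^sub>R x \<in> B" using x W False by (auto simp: B_def subspace_scale)
    then have "A ((1 / norm x) *\<^sub>R x) \<bullet> ((1 / norm x) *\<^sub>R x) \<le> c"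
      unfolding c_def by (intro cSUP_upper bdd)
    then have "(A x \<bullet> x) / (norm x)\<^sup>2 \<le> c" by (simp add: A.scaleR power2_eq_square)
    then show ?thesis using False by (simp add: pos_divide_le_eq)
  qed (simp add: A.zero)
  have x0n: "x0 \<noteq> 0" using x0(2) A.zero by auto
  have "b * (norm x0)\<^sup>2 < c * (norm x0)\<^sup>2" using x0 quad by (meson less_le_trans)
  then have cb: "c > b" using x0n by simp
  then have c0: "c > 0" using b by simp
  have "\<exists>x\<in>B. c - 1 / Suc n < A x \<bullet> x" for n
  proof -
    have "0 \<in> B" using subspace_0[OF W(1)] by (simp add: B_def)
    then have "B \<noteq> {}" by blast
    from less_cSUP_iff[OF this bdd, of "c - 1 / Suc n"] show ?thesis by (simp add: c_def)
  qed
  then obtain x where x: "\<And>n. x n \<in> B" "\<And>n. c - 1 / Suc n < A (x n) \<bullet> x n" by metis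
  have xW: "x n \<in> W" "norm (x n) \<le> 1" for n using x(1) by (auto simp: B_def)
  have "A (x n) \<in> closure (A ` cball 0 1)" for n using xW closure_subset by fastforce
  then obtain l r where lr: "strict_mono r" "((\<lambda>n. A (x n)) \<circ> r) \<longlonglongrightarrow> l"
    using compact_imp_seq_compact[OF compact] unfolding seq_compact_def by metis
  have small: "(norm (A (x n) - c *\<^sub>R x n))\<^sup>2 \<le> c * (1 / Suc n)" for n
  proof -
    have "(norm (A (x n) - c *\<^sub>R x n))\<^sup>2 = (norm (A (x n)))\<^sup>2 - 2 * c * (A (x n) \<bullet> x n) + c\<^sup>2 * (norm (x n))\<^sup>2"
      unfolding power2_norm_eq_inner by (simp add: inner_diff inner_commute algebra_simps power2_eq_square)
    also have "\<dots> \<le> c * (A (x n) \<bullet> x n) - 2 * c * (A (x n) \<bullet> x n) + c\<^sup>2 * 1"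
      using norm_image_le[OF quad[OF inv[OF xW(1)]], of n] xW(2)[of n]
      by (intro add_mono diff_right_mono mult_left_mono) (auto simp: power_le_one)
    also have "\<dots> = c * (c - A (x n) \<bullet> x n)" by (simp add: power2_eq_square algebra_simps)
    also have "\<dots> \<le> c * (1 / Suc n)" using x(2)[of n] c0 by (intro mult_left_mono) auto
    finally show ?thesis .
  qed
  have inv0: "(\<lambda>n. 1 / real (Suc n)) \<longlonglongrightarrow> 0" using LIMSEQ_inverse_real_of_nat by (simp add: inverse_eq_divide)
  have "(\<lambda>n. A (x n) - c *\<^sub>R x n) \<longlonglongrightarrow> 0"
  proof -
    have "(\<lambda>n. c * (1 / real (Suc n))) \<longlonglongrightarrow> 0" by (rule tendsto_mult_right_zero[OF inv0])
    then have "(\<lambda>n. (norm (A (x n) - c *\<^sub>R x n))\<^sup>2) \<longlonglongrightarrow> 0"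
      by (rule Lim_null_comparison[rotated]) (use small in simp)
    then have "(\<lambda>n. sqrt ((norm (A (x n) - c *\<^sub>R x n))\<^sup>2)) \<longlonglongrightarrow> sqrt 0" by (rule tendsto_real_sqrt)
    then show ?thesis by (simp add: tendsto_norm_zero_iff)
  qed
  then have "((\<lambda>n. A (x n) - c *\<^sub>R x n) \<circ> r) \<longlonglongrightarrow> 0" by (rule LIMSEQ_subseq_LIMSEQ[OF _ lr(1)])
  with lr(2) have "(\<lambda>n. A (x (r n)) - (A (x (r n)) - c *\<^sub>R x (r n))) \<longlonglongrightarrow> l - 0"
    unfolding o_def by (intro tendsto_diff)
  then have "(\<lambda>n. (1 / c) *\<^sub>R c *\<^sub>R x (r n)) \<longlonglongrightarrow> (1 / c) *\<^sub>R l" by (intro tendsto_intros) simp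
  then have lim: "(\<lambda>n. x (r n)) \<longlonglongrightarrow> (1 / c) *\<^sub>R l" using c0 by simp
  define z where "z = (1 / c) *\<^sub>R l"
  have zW: "z \<in> W" using closed_sequentially[OF W(2), of "\<lambda>n. x (r n)"] xW lim by (auto simp: z_def)
  have lA: "(\<lambda>n. A (x (r n))) \<longlonglongrightarrow> A z" using A.tendsto[OF lim] by (simp add: z_def)
  moreover have "(\<lambda>n. A (x (r n))) \<longlonglongrightarrow> l" using lr(2) by (simp add: o_def)
  ultimately have "A z = l" by (rule LIMSEQ_unique)
  then have Az: "A z = c *\<^sub>R z" using c0 by (simp add: z_def)
  have "A z \<bullet> z \<ge> c - 0"
  proof (rule LIMSEQ_le)
    show "(\<lambda>n. A (x (r n)) \<bullet> x (r n)) \<longlonglongrightarrow> A z \<bullet> z"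
      using tendsto_inner[OF lA lim] by (simp only: z_def)
    from LIMSEQ_subseq_LIMSEQ[OF inv0 lr(1)]
    show "(\<lambda>n. c - 1 / Suc (r n)) \<longlonglongrightarrow> c - 0" by (intro tendsto_intros) (simp add: o_def)
    show "\<exists>N. \<forall>n\<ge>N. c - 1 / Suc (r n) \<le> A (x (r n)) \<bullet> x (r n)" using x(2) less_imp_le by blast
  qed
  then have "z \<noteq> 0" using c0 A.zero by auto
  with zW Az cb show ?thesis by blast
qed

text \<open>The range of \<open>E s\<close> is invariant. Were the form too large on it, it would
  contain an eigenvector with eigenvalue above \<open>s\<close>, but it is orthogonal to all of
  these.\<close>

lemma quadratic_upper_nonneg:
  assumes "s \<ge> 0" "E s x = x" shows "A x \<bullet> x \<le> s * (norm x)\<^sup>2"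
proof (rule ccontr)
  assume "\<not> ?thesis"
  then have x: "A x \<bullet> x > s * (norm x)\<^sup>2" by simp
  define W where "W = {y. E s y = y}"
  interpret Es: bounded_linear "E s" by (rule orthogonal_projectorD(1)[OF projector_E])
  have W: "subspace W" "closed W"
    unfolding W_def
    by (auto simp: subspace_def Es.add Es.scaleR Es.zero intro!: closed_Collect_eq Es.continuous_on continuous_intros)
  have inv: "A y \<in> W" if "y \<in> W" for y
    unfolding W_def
  proof (intro CollectI E_eq_self)
    fix v assume "v \<in> R s"
    then show "A y \<bullet> v = 0" using E_orth[OF A_R, of v s y] that by (simp add: W_def symmetric)
  qed
  obtain z \<kappa> where z: "z \<in> W" "z \<noteq> 0" "\<kappa> > s" "A z = \<kappa> *\<^sub>R z"
    using eigenvector_exists[OF W inv assms(1) _ x] assms(2) by (auto simp: W_def)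
  then have "z \<in> R s" using eigenvectors_above_subset_eigenspan by (force simp: eigenvectors_above_def)
  then have "E s z = 0" by (rule E_eq_0)
  with z show False by (simp add: W_def)
qed

text \<open>Completeness of the eigenvectors: a vector in the range of \<open>E s\<close> has form
  zero by the bound at level 0, hence lies in the kernel, and the kernel is part of
  \<open>V s\<close>.\<close>

lemma E_negative: assumes "s < 0" shows "E s x = 0"
proof -
  define y where "y = E s x"
  have "E 0 y = y" using E_below(2)[of s 0 x] assms by (simp add: y_def)
  from quadratic_upper_nonneg[OF _ this] have "A y = 0" using psd[of y] by (intro quadratic_eq_0) simp
  then have "y \<in> V s" using assms by (auto simp: eigenvectors_above_def intro!: exI[of _ 0])
  then have "y \<in> R s" using eigenvectors_above_subset_eigenspan by blast
  then have "y \<bullet> y = 0" using E_orth[of y s x] by (simp add: y_def)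
  then show ?thesis by (simp add: y_def)
qed

lemma quadratic_upper: assumes "E s x = x" shows "A x \<bullet> x \<le> s * (norm x)\<^sup>2"
  using quadratic_upper_nonneg[OF _ assms] E_negative[of s x] assms A.zero by (cases "s < 0") auto

lemma E_top: assumes K: "\<And>x. norm (A x) \<le> K * norm x" and s: "K < s" shows "E s x = x"
proof -
  have "x - E s x = 0"
  proof (rule ccontr)
    assume n: "x - E s x \<noteq> 0"
    have "s * (norm (x - E s x))\<^sup>2 \<le> K * (norm (x - E s x))\<^sup>2"
      using quadratic_lower[OF E_diff_mem] quadratic_le[OF K] by (rule order_trans)
    then show False using s n by simp
  qed
  then show ?thesis by simp
qed

lemma quadratic_lower_E: assumes "E s x = 0" shows "s * (norm x)\<^sup>2 \<le> A x \<bullet> x"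
  using E_diff_mem[of x s] assms by (intro quadratic_lower) simp

theorem resolution_of_identity_exists: "resolution_of_identity_of A E"
proof -
  obtain K where K: "K > 0" "\<And>x. norm (A x) \<le> K * norm x" using bound by blast
  have bot: "((\<lambda>s. E s x) \<longlongrightarrow> 0) at_bot" for x
    by (rule tendsto_eventually) (auto simp: eventually_at_bot_linorder E_negative intro!: exI[of _ "-1"])
  have top: "((\<lambda>s. E s x) \<longlongrightarrow> x) at_top" for x
    using E_top[OF K(2)]
    by (intro tendsto_eventually) (auto simp: eventually_at_top_dense intro!: exI[of _ K])
  interpret spectral_family E
    by unfold_locales (auto intro: projector_E E_below E_right_limit bot top)
  have "has_bochner_integral (mass x) (\<lambda>s. s) (A x \<bullet> x)" for x
    by (rule has_bochner_integral_mass[OF linear symmetric A_E_orth quadratic_lower_E quadratic_upper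
          E_negative[of "-1"] E_top[OF K(2), of "K + 1"]]) (use K in auto)
  then show ?thesis
    unfolding resolution_of_identity_of_def
    by (intro conjI allI impI linear symmetric projector_E E_right_limit bot top) (simp_all add: fun_eq_iff E_below)
qed

text \<open>From here on the chosen family takes over from the explicit one, which has served to
  show that the choice succeeds.\<close>

lemma resolution_of_identity: "resolution_of_identity_of A (resolution_of_identity A)"
  unfolding resolution_of_identity_def by (rule someI[of "resolution_of_identity_of A"]) (rule resolution_of_identity_exists)

end

section \<open>Spectral projectors above a positive level\<close>

text \<open>The sets where \<open>f\<close> takes a given value are convex, by
  \<open>between\<close>, and one of the finitely many values recurs arbitrarily close to
  \<open>e\<close>; from any of its occurrences on it is kept. Serves both for projectors in the
  level and for projectors in time.\<close>

lemma eventually_constant_left: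
  fixes f :: "real \<Rightarrow> 'b"
  assumes ae: "a < e" and fin: "finite (f ` {a..<e})"
    and between: "\<And>s t u. a \<le> s \<Longrightarrow> s \<le> t \<Longrightarrow> t \<le> u \<Longrightarrow> u < e \<Longrightarrow> f s = f u \<Longrightarrow> f t = f s"
  shows "\<exists>d. a \<le> d \<and> d < e \<and> (\<forall>s\<in>{d..<e}. f s = f d)"
proof -
  have near: "\<forall>\<^sub>F s in at_left e. b < s \<and> s < e" if "b < e" for b
    unfolding eventually_at_left_field using that by blast
  have "\<exists>\<^sub>F s in at_left e. \<exists>c\<in>f ` {a..<e}. f s = c"
  proof (rule eventually_frequently)
    show "\<forall>\<^sub>F s in at_left e. \<exists>c\<in>f ` {a..<e}. f s = c"
      by (rule eventually_mono[OF near[OF ae]]) simp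
  qed simp
  from frequently_bex_finite[OF fin this] obtain c where c: "\<exists>\<^sub>F s in at_left e. f s = c" by (elim bexE)
  have ex: "\<exists>s>b. s < e \<and> f s = c" if "b < e" for b
  proof -
    have "\<exists>\<^sub>F s in at_left e. f s = c \<and> (b < s \<and> s < e)"
      by (rule frequently_eventually_frequently[OF c near[OF that]])
    then show ?thesis using frequently_ex by fastforce
  qed
  obtain d where d: "a < d" "d < e" "f d = c" using ex[OF ae] by (elim exE conjE)
  have "f s = f d" if s: "s \<in> {d..<e}" for s
  proof -
    from s have "s < e" by simp
    from ex[OF this] obtain u where "s < u" "u < e" "f u = c" by (elim exE conjE)
    with d s show ?thesis using between[of d s u] by simp
  qed
  with d show ?thesis by (intro exI[of _ d] conjI ballI less_imp_le)
qed

context compact_psd_operator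
begin

abbreviation Q where "Q \<equiv> resolution_of_identity A"

sublocale Q: spectral_family Q
  by (rule resolution_of_identity_of_spectral_family[OF resolution_of_identity])

lemma has_bochner_integral_Q: "has_bochner_integral (Q.mass x) (\<lambda>s. s) (A x \<bullet> x)"
  using resolution_of_identity unfolding resolution_of_identity_of_def by blast

lemma quadratic_lower_Q: "Q s x = 0 \<Longrightarrow> s * (norm x)\<^sup>2 \<le> A x \<bullet> x"
  by (rule Q.integral_mass_ge[OF _ has_bochner_integral_Q])

text \<open>\<open>v + w\<close> and \<open>v - w\<close> have the same distribution function, hence the same quadratic form.\<close>

lemma A_Q_orth: "A (Q s x) \<bullet> (y - Q s y) = 0"
proof -
  define v w where "v = Q s x" and "w = y - Q s y"
  note Qp = orthogonal_projectorD[OF Q.proj] and Ql = orthogonal_projectorD(2,6-10)[OF Q.proj]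
  have cross: "Q u v \<bullet> w = 0" for u
  proof (cases "u \<le> s")
    case True
    then have "Q u w = 0" by (simp add: w_def Ql Q.below)
    then show ?thesis using Qp(3)[of u v w] by simp
  next
    case False
    then have "Q u v = v" by (simp add: v_def Q.below)
    moreover have "v \<bullet> w = 0" using Qp(2)[of s y] Qp(3)[of s x "y - Q s y"] by (simp add: v_def w_def Ql)
    ultimately show ?thesis by simp
  qed
  have "Q u (v + w) \<bullet> (v + w) = Q u (v - w) \<bullet> (v - w)" for u
    using cross[of u] Qp(3)[of u w v] by (simp add: Ql inner_add inner_diff inner_commute)
  then have "Q.mass (v + w) = Q.mass (v - w)" by simp
  then have "A (v + w) \<bullet> (v + w) = A (v - w) \<bullet> (v - w)"
    using has_bochner_integral_Q[of "v + w"] has_bochner_integral_Q[of "v - w"]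
    by (metis has_bochner_integral_eq)
  then show ?thesis
    using symmetric[of v w] by (simp add: A.add A.diff inner_add inner_diff inner_commute v_def w_def)
qed

text \<open>Since the cross terms vanish, the projector may be placed on either argument of the
  symmetric form.\<close>

lemma A_Q_commute: "A (Q s x) = Q s (A x)"
proof (rule inner_eqI)
  fix z
  note Qp = orthogonal_projectorD[OF Q.proj] and Ql = orthogonal_projectorD(2,6-10)[OF Q.proj]
  have "z \<bullet> A (Q s x) = Q s z \<bullet> A (Q s x)"
    using A_Q_orth[of s x z] by (simp add: inner_diff inner_commute)
  also have "\<dots> = A (Q s z) \<bullet> Q s x" by (simp add: symmetric)
  also have "\<dots> = A (Q s z) \<bullet> x" using A_Q_orth[of s z x] by (simp add: inner_diff)
  also have "\<dots> = z \<bullet> Q s (A x)" by (simp add: symmetric Qp(3))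
  finally show "z \<bullet> A (Q s x) = z \<bullet> Q s (A x)" .
qed

text \<open>For \<open>u > K\<close> a nonzero \<open>x - Q u x\<close> would have form at least
  \<open>u\<close> times its squared norm. Right-continuity then reaches \<open>K\<close> itself, as
  required when the upper limit of integration equals the norm bound.\<close>

lemma Q_top: assumes K: "\<And>x. norm (A x) \<le> K * norm x" shows "Q K x = x"
proof -
  have "Q u x = x" if u: "u > K" for u
  proof (rule ccontr)
    assume n: "Q u x \<noteq> x"
    have "Q u (x - Q u x) = 0" by (simp add: orthogonal_projectorD(2,6-10)[OF Q.proj])
    then have "u * (norm (x - Q u x))\<^sup>2 \<le> K * (norm (x - Q u x))\<^sup>2"
      using quadratic_lower_Q quadratic_le[OF K] order_trans by blast
    then show False using u n by simp
  qed
  then have "\<forall>\<^sub>F u in at_right K. Q u x = x" by (rule eventually_mono[OF eventually_at_right_less])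
  then have "((\<lambda>u. Q u x) \<longlongrightarrow> x) (at_right K)" by (rule tendsto_eventually)
  then show ?thesis using tendsto_unique[OF _ Q.right_limit] by simp
qed

text \<open>Vectors from pairwise disjoint spectral subspaces over \<open>[a, \<infinity>)\<close> have uniformly separated images
  under \<open>A\<close>; compactness bounds their number.\<close>

lemma finite_Q_values: assumes a: "a > 0" shows "finite (Q ` {a..})"
proof (rule ccontr)
  assume inf: "infinite (Q ` {a..})"
  note Qp = orthogonal_projectorD[OF Q.proj] and Ql = orthogonal_projectorD(2,6-10)[OF Q.proj]
  obtain k where k: "finite k" "closure (A ` cball 0 1) \<subseteq> (\<Union>x\<in>k. ball x (a/2))"
    using compact a unfolding compact_eq_totally_bounded by (metis half_gt_zero)
  \<comment> \<open>The largest level has no successor and will be dropped, which still leaves one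
    vector more than there are balls in the cover.\<close>
  obtain B where B: "finite B" "card B = card k + 2" "B \<subseteq> Q ` {a..}"
    using infinite_arbitrarily_large[OF inf] by blast
  then obtain S where S: "S \<subseteq> {a..}" "inj_on Q S" "B = Q ` S" by (auto simp: subset_image_inj)
  have fS: "finite S" and cS: "card S = card k + 2"
    using B S by (auto simp: finite_image_iff card_image)
  define S' where "S' = S - {Max S}"
  have S_ne: "S \<noteq> {}" using cS by auto
  have cS': "card S' > card k" using cS fS S_ne by (simp add: S'_def)
  define nxt where "nxt s = Min {u \<in> S. s < u}" for s
  have nxt: "nxt s \<in> S" "s < nxt s" "\<And>t. t \<in> S \<Longrightarrow> s < t \<Longrightarrow> nxt s \<le> t" if s: "s \<in> S'" for s
  proof -
    have "s < Max S" using s Max_ge[OF fS, of s] by (auto simp: S'_def)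
    then have "Max S \<in> {u \<in> S. s < u}" using Max_in[OF fS S_ne] by simp
    then have "{u \<in> S. s < u} \<noteq> {}" by blast
    from Min_in[OF _ this] show "nxt s \<in> S" "s < nxt s" using fS by (auto simp: nxt_def)
    show "nxt s \<le> t" if "t \<in> S" "s < t" for t using fS that by (auto simp: nxt_def)
  qed
  \<comment> \<open>A unit vector in the range of \<open>Q (nxt s) - Q s\<close>, which is nonzero
    because the levels were chosen with distinct projectors.\<close>
  have "\<exists>e. norm e = 1 \<and> Q s e = 0 \<and> Q (nxt s) e = e" if s: "s \<in> S'" for s
  proof -
    have "Q s \<noteq> Q (nxt s)" using inj_onD[OF S(2), of s "nxt s"] nxt(1,2)[OF s] s by (auto simp: S'_def)
    then obtain x where x: "Q (nxt s) x - Q s x \<noteq> 0" by (metis ext right_minus_eq)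
    define y where "y = Q (nxt s) x - Q s x"
    have "Q s y = 0" "Q (nxt s) y = y"
      using nxt(2)[OF s] by (simp_all add: y_def Ql Q.below)
    then show ?thesis
      using x by (intro exI[of _ "(1 / norm y) *\<^sub>R y"]) (simp add: Ql y_def)
  qed
  then obtain e where e: "\<And>s. s \<in> S' \<Longrightarrow> norm (e s) = 1" "\<And>s. s \<in> S' \<Longrightarrow> Q s (e s) = 0"
    "\<And>s. s \<in> S' \<Longrightarrow> Q (nxt s) (e s) = e s" by metis
  have big: "a \<le> norm (A (e s))" if s: "s \<in> S'" for s
  proof -
    have "a \<le> s" using s S by (auto simp: S'_def)
    then have "Q a (e s) = 0" using Q.below(1)[of a s "e s"] e(2)[OF s] by (simp add: Ql)
    from quadratic_lower_Q[OF this] have "a \<le> A (e s) \<bullet> e s" by (simp add: e(1)[OF s])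
    also have "\<dots> \<le> norm (A (e s))" using norm_cauchy_schwarz[of "A (e s)" "e s"] by (simp add: e(1)[OF s])
    finally show ?thesis .
  qed
  \<comment> \<open>Orthogonal images of length at least \<open>a\<close> are more than
    \<open>a\<close> apart, whereas two points in one ball of radius \<open>a/2\<close> are
    not.\<close>
  have sep: "a\<^sup>2 < (norm (A (e s) - A (e t)))\<^sup>2" if st: "s \<in> S'" "t \<in> S'" "s < t" for s t
  proof -
    have "nxt s \<le> t" using nxt(3)[OF st(1)] st by (auto simp: S'_def)
    then have "Q t (e s) = e s" using Q.below(2)[of "nxt s" t "e s"] e(3)[OF st(1)] by simp
    then have "A (e s) \<bullet> A (e t) = A (e s) \<bullet> A (Q t (e t))"
      using A_Q_commute[of t "e s"] A_Q_commute[of t "e t"] Qp(3) by metis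
    then have "A (e s) \<bullet> A (e t) = 0" by (simp add: e(2)[OF st(2)] A.zero)
    then have "(norm (A (e s) - A (e t)))\<^sup>2 = (norm (A (e s)))\<^sup>2 + (norm (A (e t)))\<^sup>2"
      unfolding power2_norm_eq_inner by (simp add: inner_diff inner_commute)
    moreover have "a\<^sup>2 \<le> (norm (A (e s)))\<^sup>2" "a\<^sup>2 \<le> (norm (A (e t)))\<^sup>2"
      using big st a by (auto intro: power_mono)
    moreover have "a\<^sup>2 > 0" using a by simp
    ultimately show ?thesis by linarith
  qed
  have "\<exists>x\<in>k. dist x (A (e s)) < a/2" if "s \<in> S'" for s
  proof -
    have "A (e s) \<in> closure (A ` cball 0 1)"
      using e(1)[OF that] by (intro subsetD[OF closure_subset] imageI) simp
    from subsetD[OF k(2) this] show ?thesis by simp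
  qed
  then obtain c where c: "\<And>s. s \<in> S' \<Longrightarrow> c s \<in> k \<and> dist (c s) (A (e s)) < a/2" by metis
  have "card (c ` S') \<le> card k" using c k(1) by (intro card_mono) auto
  then have "\<not> inj_on c S'" using cS' by (intro pigeonhole) simp
  then obtain s t where st: "s \<in> S'" "t \<in> S'" "c s = c t" "s \<noteq> t" by (auto simp: inj_on_def)
  have "dist (A (e s)) (A (e t)) < a"
    using c[OF st(1)] c[OF st(2)] st(3) dist_triangle2[of "A (e s)" "A (e t)" "c s"]
    by (simp add: dist_commute)
  then have "(norm (A (e s) - A (e t)))\<^sup>2 < a\<^sup>2"
    by (intro power_strict_mono) (auto simp: dist_norm)
  then show False using sep[of s t] sep[of t s] st norm_minus_commute[of "A (e s)" "A (e t)"]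
    by (metis less_asym linorder_neqE_linordered_idom)
qed

lemma Q_between:
  assumes "s \<le> t" "t \<le> u" "Q s = Q u" shows "Q t = Q s"
proof
  fix x
  have "Q t x = Q t (Q u x)" using Q.below(1)[OF assms(2)] by simp
  also have "\<dots> = Q t (Q s x)" by (simp add: assms(3))
  also have "\<dots> = Q s x" by (rule Q.below(2)[OF assms(1)])
  finally show "Q t x = Q s x" .
qed

section \<open>Projectors for closed spectral intervals\<close>

context
  fixes K P
  assumes K: "\<And>x. norm (A x) \<le> K * norm x"
  defines "P \<equiv> \<lambda>e. spectral_projector A e K"
begin

text \<open>\<open>Q\<close> takes finitely many values on \<open>[e/2, e)\<close>, so it is
  constant just below \<open>e\<close>, and the left limit in \<open>spectral_projector\<close>
  becomes an actual value of the family.\<close>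

lemma spectral_projector_eq_Q:
  assumes e: "e > 0"
  shows "\<exists>d. 0 < d \<and> d < e \<and> (\<forall>s\<in>{d..<e}. P e = (\<lambda>x. x - Q s x))"
proof -
  have "finite (Q ` {e/2..<e})"
    by (rule finite_subset[OF _ finite_Q_values[of "e/2"]]) (use e in auto)
  moreover have "e/2 < e" using e by simp
  ultimately have "\<exists>d. e/2 \<le> d \<and> d < e \<and> (\<forall>s\<in>{d..<e}. Q s = Q d)"
    by (intro eventually_constant_left) (assumption, assumption, rule Q_between)
  then obtain d where d: "e/2 \<le> d" "d < e" "\<forall>s\<in>{d..<e}. Q s = Q d" by (elim exE conjE)
  have P: "P e = (\<lambda>x. x - Q s x)" if s: "s \<in> {d..<e}" for s
  proof
    fix x
    have "Lim (at_left e) (\<lambda>u. Q u x) = Q s x"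
    proof (rule tendsto_Lim)
      have "Q u x = Q s x" if "u \<in> {d..<e}" for u using bspec[OF d(3) that] bspec[OF d(3) s] by metis
      then have "\<forall>\<^sub>F u in at_left e. Q u x = Q s x"
        unfolding eventually_at_left_field using d(2) by (intro exI[of _ d]) auto
      then show "((\<lambda>u. Q u x) \<longlongrightarrow> Q s x) (at_left e)" by (rule tendsto_eventually)
    qed simp
    then show "P e x = x - Q s x" by (simp add: P_def spectral_projector_def Q_top[OF K])
  qed
  show ?thesis using d(1,2) e P by (intro exI[of _ d] conjI ballI) simp_all
qed

lemma spectral_projector_eq_Q_point: assumes "e > 0" shows "\<exists>d. P e = (\<lambda>x. x - Q d x)"
proof -
  obtain d where "d < e" "\<forall>s\<in>{d..<e}. P e = (\<lambda>x. x - Q s x)"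
    using spectral_projector_eq_Q[OF assms] by (elim exE conjE)
  then have "P e = (\<lambda>x. x - Q d x)" by simp
  then show ?thesis by (rule exI)
qed

lemma spectral_projector_projector: assumes "e > 0" shows "orthogonal_projector (P e)"
proof -
  obtain d where d: "P e = (\<lambda>x. x - Q d x)" using spectral_projector_eq_Q_point[OF assms] by (elim exE)
  show ?thesis unfolding d by (rule orthogonal_projector_complement[OF Q.proj])
qed

lemma spectral_projector_commute: assumes "e > 0" shows "P e (A x) = A (P e x)"
proof -
  obtain d where d: "P e = (\<lambda>x. x - Q d x)" using spectral_projector_eq_Q_point[OF assms] by (elim exE)
  show ?thesis unfolding d by (simp add: A.diff A_Q_commute)
qed

text \<open>The form bound holds with every level \<open>s\<close> just below \<open>e\<close>; the
  limit gives the constant \<open>e\<close>, although spectral mass at \<open>e\<close> is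
  included.\<close>

lemma spectral_projector_lower:
  assumes e: "e > 0" shows "e * (norm (P e x))\<^sup>2 \<le> A (P e x) \<bullet> P e x"
proof -
  obtain d where d: "d < e" "\<And>s. s \<in> {d..<e} \<Longrightarrow> P e = (\<lambda>x. x - Q s x)"
    using spectral_projector_eq_Q[OF e] by blast
  have "s * (norm (P e x))\<^sup>2 \<le> A (P e x) \<bullet> P e x" if "s \<in> {d..<e}" for s
    using d(2)[OF that] by (intro quadratic_lower_Q[of s]) (simp add: orthogonal_projectorD(2,6-10)[OF Q.proj])
  then have "\<forall>\<^sub>F s in at_left e. s * (norm (P e x))\<^sup>2 \<le> A (P e x) \<bullet> P e x"
    unfolding eventually_at_left_field using d(1) by (intro exI[of _ d]) auto
  moreover have "((\<lambda>s. s * (norm (P e x))\<^sup>2) \<longlongrightarrow> e * (norm (P e x))\<^sup>2) (at_left e)"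
    by (intro tendsto_intros)
  ultimately show ?thesis by (intro tendsto_upperbound) auto
qed

lemma spectral_projector_between:
  assumes e: "0 < e1" "e1 \<le> e2" "e2 \<le> e3" and eq: "P e1 = P e3"
  shows "P e2 = P e1"
proof -
  obtain d1 where d1: "d1 < e1" "\<And>s. s \<in> {d1..<e1} \<Longrightarrow> P e1 = (\<lambda>x. x - Q s x)"
    using spectral_projector_eq_Q[of e1] e by auto
  obtain d2 where d2: "d2 < e2" "\<And>s. s \<in> {d2..<e2} \<Longrightarrow> P e2 = (\<lambda>x. x - Q s x)"
    using spectral_projector_eq_Q[of e2] e by auto
  obtain d3 where d3: "d3 < e3" "\<And>s. s \<in> {d3..<e3} \<Longrightarrow> P e3 = (\<lambda>x. x - Q s x)"
    using spectral_projector_eq_Q[of e3] e by auto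
  \<comment> \<open>The maxima put the three levels in increasing order without leaving the
    intervals on which they represent the projectors.\<close>
  define s2 where "s2 = max d1 d2"
  define s3 where "s3 = max s2 d3"
  have P: "P e1 = (\<lambda>x. x - Q d1 x)" "P e2 = (\<lambda>x. x - Q s2 x)" "P e3 = (\<lambda>x. x - Q s3 x)"
    using d1 e d2 d3 by (auto simp: s2_def s3_def)
  have "Q d1 = Q s3"
  proof
    fix x from fun_cong[OF eq, of x] show "Q d1 x = Q s3 x" unfolding P by simp
  qed
  then have "Q s2 = Q d1" by (rule Q_between[rotated 2]) (simp_all add: s2_def s3_def)
  then show ?thesis by (simp add: P)
qed

lemma finite_spectral_projectors: assumes a: "a > 0" shows "finite (P ` {a..})"
proof (rule finite_subset)
  show "P ` {a..} \<subseteq> (\<lambda>q x. x - q x) ` Q ` {a/2..}"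
  proof
    fix p assume "p \<in> P ` {a..}"
    then obtain e where e: "e \<ge> a" "p = P e" by auto
    obtain d where d: "d < e" "\<And>s. s \<in> {d..<e} \<Longrightarrow> P e = (\<lambda>x. x - Q s x)"
      using spectral_projector_eq_Q[of e] e a by auto
    have "max d (a/2) \<in> {d..<e}" using d e a by auto
    from d(2)[OF this] e show "p \<in> (\<lambda>q x. x - q x) ` Q ` {a/2..}" by auto
  qed
  show "finite ((\<lambda>q x. x - q x) ` Q ` {a/2..})" using a by (intro finite_imageI finite_Q_values) simp
qed

text \<open>The effect of the closed lower end point: mass at \<open>e\<close> is lost only when the
  level exceeds \<open>e\<close>. Along a decreasing \<open>\<epsilon>\<close> this becomes
  right-continuity in time.\<close>

lemma spectral_projector_left_constant:
  assumes e: "e > 0" shows "\<exists>d. 0 < d \<and> d < e \<and> (\<forall>e'\<in>{d<..e}. P e' = P e)"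
proof -
  obtain d where d: "0 < d" "d < e" "\<And>s. s \<in> {d..<e} \<Longrightarrow> P e = (\<lambda>x. x - Q s x)"
    using spectral_projector_eq_Q[OF e] by auto
  have "P e' = P e" if e': "e' \<in> {d<..e}" for e'
  proof -
    obtain d' where d': "d' < e'" "\<And>s. s \<in> {d'..<e'} \<Longrightarrow> P e' = (\<lambda>x. x - Q s x)"
      using spectral_projector_eq_Q[of e'] e' d by auto
    have "max d d' \<in> {d'..<e'}" "max d d' \<in> {d..<e}" using d d' e' by auto
    then show ?thesis using d(3) d'(2) by metis
  qed
  with d show ?thesis by blast
qed

end

end

section \<open>The regularized vector field\<close>

text \<open>\<open>D\<close> maps the unit ball into the uniform limit of the totally bounded sets
  \<open>(F (\<xi> + t x) - F \<xi>) / t\<close>.\<close>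

lemma compact_map_derivative:
  fixes F :: "'a::real_normed_vector \<Rightarrow> 'b::{real_normed_vector,complete_space}"
  assumes F: "compact_map F" and D: "(F has_derivative D) (at \<xi>)"
  shows "compact (closure (D ` cball 0 1))"
  unfolding compact_eq_totally_bounded
proof (intro conjI allI impI)
  show "complete (closure (D ` cball 0 1))" by (simp add: complete_eq_closed)
next
  fix e :: real assume e: "e > 0"
  interpret D: bounded_linear D using D by (rule has_derivative_bounded_linear)
  from D e obtain \<delta> where \<delta>: "\<delta> > 0"
    "\<And>x. norm (x - \<xi>) < \<delta> \<Longrightarrow> norm (F x - F \<xi> - D (x - \<xi>)) \<le> e/4 * norm (x - \<xi>)"
  proof -
    have "e/4 > 0" using e by simp
    with D show ?thesis using that unfolding has_derivative_at_alt by blast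
  qed
  define t where "t = \<delta> / 2"
  have t: "t > 0" "t < \<delta>" using \<delta> by (auto simp: t_def)
  have "compact (closure (F ` cball \<xi> t))" using F by (simp add: compact_map_def)
  moreover have "t * (e/4) > 0" using t e by simp
  ultimately have "\<exists>k. finite k \<and> closure (F ` cball \<xi> t) \<subseteq> (\<Union>z\<in>k. ball z (t * (e/4)))"
    unfolding compact_eq_totally_bounded by (elim conjE allE impE)
  then obtain k where k: "finite k" "closure (F ` cball \<xi> t) \<subseteq> (\<Union>z\<in>k. ball z (t * (e/4)))"
    by (elim exE conjE)
  \<comment> \<open>Rescaled centres of a cover of the values of \<open>F\<close>. Cover and
    difference quotient contribute \<open>e/4\<close> each; closed balls of radius
    \<open>e/2\<close> survive the closure and fit into open balls of radius
    \<open>e\<close>.\<close>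
  define k' where "k' = (\<lambda>z. (1/t) *\<^sub>R (z - F \<xi>)) ` k"
  have "D x \<in> (\<Union>z\<in>k'. cball z (e/2))" if x: "norm x \<le> 1" for x
  proof -
    define v where "v = F (\<xi> + t *\<^sub>R x)"
    have "v \<in> closure (F ` cball \<xi> t)"
      unfolding v_def using x t by (intro subsetD[OF closure_subset] imageI) (simp add: dist_norm mult_left_le)
    from subsetD[OF k(2) this] obtain z where z: "z \<in> k" "norm (z - v) < t * (e/4)"
      by (elim UN_E) (simp add: dist_norm)
    have "norm (v - F \<xi> - t *\<^sub>R D x) \<le> e/4 * (t * norm x)"
    proof -
      have "t * norm x < \<delta>" using t mult_left_le[OF x, of t] by linarith
      then have "norm (\<xi> + t *\<^sub>R x - \<xi>) < \<delta>" using t by simp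
      from \<delta>(2)[OF this] show ?thesis using t by (simp add: v_def D.scaleR)
    qed
    also have "\<dots> \<le> e/4 * (t * 1)" using x t e by (intro mult_left_mono) auto
    finally have "norm ((z - v) + (v - F \<xi> - t *\<^sub>R D x)) \<le> t * (e/2)"
      using z(2) norm_triangle_ineq[of "z - v" "v - F \<xi> - t *\<^sub>R D x"] by (simp add: mult.commute)
    then have "norm ((z - v) + (v - F \<xi> - t *\<^sub>R D x)) / t \<le> e/2"
      using t by (simp add: pos_divide_le_eq mult.commute)
    moreover have "(1/t) *\<^sub>R (z - F \<xi>) - D x = (1/t) *\<^sub>R ((z - v) + (v - F \<xi> - t *\<^sub>R D x))"
      using t by (simp add: algebra_simps)
    ultimately have "norm ((1/t) *\<^sub>R (z - F \<xi>) - D x) \<le> e/2"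
      using t by (simp only: norm_scaleR) simp
    then show ?thesis using z(1) by (intro UN_I[of "(1/t) *\<^sub>R (z - F \<xi>)"]) (simp_all only: k'_def dist_norm image_eqI mem_cball)
  qed
  then have "D ` cball 0 1 \<subseteq> (\<Union>z\<in>k'. cball z (e/2))" by auto
  then have "closure (D ` cball 0 1) \<subseteq> (\<Union>z\<in>k'. cball z (e/2))"
    using k(1) by (intro closure_minimal closed_UN) (auto simp: k'_def)
  also have "\<dots> \<subseteq> (\<Union>z\<in>k'. ball z e)" using e by (intro UN_mono) auto
  finally show "\<exists>k. finite k \<and> closure (D ` cball 0 1) \<subseteq> (\<Union>x\<in>k. ball x e)"
    using k(1) by (intro exI[of _ k']) (auto simp: k'_def)
qed

lemma compact_closure_bounded_linear_image:
  fixes f :: "'a::real_normed_vector \<Rightarrow> 'b::real_normed_vector"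
  assumes f: "bounded_linear f" and S: "compact (closure S)" shows "compact (closure (f ` S))"
proof -
  have K: "compact (f ` closure S)"
    using S by (intro compact_continuous_image linear_continuous_on f)
  have "closure (f ` S) \<subseteq> f ` closure S"
    using compact_imp_closed[OF K] closure_subset[of S] by (intro closure_minimal) auto
  then show ?thesis using compact_Int_closed[OF K closed_closure, of "f ` S"] by (simp add: Int_absorb1)
qed

lemma T_op_inner: "T_op F' h x \<bullet> y = blinfun_apply (F' h) x \<bullet> blinfun_apply (F' h) y"
  for F' :: "'a::{real_inner,complete_space} \<Rightarrow> 'a \<Rightarrow>\<^sub>L 'a"
  using adjoint_inner[OF blinfun.bounded_linear_right, of "F' h" y "blinfun_apply (F' h) x"]
  by (simp add: T_op_def inner_commute)

lemma psd_operator_T_op: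
  fixes F' :: "'a::{real_inner,complete_space} \<Rightarrow> 'a \<Rightarrow>\<^sub>L 'a"
  shows "psd_operator (T_op F' h)"
  unfolding psd_operator_def
proof (intro conjI allI)
  show "bounded_linear (T_op F' h)"
    unfolding T_op_def o_def
    by (rule bounded_linear_compose[OF bounded_linear_adjoint[OF blinfun.bounded_linear_right] blinfun.bounded_linear_right])
  show "T_op F' h x \<bullet> y = x \<bullet> T_op F' h y" for x y
    using T_op_inner[of F' h x y] T_op_inner[of F' h y x] by (simp add: inner_commute)
  show "0 \<le> T_op F' h x \<bullet> x" for x by (simp add: T_op_inner)
qed

lemma compact_psd_operator_T_op:
  fixes F :: "'a::{real_inner,complete_space} \<Rightarrow> 'a"
  assumes "compact_map F" "(F has_derivative blinfun_apply (F' h)) (at h)"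
  shows "compact_psd_operator (T_op F' h)"
proof -
  interpret psd_operator "T_op F' h" by (rule psd_operator_T_op)
  show ?thesis
  proof
    have "T_op F' h ` cball 0 1 = adjoint (blinfun_apply (F' h)) ` blinfun_apply (F' h) ` cball 0 1"
      by (simp add: T_op_def image_comp)
    then show "compact (closure (T_op F' h ` cball 0 1))"
      using compact_closure_bounded_linear_image[OF bounded_linear_adjoint[OF blinfun.bounded_linear_right]
          compact_map_derivative[OF assms]] by simp
  qed
qed

locale bounded_derivatives =
  fixes F :: "'a::{real_inner,complete_space} \<Rightarrow> 'a"
    and F' :: "'a \<Rightarrow> ('a \<Rightarrow>\<^sub>L 'a)" and F'' :: "'a \<Rightarrow> ('a \<Rightarrow>\<^sub>L ('a \<Rightarrow>\<^sub>L 'a))"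
    and N1 N2 :: real
  assumes deriv: "(F has_derivative blinfun_apply (F' x)) (at x)"
    and deriv2: "(F' has_derivative blinfun_apply (F'' x)) (at x)"
    and N1: "N1 > 0" and N2: "N2 > 0"
    and F'_le: "norm (F' x) \<le> N1" and F''_le: "norm (F'' x) \<le> N2"
begin

abbreviation D where "D h \<equiv> blinfun_apply (F' h)"
abbreviation Da where "Da h \<equiv> adjoint (D h)"
abbreviation T where "T \<equiv> T_op F'"
abbreviation Rs where "Rs e h \<equiv> inv (T_reg F' e h)"

sublocale T: psd_operator "T h" for h by (rule psd_operator_T_op)
sublocale Da: bounded_linear "Da h" for h by (rule bounded_linear_adjoint[OF blinfun.bounded_linear_right])

lemma T_eq: "T h x = Da h (D h x)" by (simp add: T_op_def)

lemma D_inner: "D h x \<bullet> y = x \<bullet> Da h y" by (rule adjoint_inner[OF blinfun.bounded_linear_right])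

lemma norm_D: "norm (D h x) \<le> N1 * norm x"
  using norm_blinfun[of "F' h" x] mult_right_mono[OF F'_le[of h], of "norm x"] by simp

lemma norm_Da: "norm (Da h x) \<le> N1 * norm x"
  using N1 norm_D by (intro norm_adjoint_le blinfun.bounded_linear_right) auto

lemma norm_T: "norm (T h x) \<le> N1\<^sup>2 * norm x"
proof -
  have "norm (T h x) \<le> N1 * norm (D h x)" unfolding T_eq by (rule norm_Da)
  also have "\<dots> \<le> N1 * (N1 * norm x)" using N1 by (intro mult_left_mono norm_D) simp
  finally show ?thesis by (simp add: power2_eq_square)
qed

lemma F'_lipschitz: "norm (F' h - F' k) \<le> N2 * norm (h - k)"
  by (rule differentiable_bound[of UNIV F' "\<lambda>x. blinfun_apply (F'' x)"])
     (use deriv2 F''_le in \<open>auto simp: norm_blinfun.rep_eq\<close>)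

lemma F_lipschitz: "norm (F h - F k) \<le> N1 * norm (h - k)"
  by (rule differentiable_bound[of UNIV F "\<lambda>x. D x"])
     (use deriv F'_le in \<open>auto simp: norm_blinfun.rep_eq\<close>)

lemma D_lipschitz: "norm (D h x - D k x) \<le> N2 * norm (h - k) * norm x"
  using norm_blinfun[of "F' h - F' k" x] mult_right_mono[OF F'_lipschitz[of h k], of "norm x"]
  by (simp add: blinfun.diff_left)

text \<open>Duality: pairing the difference with itself and moving the adjoints over reduces the
  bound to \<open>D_lipschitz\<close>.\<close>

lemma Da_lipschitz: "norm (Da h x - Da k x) \<le> N2 * norm (h - k) * norm x"
proof (cases "Da h x - Da k x = 0")
  case False
  define v where "v = Da h x - Da k x"
  have "norm v * norm v = (D h v - D k v) \<bullet> x"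
    by (simp add: v_def[symmetric] D_inner inner_diff_left inner_diff_right[symmetric] power2_norm_eq_inner[symmetric] power2_eq_square)
  also have "\<dots> \<le> norm (D h v - D k v) * norm x" by (rule norm_cauchy_schwarz)
  also have "\<dots> \<le> (N2 * norm (h - k) * norm v) * norm x" by (intro mult_right_mono D_lipschitz) simp
  finally have "norm v * norm v \<le> (N2 * norm (h - k) * norm x) * norm v" by (simp add: mult_ac)
  then show ?thesis using False by (simp add: v_def[symmetric])
next
  case True then show ?thesis using N2 by (simp add: True)
qed

lemma T_lipschitz: "norm (T h x - T k x) \<le> 2 * N1 * N2 * norm (h - k) * norm x"
proof -
  have "T h x - T k x = Da h (D h x - D k x) + (Da h (D k x) - Da k (D k x))"
    by (simp add: T_eq Da.diff)
  also have "norm \<dots> \<le> norm (Da h (D h x - D k x)) + norm (Da h (D k x) - Da k (D k x))"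
    by (rule norm_triangle_ineq)
  also have "\<dots> \<le> N1 * (N2 * norm (h - k) * norm x) + N2 * norm (h - k) * (N1 * norm x)"
    using N1 N2
    by (intro add_mono order_trans[OF norm_Da] order_trans[OF Da_lipschitz] mult_left_mono D_lipschitz norm_D) auto
  finally show ?thesis by (simp add: algebra_simps)
qed

text \<open>Pairing with the remainder \<open>u\<close> itself reduces the claim to a scalar
  function on \<open>[0, 1]\<close>, whose derivative is nonpositive by the Lipschitz bound for
  \<open>F'\<close>.\<close>

lemma Taylor_remainder: "norm (F k - F h - D h (k - h)) \<le> N2 / 2 * (norm (k - h))\<^sup>2"
proof (cases "F k - F h - D h (k - h) = 0")
  case False
  define u where "u = F k - F h - D h (k - h)"
  define d where "d = k - h"
  define \<psi> where "\<psi> t = (F (h + t *\<^sub>R d) - F h - t *\<^sub>R D h d) \<bullet> u - N2 / 2 * t\<^sup>2 * (norm d)\<^sup>2 * norm u" for t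
  have "\<psi> 1 \<le> \<psi> 0"
  proof (rule DERIV_nonpos_imp_nonincreasing[of 0 1 \<psi>])
    fix t :: real assume t: "0 \<le> t" "t \<le> 1"
    define m where "m = (D (h + t *\<^sub>R d) d - D h d) \<bullet> u - N2 * t * (norm d)\<^sup>2 * norm u"
    have "((\<lambda>t. F (h + t *\<^sub>R d)) has_derivative (\<lambda>s. D (h + t *\<^sub>R d) (s *\<^sub>R d))) (at t)"
      by (rule has_derivative_compose[OF _ deriv]) (auto intro!: derivative_eq_intros)
    then have "((\<lambda>t. F (h + t *\<^sub>R d) - F h - t *\<^sub>R D h d) has_derivative (\<lambda>s. s *\<^sub>R (D (h + t *\<^sub>R d) d - D h d))) (at t)"
      by (auto intro!: derivative_eq_intros simp: blinfun.scaleR_right algebra_simps)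
    then have "((\<lambda>t. (F (h + t *\<^sub>R d) - F h - t *\<^sub>R D h d) \<bullet> u) has_derivative (\<lambda>s. (s *\<^sub>R (D (h + t *\<^sub>R d) d - D h d)) \<bullet> u)) (at t)"
      by (rule bounded_linear.has_derivative[OF bounded_linear_inner_left])
    then have "((\<lambda>t. (F (h + t *\<^sub>R d) - F h - t *\<^sub>R D h d) \<bullet> u) has_real_derivative ((D (h + t *\<^sub>R d) d - D h d) \<bullet> u)) (at t)"
      unfolding has_field_derivative_def by (rule has_derivative_eq_rhs) (simp add: fun_eq_iff)
    then have "(\<psi> has_real_derivative m) (at t)"
      unfolding \<psi>_def[abs_def] m_def by (auto intro!: derivative_eq_intros)
    moreover have "m \<le> 0"
    proof -
      have "(D (h + t *\<^sub>R d) d - D h d) \<bullet> u \<le> norm (D (h + t *\<^sub>R d) d - D h d) * norm u"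
        by (rule norm_cauchy_schwarz)
      also have "\<dots> \<le> (N2 * norm (h + t *\<^sub>R d - h) * norm d) * norm u"
        by (intro mult_right_mono D_lipschitz) simp
      also have "\<dots> = N2 * t * (norm d)\<^sup>2 * norm u" using t by (simp add: power2_eq_square)
      finally show ?thesis by (simp add: m_def)
    qed
    ultimately show "\<exists>y. DERIV \<psi> t :> y \<and> y \<le> 0" by blast
  qed simp
  then have "u \<bullet> u \<le> N2 / 2 * (norm d)\<^sup>2 * norm u" by (simp add: \<psi>_def d_def u_def)
  then have "norm u * norm u \<le> (N2 / 2 * (norm d)\<^sup>2) * norm u"
    by (simp add: power2_norm_eq_inner[symmetric] power2_eq_square)
  moreover have "norm u > 0" using False by (simp only: u_def zero_less_norm_iff not_False_eq_True)
  ultimately have "norm u \<le> N2 / 2 * (norm d)\<^sup>2" by (rule mult_right_le_imp_le)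
  then show ?thesis by (simp only: u_def d_def)
qed (use N2 in simp)

section \<open>The regularized inverse and its dependence on point and parameter\<close>

lemma T_reg_eq: "T_reg F' e h x = T h x + e *\<^sub>R x" by (simp add: T_reg_def)

context
  fixes e :: real
  assumes e: "e > 0"
begin

lemma bij_T_reg: "bij (T_reg F' e h)"
proof (rule coercive_bij[OF _ e])
  show "bounded_linear (T_reg F' e h)"
    unfolding T_reg_def by (intro bounded_linear_add T.linear bounded_linear_scaleR_right)
  show "e * (norm x)\<^sup>2 \<le> T_reg F' e h x \<bullet> x" for x
    using T.psd[of h x] by (simp add: T_reg_eq inner_add_left power2_norm_eq_inner)
qed

lemma Rs_solves: "T h (Rs e h x) + e *\<^sub>R Rs e h x = x"
  using bij_T_reg[of h] by (simp add: T_reg_eq[symmetric] bij_is_surj surj_f_inv_f)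

lemma Rs_eqI: "T h u + e *\<^sub>R u = x \<Longrightarrow> Rs e h x = u"
  using bij_T_reg[of h] by (metis T_reg_eq bij_inv_eq_iff)

lemma Rs_add: "Rs e h (x + y) = Rs e h x + Rs e h y"
proof (rule Rs_eqI)
  have "T h (Rs e h x + Rs e h y) + e *\<^sub>R (Rs e h x + Rs e h y)
      = (T h (Rs e h x) + e *\<^sub>R Rs e h x) + (T h (Rs e h y) + e *\<^sub>R Rs e h y)"
    by (simp add: T.A.add scaleR_add_right)
  then show "T h (Rs e h x + Rs e h y) + e *\<^sub>R (Rs e h x + Rs e h y) = x + y" by (simp only: Rs_solves)
qed

lemma Rs_scaleR: "Rs e h (c *\<^sub>R x) = c *\<^sub>R Rs e h x"
proof (rule Rs_eqI)
  have "T h (c *\<^sub>R Rs e h x) + e *\<^sub>R (c *\<^sub>R Rs e h x) = c *\<^sub>R (T h (Rs e h x) + e *\<^sub>R Rs e h x)"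
    by (simp add: T.A.scaleR scaleR_add_right)
  then show "T h (c *\<^sub>R Rs e h x) + e *\<^sub>R (c *\<^sub>R Rs e h x) = c *\<^sub>R x" by (simp only: Rs_solves)
qed

lemma norm_Rs: "norm (Rs e h x) \<le> norm x / e"
proof (cases "Rs e h x = 0")
  case False
  have "e * (norm (Rs e h x))\<^sup>2 \<le> x \<bullet> Rs e h x"
    using T.psd[of h "Rs e h x"] arg_cong[OF Rs_solves[of h x], of "\<lambda>v. v \<bullet> Rs e h x"]
    by (simp add: inner_add_left power2_norm_eq_inner)
  also have "\<dots> \<le> norm x * norm (Rs e h x)" by (rule norm_cauchy_schwarz)
  finally have "(e * norm (Rs e h x)) * norm (Rs e h x) \<le> norm x * norm (Rs e h x)"
    by (simp add: power2_eq_square mult.assoc)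
  then show ?thesis using False e by (simp add: pos_le_divide_eq mult.commute)
qed (use e in simp)

lemma bounded_linear_Rs: "bounded_linear (Rs e h)"
  by (rule bounded_linear_intro[of _ "1 / e"]) (use Rs_add Rs_scaleR norm_Rs in auto)

lemma Rs_diff: "Rs e h (x - y) = Rs e h x - Rs e h y"
  by (rule linear_diff[OF bounded_linear.linear[OF bounded_linear_Rs]])

text \<open>With \<open>u = Rs e h (Da h x)\<close> and \<open>a = norm (D h u)\<close>: \<open>e * (norm u)\<^sup>2 \<le> norm x * a - a\<^sup>2 \<le> (norm x)\<^sup>2 / 4\<close>.\<close>

lemma norm_Rs_Da: "norm (Rs e h (Da h x)) \<le> norm x / (2 * sqrt e)"
proof -
  define u where "u = Rs e h (Da h x)"
  define a where "a = norm (D h u)"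
  have "a\<^sup>2 + e * (norm u)\<^sup>2 = Da h x \<bullet> u"
    using arg_cong[OF Rs_solves[of h "Da h x"], of "\<lambda>v. v \<bullet> u"]
    by (simp add: inner_add_left power2_norm_eq_inner a_def u_def[symmetric] T_op_inner)
  also have "\<dots> = x \<bullet> D h u" using D_inner[of h u x] by (simp add: inner_commute)
  also have "\<dots> \<le> norm x * a" unfolding a_def by (rule norm_cauchy_schwarz)
  also have "norm x * a \<le> a\<^sup>2 + (norm x / 2)\<^sup>2"
    using zero_le_power2[of "a - norm x / 2"] by (simp add: power2_eq_square algebra_simps)
  finally have "e * (norm u)\<^sup>2 \<le> (norm x / 2)\<^sup>2" by simp
  then have "(sqrt e * norm u)\<^sup>2 \<le> (norm x / 2)\<^sup>2" using e by (simp add: power_mult_distrib)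
  then have "sqrt e * norm u \<le> norm x / 2" by (rule power2_le_imp_le) simp
  then show ?thesis using e by (simp add: u_def[symmetric] field_simps)
qed

text \<open>The second resolvent identity, with the perturbation evaluated at the solution for
  \<open>k\<close>; it transfers estimates on differences of \<open>T\<close> to the
  inverse.\<close>

lemma resolvent_identity: "Rs e h x - Rs e k x = Rs e h (T k (Rs e k x) - T h (Rs e k x))"
proof (rule Rs_eqI[symmetric])
  have "T h (Rs e h x - Rs e k x) + e *\<^sub>R (Rs e h x - Rs e k x)
    = (T h (Rs e h x) + e *\<^sub>R Rs e h x) - (T k (Rs e k x) + e *\<^sub>R Rs e k x) + (T k (Rs e k x) - T h (Rs e k x))"
    by (simp add: T.A.diff scaleR_diff_right)
  then show "T h (Rs e h x - Rs e k x) + e *\<^sub>R (Rs e h x - Rs e k x) = T k (Rs e k x) - T h (Rs e k x)"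
    unfolding Rs_solves by simp
qed

end

text \<open>From the first resolvent identity, written as a correction to the solution for
  \<open>e'\<close>.\<close>

lemma norm_Rs_parameter_diff:
  assumes e: "e > 0" and e': "e' > 0"
  shows "norm (Rs e h x - Rs e' h x) \<le> \<bar>e' - e\<bar> * norm x / (e * e')"
proof -
  define u where "u = Rs e' h x"
  have "Rs e h x = u + Rs e h ((e' - e) *\<^sub>R u)"
  proof (rule Rs_eqI[OF e])
    have "T h (u + Rs e h ((e' - e) *\<^sub>R u)) + e *\<^sub>R (u + Rs e h ((e' - e) *\<^sub>R u))
      = T h u + e *\<^sub>R u + (T h (Rs e h ((e' - e) *\<^sub>R u)) + e *\<^sub>R Rs e h ((e' - e) *\<^sub>R u))"
      by (simp add: T.A.add scaleR_add_right)
    also have "\<dots> = T h u + e' *\<^sub>R u" unfolding Rs_solves[OF e] by (simp add: algebra_simps)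
    also have "\<dots> = x" unfolding u_def by (rule Rs_solves[OF e'])
    finally show "T h (u + Rs e h ((e' - e) *\<^sub>R u)) + e *\<^sub>R (u + Rs e h ((e' - e) *\<^sub>R u)) = x" .
  qed
  then have "norm (Rs e h x - Rs e' h x) = norm (Rs e h ((e' - e) *\<^sub>R u))" by (simp add: u_def)
  also have "\<dots> \<le> \<bar>e' - e\<bar> * norm u / e" using norm_Rs[OF e, of h "(e' - e) *\<^sub>R u"] by simp
  also have "\<dots> \<le> \<bar>e' - e\<bar> * (norm x / e') / e"
    using e norm_Rs[OF e', of h x] by (intro divide_right_mono mult_left_mono) (auto simp: u_def)
  finally show ?thesis by (simp add: mult.commute)
qed

lemma continuous_on_Rs:
  assumes f: "continuous_on S f" and pos: "\<And>t. t \<in> S \<Longrightarrow> f t > 0"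
  shows "continuous_on S (\<lambda>t. Rs (f t) h x)"
  unfolding continuous_on_def
proof
  fix t assume t: "t \<in> S"
  have lim: "(f \<longlongrightarrow> f t) (at t within S)" using f t by (auto simp: continuous_on_def)
  have "((\<lambda>s. Rs (f s) h x - Rs (f t) h x) \<longlongrightarrow> 0) (at t within S)"
  proof (rule Lim_null_comparison)
    have "\<forall>\<^sub>F s in at t within S. s \<in> S" by (simp add: eventually_at_filter)
    then show "\<forall>\<^sub>F s in at t within S. norm (Rs (f s) h x - Rs (f t) h x) \<le> \<bar>f t - f s\<bar> * norm x / (f s * f t)"
      by (rule eventually_mono) (intro norm_Rs_parameter_diff pos t)
    have "((\<lambda>s. \<bar>f t - f s\<bar> * norm x / (f s * f t)) \<longlongrightarrow> \<bar>f t - f t\<bar> * norm x / (f t * f t)) (at t within S)"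
      using pos[OF t] by (intro tendsto_intros lim) auto
    then show "((\<lambda>s. \<bar>f t - f s\<bar> * norm x / (f s * f t)) \<longlongrightarrow> 0) (at t within S)" by simp
  qed
  then show "((\<lambda>s. Rs (f s) h x) \<longlongrightarrow> Rs (f t) h x) (at t within S)"
    by (simp add: Lim_null[symmetric])
qed

text \<open>\<open>Phi\<close> with the projector \<open>p\<close> and the regularization parameter \<open>e\<close> decoupled: only \<open>p\<close>
  jumps in time.\<close>

definition flow :: "('a \<Rightarrow> 'a) \<Rightarrow> 'a \<Rightarrow> real \<Rightarrow> 'a \<Rightarrow> 'a" where
  "flow p z\<^sub>0 e h = (p (h - z\<^sub>0) - (h - z\<^sub>0)) - p (Rs e h (Da h (F h)))"

lemma continuous_on_flow:
  assumes p: "orthogonal_projector p" and f: "continuous_on S f" and pos: "\<And>t. t \<in> S \<Longrightarrow> f t > 0"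
  shows "continuous_on S (\<lambda>t. flow p z\<^sub>0 (f t) h)"
  unfolding flow_def
  by (intro continuous_intros bounded_linear.continuous_on[OF orthogonal_projectorD(1)[OF p]] continuous_on_Rs f pos)

text \<open>The 2 comes from the linear part, the quotient by \<open>e\<^sub>1\<close> from the
  variation of \<open>Da h (F h)\<close>, where \<open>F y = 0\<close> bounds \<open>F\<close> on
  the ball, and the last quotient from the variation of the inverse. The lower bound
  \<open>e\<^sub>1\<close> makes the constant uniform over bounded time intervals.\<close>

lemma flow_lipschitz:
  assumes p: "orthogonal_projector p" and e: "0 < e\<^sub>1" "e\<^sub>1 \<le> e" and y: "F y = 0"
    and hk: "norm (h - y) \<le> r" "norm (k - y) \<le> r"
  shows "norm (flow p z\<^sub>0 e h - flow p z\<^sub>0 e k)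
    \<le> (2 + (N1\<^sup>2 + N1 * N2 * r) / e\<^sub>1 + 2 * N1 ^ 3 * N2 * r / e\<^sub>1\<^sup>2) * norm (h - k)"
proof -
  note pl = orthogonal_projectorD(6,7)[OF p] and pn = orthogonal_projectorD(5)[OF p]
  have e0: "e > 0" using e by simp
  have r: "r \<ge> 0" using hk(1) norm_ge_zero order_trans by blast
  define G where "G h = Da h (F h)" for h
  define u where "u = Rs e k (G k)"
  have Fk: "norm (F k) \<le> N1 * r"
  proof -
    have "N1 * norm (k - y) \<le> N1 * r" using N1 hk(2) by (intro mult_left_mono) auto
    then show ?thesis using F_lipschitz[of k y] by (simp only: y diff_zero)
  qed
  have Gk: "norm (G k) \<le> N1\<^sup>2 * r"
  proof -
    have "N1 * norm (F k) \<le> N1 * (N1 * r)" using N1 Fk by (intro mult_left_mono) auto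
    then show ?thesis using norm_Da[of k "F k"] by (simp add: G_def power2_eq_square)
  qed
  have Gd: "norm (G h - G k) \<le> (N1\<^sup>2 + N1 * N2 * r) * norm (h - k)"
  proof -
    have "G h - G k = Da h (F h - F k) + (Da h (F k) - Da k (F k))" by (simp add: G_def Da.diff)
    also have "norm \<dots> \<le> norm (Da h (F h - F k)) + norm (Da h (F k) - Da k (F k))" by (rule norm_triangle_ineq)
    also have "\<dots> \<le> N1 * (N1 * norm (h - k)) + N2 * norm (h - k) * (N1 * r)"
      using N1 N2
      by (intro add_mono order_trans[OF norm_Da] order_trans[OF Da_lipschitz] mult_left_mono F_lipschitz Fk) auto
    finally show ?thesis by (simp add: algebra_simps power2_eq_square)
  qed
  have u: "norm u \<le> N1\<^sup>2 * r / e\<^sub>1"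
  proof -
    have "norm u \<le> N1\<^sup>2 * r / e"
      using norm_Rs[OF e0, of k "G k"] divide_right_mono[OF Gk, of e] e0 by (simp add: u_def)
    also have "\<dots> \<le> N1\<^sup>2 * r / e\<^sub>1" using e r by (intro divide_left_mono) auto
    finally show ?thesis .
  qed
  have "norm (T k u - T h u) \<le> 2 * N1 * N2 * norm (h - k) * norm u"
    using T_lipschitz[of k u h] by (simp add: norm_minus_commute)
  also have "\<dots> \<le> 2 * N1 * N2 * norm (h - k) * (N1\<^sup>2 * r / e\<^sub>1)"
    using N1 N2 by (intro mult_left_mono u) auto
  finally have Tu: "norm (T k u - T h u) \<le> 2 * N1 * N2 * norm (h - k) * (N1\<^sup>2 * r / e\<^sub>1)" .
  have "Rs e h (G h) - Rs e k (G k) = Rs e h (G h - G k) + Rs e h (T k u - T h u)"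
    unfolding u_def resolvent_identity[OF e0, of h "G k" k, symmetric] Rs_diff[OF e0, of h "G h"] by simp
  also have "norm \<dots> \<le> norm (Rs e h (G h - G k)) + norm (Rs e h (T k u - T h u))" by (rule norm_triangle_ineq)
  also have "\<dots> \<le> norm (G h - G k) / e + norm (T k u - T h u) / e"
    by (intro add_mono norm_Rs e0)
  also have "\<dots> \<le> norm (G h - G k) / e\<^sub>1 + norm (T k u - T h u) / e\<^sub>1"
    using e by (intro add_mono divide_left_mono) auto
  also have "\<dots> \<le> (N1\<^sup>2 + N1 * N2 * r) * norm (h - k) / e\<^sub>1 + 2 * N1 * N2 * norm (h - k) * (N1\<^sup>2 * r / e\<^sub>1) / e\<^sub>1"
    using e by (intro add_mono divide_right_mono Gd Tu) auto
  also have "\<dots> = ((N1\<^sup>2 + N1 * N2 * r) / e\<^sub>1 + 2 * N1 ^ 3 * N2 * r / e\<^sub>1\<^sup>2) * norm (h - k)"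
    using e by (simp add: field_simps power2_eq_square power3_eq_cube)
  finally have R: "norm (Rs e h (G h) - Rs e k (G k))
    \<le> ((N1\<^sup>2 + N1 * N2 * r) / e\<^sub>1 + 2 * N1 ^ 3 * N2 * r / e\<^sub>1\<^sup>2) * norm (h - k)" .
  have "flow p z\<^sub>0 e h - flow p z\<^sub>0 e k = p (h - k) - (h - k) - p (Rs e h (G h) - Rs e k (G k))"
    by (simp add: flow_def G_def pl)
  also have "norm \<dots> \<le> norm (p (h - k)) + norm (h - k) + norm (p (Rs e h (G h) - Rs e k (G k)))"
    by (meson add_mono norm_triangle_ineq4 order_refl order_trans)
  also have "\<dots> \<le> norm (h - k) + norm (h - k) + norm (Rs e h (G h) - Rs e k (G k))"
    by (intro add_mono pn order_refl)
  finally show ?thesis using R by (simp add: algebra_simps)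
qed

text \<open>The resolvent is split at \<open>\<xi>\<close>, where \<open>p\<close> reduces \<open>T \<xi>\<close> to the part above \<open>e\<close>, so that
  \<open>e * norm (p (Rs e \<xi> x)) \<le> norm x / 2\<close>.\<close>

lemma flow_dissipative:
  assumes p: "orthogonal_projector p" and e: "0 < e" and y: "F y = 0"
    and comm: "\<And>x. p (T \<xi> x) = T \<xi> (p x)"
    and low: "\<And>x. e * (norm (p x))\<^sup>2 \<le> T \<xi> (p x) \<bullet> p x"
    and C: "C \<ge> 0" "\<And>x. norm (p (Rs e \<xi> (T y x - T \<xi> x))) \<le> C * norm x"
  shows "(h - y) \<bullet> flow p z\<^sub>0 e h \<le> norm (h - y) *
    ((C - 1/2) * norm (h - y) + (4 * N1 * N2 + N2 * sqrt e) / (4 * e) * (norm (h - y))\<^sup>2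
      + norm (p (y - z\<^sub>0) - (y - z\<^sub>0)))"
proof -
  note pl = orthogonal_projectorD(6-8)[OF p] and pn = orthogonal_projectorD(5)[OF p]
  have half: "norm (p (Rs e \<xi> x)) \<le> norm x / (2 * e)" for x
  proof (cases "p (Rs e \<xi> x) = 0")
    case False
    define v where "v = p (Rs e \<xi> x)"
    have "T \<xi> v + e *\<^sub>R v = p x"
      using arg_cong[OF Rs_solves[OF e, of \<xi> x], of p] by (simp add: v_def pl comm)
    then have "T \<xi> v \<bullet> v + e * (norm v)\<^sup>2 = p x \<bullet> v"
      by (metis inner_add_left inner_scaleR_left power2_norm_eq_inner)
    also have "\<dots> \<le> norm (p x) * norm v" by (rule norm_cauchy_schwarz)
    also have "\<dots> \<le> norm x * norm v" by (intro mult_right_mono pn) simp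
    finally have "2 * e * norm v * norm v \<le> norm x * norm v"
      using low[of "Rs e \<xi> x"] by (simp add: v_def[symmetric] power2_eq_square)
    then show ?thesis using False e by (simp add: v_def[symmetric] field_simps)
  qed (use e in simp)
  define w where "w = h - y"
  define \<rho> where "\<rho> = F y - F h - D h (y - h)"
  define v where "v = Rs e h w"
  have "norm \<rho> \<le> N2 / 2 * (norm (y - h))\<^sup>2" unfolding \<rho>_def by (rule Taylor_remainder)
  then have \<rho>: "norm \<rho> \<le> N2 / 2 * (norm w)\<^sup>2" by (simp add: w_def norm_minus_commute)
  have Fh: "F h = D h w - \<rho>" by (simp add: \<rho>_def w_def y blinfun.diff_right)
  have RT: "Rs e h (T h w) = w - e *\<^sub>R v"
  proof (rule Rs_eqI[OF e])
    have "T h (w - e *\<^sub>R v) + e *\<^sub>R (w - e *\<^sub>R v) = T h w + e *\<^sub>R w - e *\<^sub>R (T h v + e *\<^sub>R v)"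
      by (simp add: T.A.diff T.A.scaleR algebra_simps)
    then show "T h (w - e *\<^sub>R v) + e *\<^sub>R (w - e *\<^sub>R v) = T h w" by (simp add: v_def Rs_solves[OF e])
  qed
  have RF: "Rs e h (Da h (F h)) = w - e *\<^sub>R v - Rs e h (Da h \<rho>)"
    by (simp add: Fh Da.diff T_eq[symmetric] Rs_diff[OF e] RT)
  \<comment> \<open>\<open>q1\<close> is the defect of the initial guess,
    \<open>e *\<^sub>R q2\<close> costs half of \<open>norm w\<close>, \<open>e *\<^sub>R q3\<close>
    costs \<open>C * norm w\<close>, and \<open>e *\<^sub>R q4\<close> and \<open>q5\<close> are
    quadratic in \<open>norm w\<close>. Together with \<open>- w\<close> this leaves the linear rate
    \<open>C - 1/2\<close>.\<close>
  define q1 where "q1 = p (y - z\<^sub>0) - (y - z\<^sub>0)"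
  define q2 where "q2 = p (Rs e \<xi> w)"
  define q3 where "q3 = p (Rs e \<xi> (T y v - T \<xi> v))"
  define q4 where "q4 = p (Rs e \<xi> (T h v - T y v))"
  define q5 where "q5 = p (Rs e h (Da h \<rho>))"
  have "v = Rs e \<xi> w - Rs e \<xi> (T h v - T \<xi> v)"
    unfolding v_def resolvent_identity[OF e, of \<xi> w h, symmetric] by simp
  \<comment> \<open>Passing through \<open>y\<close> separates the fixed difference measured by
    \<open>C\<close> from one that is small when \<open>h\<close> is near \<open>y\<close>.\<close>
  also have "T h v - T \<xi> v = (T y v - T \<xi> v) + (T h v - T y v)" by simp
  finally have pv: "p v = q2 - (q3 + q4)"
    unfolding q2_def q3_def q4_def by (metis Rs_add[OF e] pl(1,2))
  have hz: "h - z\<^sub>0 = w + (y - z\<^sub>0)" by (simp add: w_def)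
  have "flow p z\<^sub>0 e h = (p w + p (y - z\<^sub>0) - (w + (y - z\<^sub>0))) - (p w - e *\<^sub>R p v - q5)"
    unfolding flow_def RF hz pl q5_def ..
  also have "\<dots> = q1 - w + e *\<^sub>R (q2 - (q3 + q4)) + q5" by (simp add: q1_def pv)
  finally have fl: "flow p z\<^sub>0 e h = q1 - w + e *\<^sub>R (q2 - (q3 + q4)) + q5" .
  have "w \<bullet> flow p z\<^sub>0 e h = w \<bullet> q1 - (norm w)\<^sup>2 + e * (w \<bullet> q2) - e * (w \<bullet> q3) - e * (w \<bullet> q4) + w \<bullet> q5"
    unfolding fl by (simp add: inner_add_right inner_diff_right power2_norm_eq_inner right_diff_distrib distrib_left)
  also have "\<dots> \<le> norm w * norm q1 - (norm w)\<^sup>2 + norm w * (e * norm q2) + norm w * (e * norm q3)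
      + norm w * (e * norm q4) + norm w * norm q5"
  proof -
    have up: "e * (w \<bullet> q) \<le> norm w * (e * norm q)" for q
      using mult_left_mono[OF norm_cauchy_schwarz[of w q], of e] e by (simp add: mult_ac)
    have lo: "- (e * (w \<bullet> q)) \<le> norm w * (e * norm q)" for q using up[of "- q"] by simp
    show ?thesis using up[of q2] lo[of q3] lo[of q4] norm_cauchy_schwarz[of w q1] norm_cauchy_schwarz[of w q5] by linarith
  qed
  also have "\<dots> \<le> norm w * norm q1 - (norm w)\<^sup>2 + norm w * (norm w / 2) + norm w * (C * norm w)
      + norm w * (N1 * N2 / e * (norm w)\<^sup>2) + norm w * (N2 / (4 * sqrt e) * (norm w)\<^sup>2)"
  proof (intro add_mono mult_left_mono order_refl norm_ge_zero)
    have v: "e * norm v \<le> norm w" using norm_Rs[OF e, of h w] e by (simp add: v_def field_simps)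
    show "e * norm q2 \<le> norm w / 2"
      using mult_left_mono[OF half[of w], of e] e by (simp add: q2_def)
    have "e * norm q3 \<le> C * (e * norm v)"
      using mult_left_mono[OF C(2)[of v], of e] e by (simp add: q3_def mult_ac)
    also have "\<dots> \<le> C * norm w" using C(1) v by (intro mult_left_mono)
    finally show "e * norm q3 \<le> C * norm w" .
    have "e * norm q4 \<le> norm (T h v - T y v) / 2"
      using mult_left_mono[OF half[of "T h v - T y v"], of e] e by (simp add: q4_def)
    also have "\<dots> \<le> N1 * N2 * norm w * norm v" using T_lipschitz[of h v y] by (simp add: w_def)
    also have "\<dots> \<le> N1 * N2 * norm w * (norm w / e)"
      using N1 N2 norm_Rs[OF e, of h w] by (intro mult_left_mono) (auto simp: v_def)
    finally show "e * norm q4 \<le> N1 * N2 / e * (norm w)\<^sup>2" by (simp add: power2_eq_square)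
    have "norm q5 \<le> norm \<rho> / (2 * sqrt e)"
      using pn norm_Rs_Da[OF e] order_trans unfolding q5_def by blast
    also have "\<dots> \<le> (N2 / 2 * (norm w)\<^sup>2) / (2 * sqrt e)" using e by (intro divide_right_mono \<rho>) simp
    finally show "norm q5 \<le> N2 / (4 * sqrt e) * (norm w)\<^sup>2" by simp
  qed
  also have "\<dots> = norm w * ((C - 1/2) * norm w + (N1 * N2 / e + N2 / (4 * sqrt e)) * (norm w)\<^sup>2 + norm q1)"
    by (simp add: power2_eq_square algebra_simps)
  also have "N1 * N2 / e + N2 / (4 * sqrt e) = (4 * N1 * N2 + N2 * sqrt e) / (4 * e)"
  proof -
    have "N2 / (4 * sqrt e) = N2 * sqrt e / (4 * sqrt e * sqrt e)" using e by simp
    also have "4 * sqrt e * sqrt e = 4 * e" using e by (simp add: mult.assoc)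
    finally have "N2 / (4 * sqrt e) = N2 * sqrt e / (4 * e)" .
    then show ?thesis using e by (simp add: add_divide_distrib)
  qed
  finally show ?thesis by (simp only: w_def q1_def)
qed

end

section \<open>Projected flows in time\<close>

definition ball_retraction :: "'a::real_normed_vector \<Rightarrow> real \<Rightarrow> 'a \<Rightarrow> 'a" where
  "ball_retraction y R h = (if norm (h - y) \<le> R then h else y + (R / norm (h - y)) *\<^sub>R (h - y))"

lemma norm_ball_retraction: "R \<ge> 0 \<Longrightarrow> norm (ball_retraction y R h - y) \<le> R"
  by (auto simp: ball_retraction_def)

text \<open>For two outer points, scale both by the factor of the longer one and then correct the
  factor of the shorter one: each change costs at most \<open>norm (h - k)\<close>, hence the
  2.\<close>

lemma ball_retraction_lipschitz:
  assumes R: "R \<ge> 0"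
  shows "norm (ball_retraction y R h - ball_retraction y R k) \<le> 2 * norm (h - k)"
proof -
  define c where "c v = (if norm v \<le> R then v else (R / norm v) *\<^sub>R v)" for v :: 'a
  have out: "norm (c v - c w) \<le> 2 * norm (v - w)" if v: "norm v > R" "norm w \<le> norm v" for v w
  proof (cases "norm w \<le> R")
    case True
    have "c v - v = (R / norm v - 1) *\<^sub>R v" using v by (simp add: c_def scaleR_diff_left)
    also have "norm \<dots> = norm v - R"
    proof -
      have "R / norm v < 1" using v R by (simp add: divide_less_eq)
      then have "\<bar>R / norm v - 1\<bar> = 1 - R / norm v" by simp
      moreover have "norm v \<noteq> 0" using v R by linarith
      ultimately show ?thesis using v R by (simp add: left_diff_distrib)
    qed
    finally have "norm (c v - v) \<le> norm (v - w)" using norm_triangle_ineq2[of v w] True by linarith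
    moreover have "c v - c w = (c v - v) + (v - w)" using True by (simp add: c_def)
    ultimately show ?thesis using norm_triangle_ineq[of "c v - v" "v - w"] by simp
  next
    case False
    have nv: "norm v > 0" "norm w > 0" using v False R by linarith+
    have "c v - c w = (R / norm v) *\<^sub>R (v - w) + (R / norm v - R / norm w) *\<^sub>R w"
      using v False by (simp add: c_def algebra_simps)
    also have "norm \<dots> \<le> norm ((R / norm v) *\<^sub>R (v - w)) + norm ((R / norm v - R / norm w) *\<^sub>R w)"
      by (rule norm_triangle_ineq)
    also have "norm ((R / norm v - R / norm w) *\<^sub>R w) = R / norm v * \<bar>norm w - norm v\<bar>"
    proof -
      have "(R / norm v - R / norm w) * norm w = R / norm v * (norm w - norm v)"
        using nv by (simp add: field_simps)
      then have "\<bar>R / norm v - R / norm w\<bar> * norm w = R / norm v * \<bar>norm w - norm v\<bar>"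
        using nv R by (metis abs_mult abs_norm_cancel abs_of_nonneg divide_nonneg_nonneg norm_ge_zero)
      then show ?thesis by simp
    qed
    also have "norm ((R / norm v) *\<^sub>R (v - w)) + R / norm v * \<bar>norm w - norm v\<bar> = R / norm v * (norm (v - w) + \<bar>norm w - norm v\<bar>)"
      using R nv by (simp add: distrib_left)
    also have "\<dots> \<le> 1 * (norm (v - w) + norm (v - w))"
      using R v nv norm_triangle_ineq3[of v w] by (intro mult_mono add_mono) (auto simp: abs_minus_commute)
    finally show ?thesis by simp
  qed
  have lip: "norm (c v - c w) \<le> 2 * norm (v - w)" for v w
  proof (cases "norm v \<le> R \<and> norm w \<le> R")
    case True then show ?thesis by (simp add: c_def)
  next
    case False
    show ?thesis
    proof (cases "norm w \<le> norm v")
      case True then show ?thesis using False by (intro out) auto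
    next
      case w: False
      then have "R < norm w" using False by linarith
      then show ?thesis using w out[of w v] norm_minus_commute[of "c w"] norm_minus_commute[of w] by simp
    qed
  qed
  have "ball_retraction y R h = y + c (h - y)" for h by (simp add: ball_retraction_def c_def)
  then show ?thesis using lip[of "h - y" "k - y"] by simp
qed

lemma has_vector_derivative_two_sided:
  fixes z :: "real \<Rightarrow> 'a::real_normed_vector"
  assumes "(z has_vector_derivative d) (at_left t)" "(z has_vector_derivative d) (at_right t)"
  shows "(z has_vector_derivative d) (at t)"
  using assms unfolding has_vector_derivative_def has_derivative_within
  by (simp add: filterlim_split_at)

text \<open>The spectral origin of the projectors is forgotten here. \<open>P_between\<close> says
  that the levels sharing a projector form an interval; \<open>P_left\<close> decides on which side
  of a jump the new value holds.\<close>

locale projected_flow = bounded_derivatives F F' F'' N1 N2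
  for F :: "'a::{real_inner,complete_space} \<Rightarrow> 'a" and F' F'' N1 N2 +
  fixes y z\<^sub>0 :: 'a and P :: "real \<Rightarrow> 'a \<Rightarrow> 'a" and \<epsilon> :: "real \<Rightarrow> real"
  assumes root: "F y = 0"
    and projector: "e > 0 \<Longrightarrow> orthogonal_projector (P e)"
    and P_between: "0 < e1 \<Longrightarrow> e1 \<le> e2 \<Longrightarrow> e2 \<le> e3 \<Longrightarrow> P e1 = P e3 \<Longrightarrow> P e2 = P e1"
    and P_finite: "a > 0 \<Longrightarrow> finite (P ` {a..})"
    and P_left: "e > 0 \<Longrightarrow> \<exists>d. 0 < d \<and> d < e \<and> (\<forall>e'\<in>{d<..e}. P e' = P e)"
    and eps_cont: "continuous_on {0..} \<epsilon>"
    and eps_pos: "t \<ge> 0 \<Longrightarrow> \<epsilon> t > 0"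
    and eps_antimono: "0 \<le> s \<Longrightarrow> s \<le> t \<Longrightarrow> \<epsilon> t \<le> \<epsilon> s"
begin

text \<open>A jump is visible only from the left: at every time the projector keeps its value for a
  while afterwards.\<close>

definition jumps :: "real set" where
  "jumps = {t. 0 < t \<and> \<not> (\<exists>s. 0 \<le> s \<and> s < t \<and> (\<forall>u\<in>{s..<t}. P (\<epsilon> u) = P (\<epsilon> t)))}"

lemma P_eps_between: "0 \<le> s \<Longrightarrow> s \<le> t \<Longrightarrow> t \<le> u \<Longrightarrow> P (\<epsilon> s) = P (\<epsilon> u) \<Longrightarrow> P (\<epsilon> t) = P (\<epsilon> s)"
  using P_between[of "\<epsilon> u" "\<epsilon> t" "\<epsilon> s"] eps_pos[of u] eps_antimono[of t u] eps_antimono[of s t] by auto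

lemma finite_P_eps: "finite ((\<lambda>t. P (\<epsilon> t)) ` {0..b})"
proof (cases "b \<ge> 0")
  case True
  show ?thesis
    by (rule finite_subset[OF _ P_finite[OF eps_pos[OF True]]]) (auto intro!: imageI eps_antimono)
qed simp

text \<open>Since \<open>\<epsilon>\<close> is continuous and nonincreasing, constancy of
  \<open>P\<close> just below a level becomes constancy just after a time.\<close>

lemma P_eps_right_constant:
  assumes t: "t \<ge> 0" shows "\<exists>s>t. \<forall>u\<in>{t..<s}. P (\<epsilon> u) = P (\<epsilon> t)"
proof -
  obtain d where d: "d < \<epsilon> t" "\<forall>e\<in>{d<..\<epsilon> t}. P e = P (\<epsilon> t)"
    using P_left[OF eps_pos[OF t]] by (elim exE conjE)
  have "(\<epsilon> \<longlongrightarrow> \<epsilon> t) (at t within {0..})" using eps_cont t by (simp add: continuous_on_def)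
  moreover have "at_right t \<le> at t within {0..}" using t by (intro at_le) auto
  ultimately have "(\<epsilon> \<longlongrightarrow> \<epsilon> t) (at_right t)" by (rule tendsto_mono[rotated])
  then have "\<forall>\<^sub>F u in at_right t. d < \<epsilon> u" using d(1) by (rule order_tendstoD)
  then obtain s where s: "s > t" "\<forall>u>t. u < s \<longrightarrow> d < \<epsilon> u"
    unfolding eventually_at_right_field by (elim exE conjE)
  have "P (\<epsilon> u) = P (\<epsilon> t)" if u: "u \<in> {t..<s}" for u
  proof (cases "u = t")
    case False
    then have "\<epsilon> u \<in> {d<..\<epsilon> t}" using u s(2) eps_antimono[OF t, of u] by simp
    with d(2) show ?thesis by (rule bspec)
  qed simp
  with s(1) show ?thesis by (intro exI[of _ s] conjI ballI)
qed

lemma P_eps_left_constant: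
  assumes t: "t > 0" shows "\<exists>s. 0 \<le> s \<and> s < t \<and> (\<forall>u\<in>{s..<t}. P (\<epsilon> u) = P (\<epsilon> s))"
proof -
  have "finite ((\<lambda>t. P (\<epsilon> t)) ` {0..<t})"
    by (rule finite_subset[OF image_mono finite_P_eps[of t]]) auto
  from t this show ?thesis
  proof (rule eventually_constant_left)
    fix s r u assume "0 \<le> s" "s \<le> r" "r \<le> u" "P (\<epsilon> s) = P (\<epsilon> u)"
    then show "P (\<epsilon> r) = P (\<epsilon> s)" by (rule P_eps_between)
  qed
qed

text \<open>Two jumps cannot share a projector, which would then be constant between them, so that
  the later time would be no jump. Hence the jumps up to \<open>b\<close> inject into the finitely
  many projectors met.\<close>

lemma finite_jumps: "finite (jumps \<inter> {0..b})"
proof (rule finite_imageD[of "\<lambda>t. P (\<epsilon> t)"])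
  show "finite ((\<lambda>t. P (\<epsilon> t)) ` (jumps \<inter> {0..b}))"
    by (rule finite_subset[OF _ finite_P_eps[of b]]) auto
  have no: False if st: "s \<in> jumps" "t \<in> jumps" "s < t" "P (\<epsilon> s) = P (\<epsilon> t)" for s t
  proof -
    have "0 < s" using st(1) by (simp add: jumps_def)
    have "P (\<epsilon> u) = P (\<epsilon> t)" if "u \<in> {s..<t}" for u
      using P_eps_between[of s u t] st(4) that \<open>0 < s\<close> by simp
    then have "\<forall>u\<in>{s..<t}. P (\<epsilon> u) = P (\<epsilon> t)" by blast
    moreover have "0 \<le> s" using \<open>0 < s\<close> by simp
    ultimately show False using st(2,3) unfolding jumps_def by blast
  qed
  show "inj_on (\<lambda>t. P (\<epsilon> t)) (jumps \<inter> {0..b})"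
  proof (rule inj_onI, rule ccontr)
    fix s t assume "s \<in> jumps \<inter> {0..b}" "t \<in> jumps \<inter> {0..b}" "P (\<epsilon> s) = P (\<epsilon> t)" "s \<noteq> t"
    then show False using no[of s t] no[of t s] by (cases "s < t") auto
  qed
qed

definition rhs :: "'a \<Rightarrow> real \<Rightarrow> 'a" where
  "rhs h t = flow (P (\<epsilon> t)) z\<^sub>0 (\<epsilon> t) h"

definition lipschitz_bound :: "real \<Rightarrow> real \<Rightarrow> real" where
  "lipschitz_bound r b = 2 + (N1\<^sup>2 + N1 * N2 * r) / \<epsilon> b + 2 * N1 ^ 3 * N2 * r / (\<epsilon> b)\<^sup>2"

lemma lipschitz_bound_nonneg: "0 \<le> r \<Longrightarrow> 0 \<le> b \<Longrightarrow> 0 \<le> lipschitz_bound r b"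
  unfolding lipschitz_bound_def using N1 N2 eps_pos[of b]
  by (intro add_nonneg_nonneg divide_nonneg_nonneg mult_nonneg_nonneg) auto

lemma flow_lipschitz_on_interval:
  assumes "orthogonal_projector p" "0 \<le> t" "t \<le> b" "norm (h - y) \<le> r" "norm (k - y) \<le> r"
  shows "norm (flow p z\<^sub>0 (\<epsilon> t) h - flow p z\<^sub>0 (\<epsilon> t) k) \<le> lipschitz_bound r b * norm (h - k)"
  unfolding lipschitz_bound_def
  using assms eps_pos[of b] eps_antimono[of t b] by (intro flow_lipschitz[OF _ _ _ root]) auto

text \<open>The continuous extension freezes the projector at its value at \<open>u\<close>; the
  factor 2 is the Lipschitz constant of the retraction.\<close>

lemma truncated_piece:
  assumes R: "R \<ge> 0" and uv: "0 \<le> u" "u \<le> v" "v \<le> b"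
    and const: "\<And>t. t \<in> {u..<v} \<Longrightarrow> P (\<epsilon> t) = P (\<epsilon> u)" "v \<notin> jumps \<Longrightarrow> P (\<epsilon> v) = P (\<epsilon> u)"
  shows "continuous_piece (\<lambda>h. rhs (ball_retraction y R h)) jumps (2 * lipschitz_bound R b) u v"
proof -
  define g where "g h t = flow (P (\<epsilon> u)) z\<^sub>0 (\<epsilon> t) (ball_retraction y R h)" for h t
  have p: "orthogonal_projector (P (\<epsilon> u))" using uv by (intro projector eps_pos)
  have "continuous_on {u..v} (g h)" for h
    unfolding g_def[abs_def]
    using uv by (intro continuous_on_flow p continuous_on_subset[OF eps_cont] eps_pos) auto
  moreover have "norm (g h t - g k t) \<le> 2 * lipschitz_bound R b * norm (h - k)" if t: "t \<in> {u..v}" for h k t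
  proof -
    have "norm (g h t - g k t) \<le> lipschitz_bound R b * norm (ball_retraction y R h - ball_retraction y R k)"
      unfolding g_def using t uv R
      by (intro flow_lipschitz_on_interval p norm_ball_retraction) auto
    also have "\<dots> \<le> lipschitz_bound R b * (2 * norm (h - k))"
      using R uv by (intro mult_left_mono ball_retraction_lipschitz lipschitz_bound_nonneg) auto
    finally show ?thesis by simp
  qed
  moreover have "rhs (ball_retraction y R h) t = g h t" if "t \<in> {u..<v}" for h t
    using const(1)[OF that] by (simp add: g_def rhs_def)
  moreover have "rhs (ball_retraction y R h) v = g h v" if "v \<notin> jumps" for h
    using const(2)[OF that] by (simp add: g_def rhs_def)
  ultimately show ?thesis unfolding continuous_piece_def by blast
qed

lemma truncated_solution_exists:
  assumes R: "R \<ge> 0" and b: "b \<ge> 0"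
  shows "\<exists>z. z 0 = x \<and> piecewise_solution (\<lambda>h. rhs (ball_retraction y R h)) jumps 0 b z"
proof (rule piecewise_solution_exists[OF b])
  show "2 * lipschitz_bound R b \<ge> 0" using lipschitz_bound_nonneg[OF R b] by simp
  fix s assume s: "0 \<le> s" "s \<le> b"
  obtain r where r: "r > s" "\<And>u. u \<in> {s..<r} \<Longrightarrow> P (\<epsilon> u) = P (\<epsilon> s)"
    using P_eps_right_constant[OF s(1)] by blast
  obtain l where l: "l < s" "\<And>u v. 0 \<le> u \<Longrightarrow> 0 \<le> v \<Longrightarrow> u \<in> {l..<s} \<Longrightarrow> v \<in> {l..<s} \<Longrightarrow> P (\<epsilon> u) = P (\<epsilon> v)"
  proof (cases "s = 0")
    \<comment> \<open>No times precede zero, so any negative \<open>l\<close> satisfies the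
      condition vacuously.\<close>
    case True then show ?thesis using that[of "-1"] by auto
  next
    case False
    then have "0 < s" using s by simp
    from P_eps_left_constant[OF this] obtain l where l: "0 \<le> l" "l < s" "\<forall>u\<in>{l..<s}. P (\<epsilon> u) = P (\<epsilon> l)"
      by (elim exE conjE)
    show ?thesis by (rule that[OF l(2)]) (rule trans[OF bspec[OF l(3)] bspec[OF l(3), symmetric]])
  qed
  have "continuous_piece (\<lambda>h. rhs (ball_retraction y R h)) jumps (2 * lipschitz_bound R b) u s \<and>
    continuous_piece (\<lambda>h. rhs (ball_retraction y R h)) jumps (2 * lipschitz_bound R b) s v"
    if uv: "0 \<le> u" "u \<le> s" "s \<le> v" "v \<le> b" "v - u < min (r - s) (s - l)" for u v
  proof
    show "continuous_piece (\<lambda>h. rhs (ball_retraction y R h)) jumps (2 * lipschitz_bound R b) s v"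
    proof (rule truncated_piece[OF R s(1) uv(3,4)])
      show "P (\<epsilon> t) = P (\<epsilon> s)" if "t \<in> {s..<v}" for t using that uv by (intro r(2)) auto
      show "P (\<epsilon> v) = P (\<epsilon> s)" using uv by (intro r(2)) auto
    qed
    show "continuous_piece (\<lambda>h. rhs (ball_retraction y R h)) jumps (2 * lipschitz_bound R b) u s"
    proof (rule truncated_piece[OF R uv(1,2) s(2)])
      fix t assume "t \<in> {u..<s}"
      then show "P (\<epsilon> t) = P (\<epsilon> u)" using uv by (intro l(2)) auto
    next
      assume j: "s \<notin> jumps"
      show "P (\<epsilon> s) = P (\<epsilon> u)"
      proof (cases "u = s")
        case False
        then have "0 < s" using uv by simp
        then obtain m where m: "0 \<le> m" "m < s" "\<forall>u\<in>{m..<s}. P (\<epsilon> u) = P (\<epsilon> s)"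
          using j unfolding jumps_def by blast
        \<comment> \<open>\<open>max m u\<close> lies in both left neighbourhoods of
          \<open>s\<close>: the one given by \<open>s \<notin> jumps\<close> and the one that
          contains \<open>u\<close>.\<close>
        have "P (\<epsilon> s) = P (\<epsilon> (max m u))"
          by (rule bspec[OF m(3), symmetric]) (use False uv m in simp)
        also have "\<dots> = P (\<epsilon> u)" using False uv m by (intro l(2)) auto
        finally show ?thesis .
      qed simp
    qed
  qed
  moreover have "min (r - s) (s - l) > 0" using r l by simp
  ultimately show "\<exists>d>0. \<forall>u v. 0 \<le> u \<and> u \<le> s \<and> s \<le> v \<and> v \<le> b \<and> v - u < d \<longrightarrow>
     continuous_piece (\<lambda>h. rhs (ball_retraction y R h)) jumps (2 * lipschitz_bound R b) u s \<and>
     continuous_piece (\<lambda>h. rhs (ball_retraction y R h)) jumps (2 * lipschitz_bound R b) s v" by blast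
qed

text \<open>Two given solutions on a compact interval stay in some ball around \<open>y\<close>,
  where the local Lipschitz bound applies; this covers competitors for which no a priori bound is
  known.\<close>

lemma solutions_agree:
  assumes z: "continuous_on {0..b} z" "\<And>t. 0 \<le> t \<Longrightarrow> t < b \<Longrightarrow> (z has_vector_derivative rhs (z t) t) (at_right t)"
    and w: "continuous_on {0..b} w" "\<And>t. 0 \<le> t \<Longrightarrow> t < b \<Longrightarrow> (w has_vector_derivative rhs (w t) t) (at_right t)"
    and init: "z 0 = w 0" and t: "t \<in> {0..b}"
  shows "z t = w t"
proof -
  have "bounded ((\<lambda>t. z t - y) ` {0..b} \<union> (\<lambda>t. w t - y) ` {0..b})"
    using z(1) w(1) by (intro compact_imp_bounded compact_Un compact_continuous_image continuous_intros) auto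
  then obtain r where r: "\<And>v. v \<in> (\<lambda>t. z t - y) ` {0..b} \<union> (\<lambda>t. w t - y) ` {0..b} \<Longrightarrow> norm v \<le> r"
    unfolding bounded_iff by blast
  show ?thesis
  proof (rule right_solutions_unique[OF z(1) w(1) z(2) w(2) _ init t])
    fix s assume s: "0 \<le> s" "s < b"
    show "norm (rhs (z s) s - rhs (w s) s) \<le> lipschitz_bound r b * norm (z s - w s)"
      unfolding rhs_def using s by (intro flow_lipschitz_on_interval projector eps_pos r) auto
  qed
qed

text \<open>The estimate is demanded of the truncated equation, which is solvable on every
  \<open>[0, n]\<close>. As \<open>B\<close> never exceeds \<open>R\<close>, it shows that the
  truncation was inactive; uniqueness then glues the solutions for different
  \<open>n\<close>.\<close>

theorem global_solution:
  assumes R: "R \<ge> 0" and B: "\<And>t. t \<ge> 0 \<Longrightarrow> B t \<le> R"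
    and apriori: "\<And>z b t. continuous_on {0..b} z \<Longrightarrow> z 0 = z\<^sub>0 \<Longrightarrow>
      (\<And>t. 0 \<le> t \<Longrightarrow> t < b \<Longrightarrow> (z has_vector_derivative rhs (ball_retraction y R (z t)) t) (at_right t)) \<Longrightarrow>
      t \<in> {0..b} \<Longrightarrow> norm (z t - y) \<le> B t"
  shows "\<exists>z. cauchy_solution rhs z\<^sub>0 z \<and> (\<forall>w. cauchy_solution rhs z\<^sub>0 w \<longrightarrow> (\<forall>t\<ge>0. w t = z t)) \<and>
    (\<forall>t\<ge>0. norm (z t - y) \<le> B t)"
proof -
  have "\<exists>z. z 0 = z\<^sub>0 \<and> (\<forall>t\<in>{0..real n}. norm (z t - y) \<le> B t) \<and> piecewise_solution rhs jumps 0 (real n) z" for n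
  proof -
    obtain z where z: "z 0 = z\<^sub>0" "piecewise_solution (\<lambda>h. rhs (ball_retraction y R h)) jumps 0 (real n) z"
      using truncated_solution_exists[OF R, of "real n" z\<^sub>0] by auto
    have bd: "norm (z t - y) \<le> B t" if "t \<in> {0..real n}" for t
      using z that by (intro apriori[of "real n"]) (auto simp: piecewise_solution_def)
    then have "ball_retraction y R (z t) = z t" if "t \<in> {0..real n}" for t
      using that B order_trans unfolding ball_retraction_def by fastforce
    then have "piecewise_solution rhs jumps 0 (real n) z"
      using z(2) by (auto simp: piecewise_solution_def)
    with z(1) bd show ?thesis by blast
  qed
  then obtain Z where Z: "\<And>n. Z n 0 = z\<^sub>0" "\<And>n t. t \<in> {0..real n} \<Longrightarrow> norm (Z n t - y) \<le> B t"
    "\<And>n. piecewise_solution rhs jumps 0 (real n) (Z n)" by metis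
  have Zc: "continuous_on {0..b} (Z n)" if "b \<le> real n" for n b
    using Z(3)[of n] that unfolding piecewise_solution_def by (auto intro: continuous_on_subset)
  have Zr: "(Z n has_vector_derivative rhs (Z n t) t) (at_right t)" if "0 \<le> t" "t < real n" for n t
    using Z(3)[of n] that unfolding piecewise_solution_def by auto
  have Zl: "(Z n has_vector_derivative rhs (Z n t) t) (at_left t)" if "0 < t" "t \<le> real n" "t \<notin> jumps" for n t
    using Z(3)[of n] that unfolding piecewise_solution_def by auto
  define z where "z t = Z (nat \<lceil>t\<rceil>) t" for t
  have zZ: "z t = Z n t" if t: "t \<in> {0..real n}" for t n
    unfolding z_def
  proof (rule solutions_agree[of t "Z (nat \<lceil>t\<rceil>)" "Z n"])
    show "t \<in> {0..t}" using t by simp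
    have tn: "t \<le> real (nat \<lceil>t\<rceil>)" by linarith
    then show "continuous_on {0..t} (Z (nat \<lceil>t\<rceil>))" by (rule Zc)
    show "(Z (nat \<lceil>t\<rceil>) has_vector_derivative rhs (Z (nat \<lceil>t\<rceil>) s) s) (at_right s)" if "0 \<le> s" "s < t" for s
      by (rule Zr[OF that(1) order_less_le_trans[OF that(2) tn]])
  qed (use t Z(1) in \<open>auto intro: Zc Zr\<close>)
  have right: "(z has_vector_derivative rhs (z t) t) (at_right t)" if t: "t \<ge> 0" for t
  proof -
    \<comment> \<open>One more than the ceiling, because a right derivative at \<open>t\<close>
      needs \<open>t < real n\<close>; for the left derivative the ceiling itself will do.\<close>
    define n where "n = nat \<lceil>t\<rceil> + 1"
    have n: "t < real n" unfolding n_def by linarith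
    have "(Z n has_vector_derivative rhs (z t) t) (at_right t)"
      using Zr[OF t n] zZ[of t n] t n by simp
    then show ?thesis
      by (rule has_vector_derivative_eventually_cong)
         (use t n zZ in \<open>auto simp: eventually_at_right_field intro!: exI[of _ "real n"]\<close>)
  qed
  have left: "(z has_vector_derivative rhs (z t) t) (at_left t)" if t: "t > 0" "t \<notin> jumps" for t
  proof -
    define n where "n = nat \<lceil>t\<rceil>"
    have n: "t \<le> real n" unfolding n_def by linarith
    have "(Z n has_vector_derivative rhs (z t) t) (at_left t)"
      using Zl[of t n] zZ[of t n] t n by simp
    then show ?thesis
      by (rule has_vector_derivative_eventually_cong)
         (use t n zZ in \<open>auto simp: eventually_at_left_field intro!: exI[of _ 0]\<close>)
  qed
  have cont: "continuous_on {0..b} z" for b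
  proof -
    have bn: "b \<le> real (nat \<lceil>b\<rceil>)" by linarith
    show ?thesis
    proof (rule continuous_on_eq[OF Zc[OF bn]])
      fix t assume "t \<in> {0..b}"
      then have "t \<in> {0..real (nat \<lceil>b\<rceil>)}" using order_trans[OF _ bn] by (simp del: of_nat_nat)
      then show "Z (nat \<lceil>b\<rceil>) t = z t" by (rule zZ[symmetric])
    qed
  qed
  have cont': "continuous_on {0..} z"
    unfolding continuous_on_eq_continuous_within
  proof
    fix t :: real assume t: "t \<in> {0..}"
    have "continuous (at t within {0..t+1}) z"
      using cont[of "t+1"] t by (simp add: continuous_on_eq_continuous_within)
    moreover have "at t within {0..t+1} = at t within {0..}"
      by (rule at_within_nhd[of _ "{..<t+1}"]) auto
    ultimately show "continuous (at t within {0..}) z" by simp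
  qed
  have "cauchy_solution rhs z\<^sub>0 z"
    unfolding cauchy_solution_def
  proof (intro conjI allI impI)
    show "z 0 = z\<^sub>0" using Z(1) by (simp add: z_def)
    show "continuous_on {0..} z" by (rule cont')
    show "(z has_vector_derivative rhs (z t) t) (at_right t)" if "0 \<le> t" for t by (rule right[OF that])
    show "\<exists>D. (\<forall>b. finite (D \<inter> {0..b})) \<and> (\<forall>t\<in>{0..} - D. (z has_vector_derivative rhs (z t) t) (at t within {0..}))"
    proof (intro exI[of _ jumps] conjI allI ballI finite_jumps)
      fix t assume t: "t \<in> {0..} - jumps"
      show "(z has_vector_derivative rhs (z t) t) (at t within {0..})"
      \<comment> \<open>At time zero the derivative within \<open>{0..}\<close> is the right
        derivative; at the other times the two one-sided derivatives combine.\<close>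
      proof (cases "t = 0")
        case True
        then show ?thesis using right[of 0] by (simp add: at_within_Ici_at_right)
      next
        case False
        then have "0 < t" "t \<notin> jumps" using t by auto
        then show ?thesis
          by (intro has_vector_derivative_at_within[OF has_vector_derivative_two_sided[OF left right]]) simp_all
      qed
    qed
  qed
  moreover have "w t = z t" if w: "cauchy_solution rhs z\<^sub>0 w" and t: "t \<ge> 0" for w t
  proof (rule solutions_agree[of t w z])
    show "continuous_on {0..t} w" using w unfolding cauchy_solution_def by (auto intro: continuous_on_subset)
    show "w 0 = z 0" using w Z(1) unfolding cauchy_solution_def by (simp add: z_def)
  qed (use w right cont t in \<open>auto simp: cauchy_solution_def\<close>)
  moreover have "norm (z t - y) \<le> B t" if t: "t \<ge> 0" for t
    unfolding z_def by (rule Z(2)) (use t in \<open>auto simp: le_of_int_ceiling\<close>)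
  ultimately show ?thesis by blast
qed

end

section \<open>Verification of the barrier\<close>

theorem theorem4p3:
  fixes F :: "'a::{real_inner, complete_space} \<Rightarrow> 'a"
    and F' :: "'a \<Rightarrow> ('a \<Rightarrow>\<^sub>L 'a)"
    and F'' :: "'a \<Rightarrow> ('a \<Rightarrow>\<^sub>L ('a \<Rightarrow>\<^sub>L 'a))"
    and z\<^sub>0 y \<xi> :: 'a
    and N1 N2 \<epsilon>\<^sub>0 C \<gamma> C\<^sub>0 C\<^sub>\<alpha> :: real
    and \<epsilon> \<epsilon>' \<alpha> :: "real \<Rightarrow> real"
  assumes a: "F y = 0" "\<And>x. F x = 0 \<Longrightarrow> x = y"
    and b_compact: "compact_map F"
    and b_deriv: "\<And>x. (F has_derivative blinfun_apply (F' x)) (at x)"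
    and b_deriv2: "\<And>x. (F' has_derivative blinfun_apply (F'' x)) (at x)"
    and b_bounds: "N1 > 0" "N2 > 0" "\<And>x. norm (F' x) \<le> N1" "\<And>x. norm (F'' x) \<le> N2"
    and c_eps: "\<epsilon>\<^sub>0 > 0"
    and c_bdd: "bdd_above ((\<lambda>e. onorm (\<lambda>x. P_proj F' N1 \<xi> e
                  (inv (T_reg F' e \<xi>) (T_op F' y x - T_op F' \<xi> x)))) ` {0<..\<epsilon>\<^sub>0})"
    and c_C: "C = (SUP e\<in>{0<..\<epsilon>\<^sub>0}. onorm (\<lambda>x. P_proj F' N1 \<xi> e
                  (inv (T_reg F' e \<xi>) (T_op F' y x - T_op F' \<xi> x))))"
    and c_less: "C < 1 / 2"
    and d: "\<And>t. t \<ge> 0 \<Longrightarrow> 0 < \<epsilon> t \<and> \<epsilon> t \<le> \<epsilon>\<^sub>0"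
    and gamma: "\<gamma> = 1 / 2 - C"
    and alpha: "\<And>t. \<alpha> t = norm (P_proj F' N1 \<xi> (\<epsilon> t) (y - z\<^sub>0) - (y - z\<^sub>0))"
    and cond1: "orthogonal_projection {x. T_op F' \<xi> x = 0} (y - z\<^sub>0) = 0"
    and cond2_deriv: "\<And>t. t \<ge> 0 \<Longrightarrow> (\<epsilon> has_real_derivative \<epsilon>' t) (at t within {0..})"
    and cond2_cont: "continuous_on {0..} \<epsilon>'"
    and cond2_mono: "antimono_on {0..} \<epsilon>"
    and cond2_lim: "(\<epsilon> \<longlongrightarrow> 0) at_top"
    and cond2_bdd: "bdd_below ((\<lambda>t. \<gamma> - \<bar>\<epsilon>' t\<bar> / \<epsilon> t) ` {0..})"
    and cond2_C0: "C\<^sub>0 = (INF t\<in>{0..}. \<gamma> - \<bar>\<epsilon>' t\<bar> / \<epsilon> t)"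
    and cond2_pos: "C\<^sub>0 > 0"
    and cond3_bdd: "bdd_above ((\<lambda>t. \<alpha> t / \<epsilon> t) ` {0..})"
    and cond3_Calpha: "C\<^sub>\<alpha> = \<epsilon> 0 * (SUP t\<in>{0..}. \<alpha> t / \<epsilon> t)"
    and cond4: "ereal ((4 * N1 * N2 + N2 * sqrt (\<epsilon> 0)) / (2 * C\<^sub>0))
                < ereal (\<epsilon> 0) * min (ereal C\<^sub>0 / ereal (2 * C\<^sub>\<alpha>)) (1 / ereal (norm (y - z\<^sub>0)))"
  shows "\<exists>z. cauchy_solution (Phi F F' N1 \<xi> z\<^sub>0 \<epsilon>) z\<^sub>0 z \<and>
             (\<forall>w. cauchy_solution (Phi F F' N1 \<xi> z\<^sub>0 \<epsilon>) z\<^sub>0 w \<longrightarrow> (\<forall>t\<ge>0. w t = z t)) \<and>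
             (\<forall>t\<ge>0. norm (z t - y) \<le> 2 * C\<^sub>0 / (4 * N1 * N2 + N2 * sqrt (\<epsilon> 0)) * \<epsilon> t)"
proof -
  define P where "P = P_proj F' N1 \<xi>"
  have P: "P e = spectral_projector (T_op F' \<xi>) e (N1\<^sup>2)" for e by (simp add: P_def P_proj_def)
  interpret bounded_derivatives F F' F'' N1 N2
    using b_deriv b_deriv2 b_bounds by unfold_locales
  interpret A: compact_psd_operator "T \<xi>"
    by (rule compact_psd_operator_T_op[OF b_compact b_deriv])
  have eps_cont: "continuous_on {0..} \<epsilon>"
    using cond2_deriv by (auto intro!: DERIV_continuous_on)
  interpret projected_flow F F' F'' N1 N2 y z\<^sub>0 P \<epsilon>
  proof
    show "F y = 0" by (rule a)
    show "orthogonal_projector (P e)" if "e > 0" for e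
      unfolding P by (rule A.spectral_projector_projector[OF norm_T that])
    show "P e2 = P e1" if "0 < e1" "e1 \<le> e2" "e2 \<le> e3" "P e1 = P e3" for e1 e2 e3
      using that unfolding P by (rule A.spectral_projector_between[OF norm_T])
    show "finite (P ` {r..})" if "r > 0" for r
    proof -
      have "P = (\<lambda>e. spectral_projector (T \<xi>) e (N1\<^sup>2))" by (rule ext) (rule P)
      then show ?thesis using A.finite_spectral_projectors[OF norm_T that] by simp
    qed
    show "\<exists>d. 0 < d \<and> d < e \<and> (\<forall>e'\<in>{d<..e}. P e' = P e)" if "e > 0" for e
      unfolding P by (rule A.spectral_projector_left_constant[OF norm_T that])
    show "0 < \<epsilon> t" if "t \<ge> 0" for t using d[OF that] by simp
    show "\<epsilon> t \<le> \<epsilon> s" if "0 \<le> s" "s \<le> t" for s t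
      using monotone_onD[OF cond2_mono, of s t] that by simp
  qed (rule eps_cont)
  have rhs: "Phi F F' N1 \<xi> z\<^sub>0 \<epsilon> = rhs"
    by (intro ext) (simp only: Phi_def rhs_def flow_def P_def[symmetric])

  define M where "M = 4 * N1 * N2 + N2 * sqrt (\<epsilon> 0)"
  define r\<^sub>0 where "r\<^sub>0 = 2 * C\<^sub>0 / M"
  define c where "c = (SUP t\<in>{0..}. \<alpha> t / \<epsilon> t)"
  have M: "M > 0" unfolding M_def using N1 N2 eps_pos[of 0] by (intro add_pos_nonneg mult_pos_pos) auto
  have r0: "r\<^sub>0 > 0" using M cond2_pos by (simp add: r\<^sub>0_def)
  have \<alpha>: "\<alpha> t \<le> c * \<epsilon> t" if t: "t \<ge> 0" for t
  proof -
    have "\<alpha> t / \<epsilon> t \<le> c" unfolding c_def by (rule cSUP_upper[OF _ cond3_bdd]) (use t in simp)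
    then show ?thesis using eps_pos[OF t] by (simp add: pos_divide_le_eq)
  qed
  have c0: "c \<ge> 0"
  proof -
    have "0 \<le> \<alpha> 0" by (simp add: alpha)
    then have "0 \<le> c * \<epsilon> 0" using \<alpha>[of 0] by simp
    then show ?thesis using eps_pos[of 0] by (simp add: zero_le_mult_iff)
  qed
  have Cal: "C\<^sub>\<alpha> = \<epsilon> 0 * c" by (simp add: cond3_Calpha c_def)
  \<comment> \<open>A zero denominator makes an extended real quotient infinite, and its inequality
    then carries no information. This occurs for \<open>c = 0\<close> and for
    \<open>y = z\<^sub>0\<close>, where the respective consequences below are immediate.\<close>
  have lt1: "ereal (M / (2 * C\<^sub>0)) < ereal (\<epsilon> 0) * (ereal C\<^sub>0 / ereal (2 * C\<^sub>\<alpha>))"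
    and lt2: "ereal (M / (2 * C\<^sub>0)) < ereal (\<epsilon> 0) * (1 / ereal (norm (y - z\<^sub>0)))"
  proof -
    have "ereal (\<epsilon> 0) \<ge> 0" using eps_pos[of 0] by simp
    note le = less_le_trans[OF cond4[folded M_def] ereal_mult_left_mono[OF _ this]]
    show "ereal (M / (2 * C\<^sub>0)) < ereal (\<epsilon> 0) * (ereal C\<^sub>0 / ereal (2 * C\<^sub>\<alpha>))"
      by (rule le[OF min.cobounded1])
    show "ereal (M / (2 * C\<^sub>0)) < ereal (\<epsilon> 0) * (1 / ereal (norm (y - z\<^sub>0)))"
      by (rule le[OF min.cobounded2])
  qed
  have cM: "M * c < C\<^sub>0\<^sup>2"
  proof (cases "c = 0")
    case True then show ?thesis using cond2_pos by simp
  next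
    case False
    then have cp: "c > 0" using c0 by simp
    then have "2 * C\<^sub>\<alpha> \<noteq> 0" using eps_pos[of 0] by (simp add: Cal)
    then have "M / (2 * C\<^sub>0) < \<epsilon> 0 * (C\<^sub>0 / (2 * C\<^sub>\<alpha>))" using lt1 by simp
    also have "\<dots> = C\<^sub>0 / (2 * c)" using eps_pos[of 0] by (simp add: Cal)
    finally show ?thesis using cp cond2_pos by (simp add: field_simps power2_eq_square)
  qed
  have init: "norm (z\<^sub>0 - y) \<le> r\<^sub>0 * \<epsilon> 0"
  proof (cases "y = z\<^sub>0")
    case True then show ?thesis using r0 eps_pos[of 0] by simp
  next
    case False
    then have n: "norm (y - z\<^sub>0) > 0" by simp
    then have "M / (2 * C\<^sub>0) < \<epsilon> 0 * (1 / norm (y - z\<^sub>0))" using lt2 by (simp add: one_ereal_def)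
    then have "norm (y - z\<^sub>0) < \<epsilon> 0 * (2 * C\<^sub>0) / M"
      using n M cond2_pos by (simp add: field_simps)
    then show ?thesis by (simp add: r\<^sub>0_def norm_minus_commute mult_ac)
  qed
  \<comment> \<open>\<open>onorm\<close> controls values only for a bounded linear map, so
    boundedness is established before the supremum is applied.\<close>
  have CP: "norm (P e (Rs e \<xi> (T y x - T \<xi> x))) \<le> C * norm x" if e: "e \<in> {0<..\<epsilon>\<^sub>0}" for e x
  proof -
    have e0: "e > 0" using e by simp
    let ?f = "\<lambda>x. P e (Rs e \<xi> (T y x - T \<xi> x))"
    have bl: "bounded_linear ?f"
      by (intro bounded_linear_compose[OF orthogonal_projectorD(1)[OF projector[OF e0]]]
          bounded_linear_compose[OF bounded_linear_Rs[OF e0]] bounded_linear_sub T.linear)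
    have "norm (?f x) \<le> onorm ?f * norm x" by (rule onorm[OF bl])
    also have "onorm ?f \<le> C" unfolding c_C P_def by (rule cSUP_upper[OF e c_bdd])
    finally show ?thesis by (simp add: mult_right_mono)
  qed
  have C0: "C \<ge> 0"
  proof -
    have e: "\<epsilon>\<^sub>0 \<in> {0<..\<epsilon>\<^sub>0}" using c_eps by simp
    have "0 \<le> onorm (\<lambda>x. P \<epsilon>\<^sub>0 (Rs \<epsilon>\<^sub>0 \<xi> (T y x - T \<xi> x)))"
      by (intro onorm_pos_le bounded_linear_compose[OF orthogonal_projectorD(1)[OF projector[OF c_eps]]]
          bounded_linear_compose[OF bounded_linear_Rs[OF c_eps]] bounded_linear_sub T.linear)
    also have "\<dots> \<le> C" unfolding c_C P_def by (rule cSUP_upper[OF e c_bdd])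
    finally show ?thesis .
  qed
  have rate: "C\<^sub>0 \<le> \<gamma> - \<bar>\<epsilon>' t\<bar> / \<epsilon> t" if "t \<ge> 0" for t
    unfolding cond2_C0 by (rule cINF_lower[OF cond2_bdd]) (use that in simp)
  have "\<exists>z. cauchy_solution rhs z\<^sub>0 z \<and> (\<forall>w. cauchy_solution rhs z\<^sub>0 w \<longrightarrow> (\<forall>t\<ge>0. w t = z t)) \<and>
    (\<forall>t\<ge>0. norm (z t - y) \<le> r\<^sub>0 * \<epsilon> t)"
  proof (rule global_solution)
    show "0 \<le> r\<^sub>0 * \<epsilon> 0" using r0 eps_pos[of 0] by simp
    show "r\<^sub>0 * \<epsilon> t \<le> r\<^sub>0 * \<epsilon> 0" if "t \<ge> 0" for t
      using r0 eps_antimono[of 0 t] that by simp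
  next
    fix z b t
    assume zc: "continuous_on {0..b} z" and z0: "z 0 = z\<^sub>0" and t: "t \<in> {0..b}"
      and zd: "\<And>t. 0 \<le> t \<Longrightarrow> t < b \<Longrightarrow>
        (z has_vector_derivative rhs (ball_retraction y (r\<^sub>0 * \<epsilon> 0) (z t)) t) (at_right t)"
    define g where "g s = (norm (z s - y))\<^sup>2 - r\<^sub>0\<^sup>2 * (\<epsilon> s)\<^sup>2" for s
    have "g t \<le> 0"
    proof (rule right_derivative_barrier[OF _ _ _ t])
      show "continuous_on {0..b} g"
        unfolding g_def by (intro continuous_intros zc continuous_on_subset[OF eps_cont]) auto
      have "(norm (z\<^sub>0 - y))\<^sup>2 \<le> (r\<^sub>0 * \<epsilon> 0)\<^sup>2" using init by (intro power_mono) auto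
      then show "g 0 \<le> 0" by (simp add: g_def z0 power_mult_distrib)
    next
      fix s assume s: "0 \<le> s" "s < b" and gs: "g s = 0"
      define e where "e = \<epsilon> s"
      have e: "0 < e" "e \<le> \<epsilon> 0" "e \<in> {0<..\<epsilon>\<^sub>0}"
        using eps_pos[OF s(1)] eps_antimono[of 0 s] s d[of s] by (auto simp: e_def)
      have "(norm (z s - y))\<^sup>2 = (r\<^sub>0 * e)\<^sup>2" using gs by (simp add: g_def e_def power_mult_distrib)
      then have ns: "norm (z s - y) = r\<^sub>0 * e" using r0 e by (simp add: power2_eq_iff_nonneg)
      \<comment> \<open>Contact happens inside the ball, since
        \<open>\<epsilon> s \<le> \<epsilon> 0\<close>, so the truncated and the original equation
        coincide there.\<close>
      have "ball_retraction y (r\<^sub>0 * \<epsilon> 0) (z s) = z s"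
        using r0 e by (simp add: ball_retraction_def ns)
      then have zs: "(z has_vector_derivative rhs (z s) s) (at_right s)" using zd[OF s] by simp
      have "(\<epsilon> has_vector_derivative \<epsilon>' s) (at s within {0..})"
        using cond2_deriv[OF s(1)] by (simp add: has_real_derivative_iff_has_vector_derivative)
      then have "(\<epsilon> has_vector_derivative \<epsilon>' s) (at_right s)"
        by (rule has_vector_derivative_mono_filter) (use s in \<open>auto intro!: at_le\<close>)
      then have "((\<lambda>s. (\<epsilon> s)\<^sup>2) has_vector_derivative 2 * (\<epsilon> s * \<epsilon>' s)) (at_right s)"
        using has_vector_derivative_norm_squared[of \<epsilon>] by simp
      then have gd: "(g has_vector_derivative 2 * ((z s - y) \<bullet> rhs (z s) s) - r\<^sub>0\<^sup>2 * (2 * (e * \<epsilon>' s))) (at_right s)"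
        unfolding g_def[abs_def] e_def
        using has_vector_derivative_norm_squared[OF has_vector_derivative_diff[OF zs has_vector_derivative_const[of y]]]
        by (intro has_vector_derivative_diff has_vector_derivative_mult_right) simp_all
      have "(z s - y) \<bullet> rhs (z s) s \<le> norm (z s - y) * ((C - 1/2) * norm (z s - y)
        + (4 * N1 * N2 + N2 * sqrt e) / (4 * e) * (norm (z s - y))\<^sup>2 + norm (P e (y - z\<^sub>0) - (y - z\<^sub>0)))"
        unfolding rhs_def e_def[symmetric]
      proof (rule flow_dissipative[OF projector[OF e(1)] e(1) root _ _ C0 CP[OF e(3)]])
        show "P e (T \<xi> x) = T \<xi> (P e x)" for x
          unfolding P by (rule A.spectral_projector_commute[OF norm_T e(1)])
        show "e * (norm (P e x))\<^sup>2 \<le> T \<xi> (P e x) \<bullet> P e x" for x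
          unfolding P by (rule A.spectral_projector_lower[OF norm_T e(1)])
      qed
      also have "\<dots> \<le> r\<^sub>0 * e * (- \<gamma> * (r\<^sub>0 * e) + M / (4 * e) * (r\<^sub>0 * e)\<^sup>2 + c * e)"
        unfolding ns
      proof (intro mult_left_mono add_mono mult_right_mono divide_right_mono)
        show "C - 1/2 \<le> - \<gamma>" by (simp add: gamma)
        show "4 * N1 * N2 + N2 * sqrt e \<le> M" using e N2 by (simp add: M_def)
        show "norm (P e (y - z\<^sub>0) - (y - z\<^sub>0)) \<le> c * e" using \<alpha>[OF s(1)] by (simp add: alpha P_def e_def)
      qed (use r0 e in auto)
      also have "\<dots> = r\<^sub>0 * e\<^sup>2 * (- \<gamma> * r\<^sub>0 + M / 4 * r\<^sub>0\<^sup>2 + c)"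
        using e by (simp add: field_simps power2_eq_square)
      finally have 1: "(z s - y) \<bullet> rhs (z s) s \<le> r\<^sub>0 * e\<^sup>2 * (- \<gamma> * r\<^sub>0 + M / 4 * r\<^sub>0\<^sup>2 + c)" .
      \<comment> \<open>The barrier itself sinks, at a relative speed of at most
        \<open>\<gamma> - C\<^sub>0\<close>; this turns the decay rate \<open>\<gamma>\<close> into
        \<open>C\<^sub>0\<close>.\<close>
      have "- (e * \<epsilon>' s) \<le> e * (e * (\<gamma> - C\<^sub>0))"
      proof -
        have "\<bar>\<epsilon>' s\<bar> / e \<le> \<gamma> - C\<^sub>0" using rate[OF s(1)] by (simp add: e_def)
        then have "\<bar>\<epsilon>' s\<bar> \<le> e * (\<gamma> - C\<^sub>0)" using e by (simp add: pos_divide_le_eq mult.commute)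
        then have "- \<epsilon>' s \<le> e * (\<gamma> - C\<^sub>0)" by linarith
        from mult_left_mono[OF this, of e] show ?thesis using e by simp
      qed
      from mult_left_mono[OF this, of "r\<^sub>0\<^sup>2"]
      have 2: "- (r\<^sub>0\<^sup>2 * (e * \<epsilon>' s)) \<le> r\<^sub>0 * e\<^sup>2 * (r\<^sub>0 * (\<gamma> - C\<^sub>0))"
        by (simp add: power2_eq_square algebra_simps)
      have "2 * ((z s - y) \<bullet> rhs (z s) s) - r\<^sub>0\<^sup>2 * (2 * (e * \<epsilon>' s))
          \<le> 2 * (r\<^sub>0 * e\<^sup>2) * (- \<gamma> * r\<^sub>0 + M / 4 * r\<^sub>0\<^sup>2 + c + r\<^sub>0 * (\<gamma> - C\<^sub>0))"
        using 1 2 by (simp add: algebra_simps)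
      \<comment> \<open>The terms with \<open>\<gamma>\<close> cancel, and what remains is the
        parabola at its vertex, negative by \<open>cM\<close>.\<close>
      also have "- \<gamma> * r\<^sub>0 + M / 4 * r\<^sub>0\<^sup>2 + c + r\<^sub>0 * (\<gamma> - C\<^sub>0) = (M * c - C\<^sub>0\<^sup>2) / M"
        using M by (simp add: r\<^sub>0_def field_simps power2_eq_square)
      also have "2 * (r\<^sub>0 * e\<^sup>2) * ((M * c - C\<^sub>0\<^sup>2) / M) < 0"
        using r0 e M cM by (intro mult_pos_neg) (auto simp: divide_less_0_iff)
      finally show "\<exists>d<0. (g has_vector_derivative d) (at_right s)" using gd by blast
    qed
    then have "(norm (z t - y))\<^sup>2 \<le> (r\<^sub>0 * \<epsilon> t)\<^sup>2" by (simp add: g_def power_mult_distrib)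
    then show "norm (z t - y) \<le> r\<^sub>0 * \<epsilon> t"
      by (rule power2_le_imp_le) (use r0 eps_pos[of t] t in \<open>simp add: less_imp_le\<close>)
  qed
  then show ?thesis unfolding rhs r\<^sub>0_def M_def .
qed

end
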